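(* Let $\mathfrak{k}\subset\mathfrak{g}=\mathfrak{so}(8)$ be a subalgebra such that there are two commuting involutions $\sigma$ and $\tau$ of $\mathfrak{g}$, $\sigma\neq\tau$, with $\mathfrak{k}=\mathfrak{g}^{\sigma}\cap\mathfrak{g}^{\tau}$. Then there is an automorphism $\varphi$ of $\mathfrak{so}(8)$ such that $\varphi(\mathfrak{k})$ is one of the following subalgebras of $\mathfrak{so}(8)$: (1) $\mathfrak{so}(n_1)+\mathfrak{so}(n_2)+\mathfrak{so}(n_3)$, where $n_1+n_2+n_3=8$, $n_i\ge 1$; (2) $\mathfrak{so}(n_1)+\mathfrak{so}(n_2)+\mathfrak{so}(n_3)+\mathfrak{so}(n_4)$, where $n_1+n_2+n_3+n_4=8$, $n_i\ge 1$; (3) $\mathfrak{u}(3)+\mathfrak{u}(1)$.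
   Context: $\mathfrak{so}(8)$ is the compact real Lie algebra of skew-symmetric real $8\times 8$ matrices. An involution of a Lie algebra $\mathfrak{g}$ is an automorphism $\sigma\neq\mathrm{id}_{\mathfrak{g}}$ with $\sigma^2=\mathrm{id}_{\mathfrak{g}}$, and $\mathfrak{g}^{\sigma}=\{X\in\mathfrak{g}\mid\sigma(X)=X\}$. The automorphism $\varphi$ may be inner or outer. The subalgebras in (1) and (2) are the standard block-diagonal ones, with diagonal blocks of sizes $n_1,n_2,\dots$ (and $\mathfrak{so}(1)=0$). In (3), $\mathfrak{u}(4)$ is embedded in $\mathfrak{so}(8)$ as the set of matrices $\begin{pmatrix} A & -B \\ B & A \end{pmatrix}$, with $A,B$ real $4\times 4$ matrices such that $A+iB\in\mathfrak{u}(4)$ (so $A$ is skew-symmetric and $B$ is symmetric), and $\mathfrak{u}(3)+\mathfrak{u}(1)\subset\mathfrak{u}(4)\subset\mathfrak{so}(8)$ is the block-diagonal subalgebra with blocks of sizes $3$ and $1$. *)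

theory Defs
  imports Complex_Main "Jordan_Normal_Form.Matrix" "Jordan_Normal_Form.Schur_Decomposition"
begin

definition so_lie :: "nat \<Rightarrow> real mat set" where
  "so_lie n = {X \<in> carrier_mat n n. transpose_mat X = - X}"

definition u_lie :: "nat \<Rightarrow> complex mat set" where
  "u_lie n = {Z \<in> carrier_mat n n. mat_adjoint Z = - Z}"

definition lie_bracket :: "real mat \<Rightarrow> real mat \<Rightarrow> real mat" where
  "lie_bracket X Y = X * Y - Y * X"

text \<open>A real Lie algebra of matrices is given by its carrier set. Maps between such sets are
  total functions of which only the values on the carrier are relevant; in particular, equality
  of maps is always understood on the carrier.\<close>

definition lie_subalgebra :: "real mat set \<Rightarrow> real mat set \<Rightarrow> bool" where
  "lie_subalgebra k g \<longleftrightarrow> k \<subseteq> g \<and> k \<noteq> {} \<and>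
     (\<forall>X\<in>k. \<forall>Y\<in>k. X + Y \<in> k) \<and>
     (\<forall>c. \<forall>X\<in>k. c \<cdot>\<^sub>m X \<in> k) \<and>
     (\<forall>X\<in>k. \<forall>Y\<in>k. lie_bracket X Y \<in> k)"

definition lie_automorphism :: "real mat set \<Rightarrow> (real mat \<Rightarrow> real mat) \<Rightarrow> bool" where
  "lie_automorphism g \<phi> \<longleftrightarrow> bij_betw \<phi> g g \<and>
     (\<forall>X\<in>g. \<forall>Y\<in>g. \<phi> (X + Y) = \<phi> X + \<phi> Y) \<and>
     (\<forall>c. \<forall>X\<in>g. \<phi> (c \<cdot>\<^sub>m X) = c \<cdot>\<^sub>m \<phi> X) \<and>
     (\<forall>X\<in>g. \<forall>Y\<in>g. \<phi> (lie_bracket X Y) = lie_bracket (\<phi> X) (\<phi> Y))"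

definition lie_involution :: "real mat set \<Rightarrow> (real mat \<Rightarrow> real mat) \<Rightarrow> bool" where
  "lie_involution g \<sigma> \<longleftrightarrow> lie_automorphism g \<sigma> \<and>
     (\<exists>X\<in>g. \<sigma> X \<noteq> X) \<and> (\<forall>X\<in>g. \<sigma> (\<sigma> X) = X)"

definition fixed_subalgebra :: "real mat set \<Rightarrow> (real mat \<Rightarrow> real mat) \<Rightarrow> real mat set" where
  "fixed_subalgebra g \<sigma> = {X \<in> g. \<sigma> X = X}"

text \<open>\<open>block_sum [S\<^sub>1, \<dots>, S\<^sub>m]\<close> is the set of block-diagonal matrices whose \<open>i\<close>-th diagonal
  block ranges over \<open>S\<^sub>i\<close>.\<close>

definition block_sum :: "'a :: zero mat set list \<Rightarrow> 'a mat set" where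
  "block_sum Ss = {diag_block_mat As |As. list_all2 (\<in>) As Ss}"

text \<open>The embedding of complex into real matrices of twice the size, sending \<open>A + \<i> B\<close> with
  real \<open>A\<close> and \<open>B\<close> to the matrix with block rows \<open>(A, -B)\<close> and \<open>(B, A)\<close>.\<close>

definition realify :: "complex mat \<Rightarrow> real mat" where
  "realify Z = four_block_mat (map_mat Re Z) (- map_mat Im Z) (map_mat Im Z) (map_mat Re Z)"

end

theory Submission
  imports Defs
begin

text \<open>
  Every pair of commuting involutions of \<open>so(8)\<close> becomes, after an automorphism, a pair of
  conjugations by orthogonal matrices \<open>g\<close> and \<open>h\<close>; from there the statement is linear algebra
  and one more use of triality.

  To get there the automorphism group is determined as far as needed. An automorphism permutes the
  nonzero solutions \<open>X\<close> of \<open>(ad X)\<^sup>3 = - ad X\<close>. Partial traces of this identity show that a solution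
  either generates a rotation in a plane or is half an orthogonal complex structure
  (\<open>ad_cubic_cases\<close>). Let \<open>e i j\<close> generate the rotation in a coordinate plane. The brackets
  between the \<open>e 0 a\<close> force their images under an automorphism to be all of the first or all of
  the second kind (\<open>aut_dichotomy\<close>). If all are of the first kind, the seven image planes share a
  line and the automorphism is conjugation by an orthogonal matrix
  (\<open>aut_preserving_plane_rot\<close>). If all are of the second kind, doubling them gives seven
  anticommuting complex structures on \<open>\<real>\<^sup>8\<close>; up to signs of the seven there is only one such system
  up to conjugation, so the automorphism is triality up to orthogonal conjugation on both
  sides (\<open>aut_half_cs\<close>).

  Consequently the orthogonal conjugations have exactly three right cosets in the automorphism group
  (\<open>aut_three_cosets\<close>, \<open>cosets_distinct\<close>). Two commuting involutions act on these three cosets as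
  commuting maps of order at most two, so they fix a common coset, and conjugating by a
  representative of it makes both of them orthogonal conjugations
  (\<open>commuting_involutions_orthogonal\<close>).

  Now \<open>g\<^sup>2 = \<plusminus>1\<close>, \<open>h\<^sup>2 = \<plusminus>1\<close> and \<open>g h = \<plusminus>h g\<close>. If all three signs are positive, \<open>g\<close> and \<open>h\<close> are
  simultaneously diagonalisable and the common centraliser is a block sum of orthogonal algebras; at
  least three of the four joint eigenspaces are nonzero because the two involutions and their
  product are nontrivial (\<open>conj_standard_diagonal\<close>). Otherwise one of \<open>g\<close>, \<open>h\<close>, \<open>g h\<close> is a complex
  structure \<open>J\<close>. Triality combined with a conjugation sends \<open>J / 2\<close> to \<open>- e 0 1\<close>, and conjugation by
  \<open>J\<close>, which is \<open>1 + 2 (ad (J / 2))\<^sup>2\<close>, to conjugation by \<open>diag(-1, -1, 1, \<dots>, 1)\<close>; the second involution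
  then maps \<open>e 0 1\<close> to \<open>\<plusminus>e 0 1\<close>, so it is again conjugation by some orthogonal \<open>h'\<close>. If \<open>h'\<^sup>2 = 1\<close> the diagonal
  case applies; if \<open>h'\<^sup>2 = -1\<close> the common centraliser is \<open>u(3) + u(1)\<close> (\<open>conj_standard_complex\<close>).
\<close>

section \<open>The algebra of real 8 by 8 matrices\<close>

text \<open>As a type of its own, the set of 8 by 8 matrices is an instance of the class of real algebras,
  and ring normalisation applies without carrier conditions.\<close>

typedef mat8 = "carrier_mat 8 8 :: real mat set"
  by (rule exI[of _ "0\<^sub>m 8 8"]) simp

setup_lifting type_definition_mat8

instantiation mat8 :: real_algebra_1
begin

lift_definition zero_mat8 :: mat8 is "0\<^sub>m 8 8" by simp
lift_definition one_mat8 :: mat8 is "1\<^sub>m 8" by simp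
lift_definition plus_mat8 :: "mat8 \<Rightarrow> mat8 \<Rightarrow> mat8" is "(+)" by simp
lift_definition minus_mat8 :: "mat8 \<Rightarrow> mat8 \<Rightarrow> mat8" is "(-)"
  by (rule minus_carrier_mat)
lift_definition uminus_mat8 :: "mat8 \<Rightarrow> mat8" is "uminus" by simp
lift_definition times_mat8 :: "mat8 \<Rightarrow> mat8 \<Rightarrow> mat8" is "(*)" by simp
lift_definition scaleR_mat8 :: "real \<Rightarrow> mat8 \<Rightarrow> mat8" is "(\<cdot>\<^sub>m)" by simp

instance
proof
  fix a b c :: mat8 and r s :: real
  show "a + b + c = a + (b + c)" by transfer auto
  show "a + b = b + a" by transfer (rule comm_add_mat)
  show "0 + a = a" by transfer simp
  show "- a + a = 0" by transfer auto
  show "a - b = a + - b" by transfer auto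
  show "a * b * c = a * (b * c)" by transfer (rule assoc_mult_mat)
  show "1 * a = a" by transfer simp
  show "a * 1 = a" by transfer simp
  show "(a + b) * c = a * c + b * c" by transfer (rule add_mult_distrib_mat)
  show "a * (b + c) = a * b + a * c" by transfer (rule mult_add_distrib_mat)
  show "(0 :: mat8) \<noteq> 1"
  proof transfer
    have "(0\<^sub>m 8 8 :: real mat) $$ (0, 0) \<noteq> 1\<^sub>m 8 $$ (0, 0)" by simp
    thus "(0\<^sub>m 8 8 :: real mat) \<noteq> 1\<^sub>m 8" by metis
  qed
  show "r *\<^sub>R (a + b) = r *\<^sub>R a + r *\<^sub>R b" by transfer (rule add_smult_distrib_left_mat)
  show "(r + s) *\<^sub>R a = r *\<^sub>R a + s *\<^sub>R a" by transfer (rule add_smult_distrib_right_mat)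
  show "r *\<^sub>R s *\<^sub>R a = (r * s) *\<^sub>R a" by transfer (auto simp: algebra_simps)
  show "1 *\<^sub>R a = a" by transfer auto
  show "r *\<^sub>R a * b = r *\<^sub>R (a * b)" by transfer auto
  show "a * r *\<^sub>R b = r *\<^sub>R (a * b)" by transfer auto
qed

end

lift_definition tp :: "mat8 \<Rightarrow> mat8" is transpose_mat by simp
lift_definition ent :: "mat8 \<Rightarrow> nat \<Rightarrow> nat \<Rightarrow> real" is "\<lambda>A i j. A $$ (i, j)" .
lift_definition E :: "nat \<Rightarrow> nat \<Rightarrow> mat8" is
  "\<lambda>i j. mat 8 8 (\<lambda>(a, b). if a = i \<and> b = j then 1 else 0)" by simp
definition tr :: "mat8 \<Rightarrow> real" where "tr A = (\<Sum>i<8. ent A i i)"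

lemma mat8_eqI: "(\<And>i j. i < 8 \<Longrightarrow> j < 8 \<Longrightarrow> ent A i j = ent B i j) \<Longrightarrow> A = B"
  by transfer (auto intro: eq_matI)

lemma ent_simps [simp]:
  assumes "i < 8" "j < 8"
  shows "ent 0 i j = 0" "ent 1 i j = (if i = j then 1 else 0)"
    "ent (A + B) i j = ent A i j + ent B i j" "ent (A - B) i j = ent A i j - ent B i j"
    "ent (- A) i j = - ent A i j" "ent (c *\<^sub>R A) i j = c * ent A i j"
    "ent (tp A) i j = ent A j i" "ent (E k l) i j = (if i = k \<and> j = l then 1 else 0)"
  using assms by (transfer, auto)+

lemma ent_mult:
  assumes "i < 8" "j < 8"
  shows "ent (A * B) i j = (\<Sum>k<8. ent A i k * ent B k j)"
  using assms by transfer (auto simp: scalar_prod_def lessThan_atLeast0 intro!: sum.cong)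

lemma ent_sum: "i < 8 \<Longrightarrow> j < 8 \<Longrightarrow> ent (sum f S) i j = (\<Sum>x\<in>S. ent (f x) i j)"
  by (induction S rule: infinite_finite_induct) auto

lemma tp_simps [simp]:
  "tp 0 = 0" "tp 1 = 1" "tp (A + B) = tp A + tp B" "tp (A - B) = tp A - tp B"
  "tp (- A) = - tp A" "tp (c *\<^sub>R A) = c *\<^sub>R tp A" "tp (tp A) = A"
  by (auto intro!: mat8_eqI)

lemma tp_mult [simp]: "tp (A * B) = tp B * tp A"
  by (auto intro!: mat8_eqI simp: ent_mult mult.commute)

lemma tp_sum: "tp (sum f S) = (\<Sum>x\<in>S. tp (f x))"
  by (induction S rule: infinite_finite_induct) auto

lemma tp_E [simp]: "i < 8 \<Longrightarrow> j < 8 \<Longrightarrow> tp (E i j) = E j i"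
  by (auto intro!: mat8_eqI)

lemma tr_simps [simp]:
  "tr 0 = 0" "tr 1 = 8" "tr (A + B) = tr A + tr B" "tr (A - B) = tr A - tr B"
  "tr (- A) = - tr A" "tr (c *\<^sub>R A) = c * tr A" "tr (tp A) = tr A"
  by (auto simp: tr_def sum.distrib sum_subtractf sum_negf sum_distrib_left)

lemma tr_commute: "tr (A * B) = tr (B * A)"
  unfolding tr_def by (simp add: ent_mult, subst sum.swap, simp add: mult.commute)

lemma tr_tp_mult: "tr (tp A * A) = (\<Sum>i<8. \<Sum>k<8. (ent A k i)\<^sup>2)"
  by (simp add: tr_def ent_mult power2_eq_square)

lemma tr_tp_nonneg: "tr (tp A * A) \<ge> 0"
  by (simp add: tr_tp_mult sum_nonneg)

lemma tr_tp_eq_0 [simp]: "tr (tp A * A) = 0 \<longleftrightarrow> A = 0"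
proof
  assume "tr (tp A * A) = 0"
  hence "\<forall>i<8. \<forall>k<8. (ent A k i)\<^sup>2 = 0"
    unfolding tr_tp_mult by (simp add: sum_nonneg sum_nonneg_eq_0_iff)
  thus "A = 0" by (auto intro!: mat8_eqI)
qed auto

lemma tp_mult_eq_0 [simp]: "tp A * A = 0 \<longleftrightarrow> A = 0"
  by (metis mult_zero_right tr_simps(1) tr_tp_eq_0)

lemma E_mult_E [simp]:
  "i < 8 \<Longrightarrow> j < 8 \<Longrightarrow> k < 8 \<Longrightarrow> l < 8 \<Longrightarrow> E i j * E k l = (if j = k then E i l else 0)"
  by (rule mat8_eqI) (auto simp: ent_mult if_distrib cong: if_cong)

lemma tr_E [simp]: "i < 8 \<Longrightarrow> j < 8 \<Longrightarrow> tr (E i j) = (if i = j then 1 else 0)"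
  by (auto simp: tr_def)

lemma E_mult_ent:
  "i < 8 \<Longrightarrow> j < 8 \<Longrightarrow> k < 8 \<Longrightarrow> l < 8 \<Longrightarrow> E i j * (A * E k l) = ent A j k *\<^sub>R E i l"
  by (rule mat8_eqI) (auto simp: ent_mult if_distrib[where f = "\<lambda>x. x * _"]
      if_distrib[where f = "\<lambda>x. _ * x"] cong: if_cong)

lemma mat8_expand: "A = (\<Sum>i<8. \<Sum>j<8. ent A i j *\<^sub>R E i j)"
proof (rule mat8_eqI)
  fix k l :: nat assume kl: "k < 8" "l < 8"
  have "ent (\<Sum>i<8. \<Sum>j<8. ent A i j *\<^sub>R E i j) k l =
      (\<Sum>i<8. \<Sum>j<8. ent A i j * (if k = i \<and> l = j then 1 else 0))"
    using kl by (simp add: ent_sum)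
  also have "\<dots> = (\<Sum>i<8. \<Sum>j<8. if l = j then if k = i then ent A i j else 0 else 0)"
    by (intro sum.cong refl) auto
  also have "\<dots> = ent A k l" using kl by simp
  finally show "ent A k l = ent (\<Sum>i<8. \<Sum>j<8. ent A i j *\<^sub>R E i j) k l" by simp
qed

lemma sum_E_diag: "(\<Sum>i<8. E i i) = 1"
  by (rule mat8_eqI) (auto simp: ent_sum)

definition so8 :: "mat8 set" where "so8 = {X. tp X = - X}"
definition O8 :: "mat8 set" where "O8 = {g. tp g * g = 1}"

lemma O8_right: "g \<in> O8 \<Longrightarrow> g * tp g = 1"
  unfolding O8_def mem_Collect_eq by transfer (rule mat_mult_left_right_inverse; simp)

section \<open>Elements with cubic adjoint action\<close>

definition br :: "mat8 \<Rightarrow> mat8 \<Rightarrow> mat8" where "br X Y = X * Y - Y * X"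

lemma so8_iff: "X \<in> so8 \<longleftrightarrow> tp X = - X" by (simp add: so8_def)

lemma so8_closed [intro, simp]:
  "0 \<in> so8" "X \<in> so8 \<Longrightarrow> Y \<in> so8 \<Longrightarrow> X + Y \<in> so8" "X \<in> so8 \<Longrightarrow> Y \<in> so8 \<Longrightarrow> X - Y \<in> so8"
  "X \<in> so8 \<Longrightarrow> - X \<in> so8" "X \<in> so8 \<Longrightarrow> c *\<^sub>R X \<in> so8"
  "X \<in> so8 \<Longrightarrow> Y \<in> so8 \<Longrightarrow> br X Y \<in> so8"
  by (auto simp: so8_iff br_def)

lemma sum_E_times_tp: "(\<Sum>i<8. \<Sum>j<8. E i j * (B * E i j)) = tp B"
proof -
  have "(\<Sum>i<8. \<Sum>j<8. E i j * (B * E i j)) = (\<Sum>i<8. \<Sum>j<8. ent (tp B) i j *\<^sub>R E i j)"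
    by (intro sum.cong refl) (simp add: E_mult_ent)
  thus ?thesis using mat8_expand[of "tp B"] by simp
qed

lemma sum_E_times_tr: "(\<Sum>i<8. \<Sum>j<8. E i j * (B * E j i)) = tr B *\<^sub>R 1"
proof -
  have "(\<Sum>i<8. \<Sum>j<8. E i j * (B * E j i)) = (\<Sum>i<8. \<Sum>j<8. ent B j j *\<^sub>R E i i)"
    by (intro sum.cong refl) (simp add: E_mult_ent)
  also have "\<dots> = (\<Sum>i<8. tr B *\<^sub>R E i i)" by (simp add: tr_def scaleR_sum_left)
  also have "\<dots> = tr B *\<^sub>R 1" by (simp flip: scaleR_sum_right add: sum_E_diag)
  finally show ?thesis .
qed

text \<open>Multiplying an identity that is linear in a skew matrix by \<open>E j i\<close> on the right, and summing over
  all basis matrices \<open>E i j - E j i\<close>, eliminates the skew matrix: this is the rule for one summand.\<close>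

lemma contraction:
  "(\<Sum>i<8. \<Sum>j<8. P * ((E i j - E j i) * (Q * E j i))) = tr Q *\<^sub>R P - P * tp Q"
proof -
  have "(\<Sum>i<8. \<Sum>j<8. P * ((E i j - E j i) * (Q * E j i))) =
     P * (\<Sum>i<8. \<Sum>j<8. E i j * (Q * E j i)) - P * (\<Sum>i<8. \<Sum>j<8. E j i * (Q * E j i))"
    by (simp add: algebra_simps sum_subtractf sum_distrib_left)
  also have "(\<Sum>i<8. \<Sum>j<8. E j i * (Q * E j i)) = tp Q"
    by (subst sum.swap) (rule sum_E_times_tp)
  finally show ?thesis by (simp add: sum_E_times_tr)
qed

definition e :: "nat \<Rightarrow> nat \<Rightarrow> mat8" where "e i j = E i j - E j i"

lemma e_so8 [simp]: "i < 8 \<Longrightarrow> j < 8 \<Longrightarrow> e i j \<in> so8"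
  by (simp add: e_def so8_iff)

text \<open>The condition says that \<open>ad X\<close> has eigenvalues in \<open>{0, i, -i}\<close>; up to conjugation these are
  the minuscule coweights of \<open>so(8)\<close>, which triality permutes.\<close>

definition ad_cubic :: "mat8 \<Rightarrow> bool" where
  "ad_cubic X \<longleftrightarrow> X \<in> so8 \<and> X \<noteq> 0 \<and> (\<forall>Y\<in>so8. br X (br X (br X Y)) = - br X Y)"

lemma scaleR_as_sum:
  fixes A :: mat8
  shows "2 *\<^sub>R A = A + A" "3 *\<^sub>R A = A + A + A" "8 *\<^sub>R A = A + A + A + A + A + A + A + A"
proof -
  show 2: "2 *\<^sub>R A = A + A" for A :: mat8 by (rule scaleR_2)
  have "3 *\<^sub>R A = (2 + 1) *\<^sub>R A" by simp
  thus "3 *\<^sub>R A = A + A + A" unfolding scaleR_add_left 2 by simp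
  have "8 *\<^sub>R A = 2 *\<^sub>R 2 *\<^sub>R 2 *\<^sub>R A" by simp
  thus "8 *\<^sub>R A = A + A + A + A + A + A + A + A" unfolding 2 by (simp add: add.assoc)
qed

text \<open>Written out, \<open>(ad X)\<^sup>3 + ad X\<close> is a sum of maps \<open>Y \<mapsto> P * Y * Q\<close>; applying the contraction rule to
  \<open>P * Y * (Q * S)\<close> for each of them leaves an identity in \<open>X\<close> and \<open>S\<close> alone.\<close>

lemma ad_cubic_contract:
  assumes X: "ad_cubic X" and S: "tp S = S" "X * S = S * X"
  shows "tr S *\<^sub>R X^3 - 8 *\<^sub>R (X^3 * S) + (3 * tr (X^2 * S) + tr S) *\<^sub>R X - 2 *\<^sub>R (X * S) = 0"
proof -
  have sk: "tp X = - X" using X by (simp add: ad_cubic_def so8_iff)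
  have SX: "S * (X * A) = X * (S * A)" "S * X = X * S" for A
    using S(2) by (simp_all flip: mult.assoc)
  have id: "X^3 * Y - 3 *\<^sub>R (X^2 * Y * X) + 3 *\<^sub>R (X * Y * X^2) - Y * X^3 + X * Y - Y * X = 0"
    if "Y \<in> so8" for Y
  proof -
    have "br X (br X (br X Y)) + br X Y = 0" using X that by (simp add: ad_cubic_def)
    thus ?thesis
      by (simp add: br_def algebra_simps power3_eq_cube power2_eq_square scaleR_as_sum)
  qed
  let ?c = "\<lambda>P Q. \<Sum>i<8. \<Sum>j<8. P * ((E i j - E j i) * (Q * E j i))"
  have "?c (X^3) S - 3 *\<^sub>R ?c (X^2) (X * S) + 3 *\<^sub>R ?c X (X^2 * S) - ?c 1 (X^3 * S) + ?c X S - ?c 1 (X * S)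
    = (\<Sum>i<8. \<Sum>j<8. (X^3 * e i j - 3 *\<^sub>R (X^2 * e i j * X) + 3 *\<^sub>R (X * e i j * X^2) - e i j * X^3
        + X * e i j - e i j * X) * (S * E j i))"
    by (simp add: e_def algebra_simps sum_subtractf sum.distrib scaleR_sum_right)
  also have "\<dots> = 0" by (intro sum.neutral ballI) (simp add: id)
  finally have eq: "tr S *\<^sub>R X^3 - X^3 * tp S - 3 *\<^sub>R (tr (X * S) *\<^sub>R X^2 - X^2 * tp (X * S))
     + 3 *\<^sub>R (tr (X^2 * S) *\<^sub>R X - X * tp (X^2 * S)) - (tr (X^3 * S) *\<^sub>R 1 - 1 * tp (X^3 * S))
     + (tr S *\<^sub>R X - X * tp S) - (tr (X * S) *\<^sub>R 1 - 1 * tp (X * S)) = 0"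
    by (simp only: contraction)
  \<comment> \<open>traces of odd powers of a skew matrix vanish\<close>
  have odd: "tr Z = 0" if "tp Z = - Z" for Z
    using tr_simps(7)[of Z] that by (simp del: tr_simps(7))
  have t: "tp (X * S) = - (X * S)" "tp (X^2 * S) = X^2 * S" "tp (X^3 * S) = - (X^3 * S)"
    using S sk SX by (simp_all add: power3_eq_cube power2_eq_square mult.assoc)
  have "tr (X * S) = 0" "tr (X^3 * S) = 0" using odd t by auto
  with eq show ?thesis unfolding t S(1)
    by (simp add: algebra_simps power3_eq_cube power2_eq_square scaleR_as_sum)
qed

text \<open>On such an \<open>X\<close> the matrix \<open>- X\<^sup>2\<close> is an orthogonal projection of rank two, the projection onto the
  plane that \<open>X\<close> rotates.\<close>

definition plane_rot :: "mat8 \<Rightarrow> bool" where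
  "plane_rot X \<longleftrightarrow> X \<in> so8 \<and> X^3 = - X \<and> tr (X^2) = -2"

definition half_cs :: "mat8 \<Rightarrow> bool" where
  "half_cs X \<longleftrightarrow> X \<in> so8 \<and> X^2 = - ((1/4) *\<^sub>R 1)"

text \<open>The contractions with \<open>S = 1\<close>, \<open>X\<^sup>2\<close> and \<open>X\<^sup>4\<close> give relations between the power traces of \<open>X\<close>
  that leave a quadratic equation for \<open>tr (X\<^sup>4)\<close>.\<close>

lemma ad_cubic_traces:
  assumes X: "ad_cubic X"
  shows "tr (X^2) = -2" and "tr (X^4) = 1/2 \<or> tr (X^4) = 2"
    and "8 *\<^sub>R X^5 + 4 *\<^sub>R X^3 = (3 * tr (X^4) - 2) *\<^sub>R X"
proof -
  have sk: "tp X = - X" and nz: "X \<noteq> 0" using X by (auto simp: ad_cubic_def so8_iff)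
  have mp: "X * X^n = X^(n + 1)" "X^n * X = X^(n + 1)" "X^m * X^n = X^(m + n)" "X * X = X^2" for m n
    by (simp_all add: power_add power_commutes power2_eq_square)
  have tp2: "tp (X^2) = X^2" using sk by (simp add: power2_eq_square)
  have X4: "X^4 = X^2 * X^2" by (simp add: mp)
  have tp4: "tp (X^4) = X^4" unfolding X4 tp_mult tp2 ..
  have "(3 * tr (X^2) + 6) *\<^sub>R X = 0"
    using ad_cubic_contract[OF X, of 1] by (simp add: algebra_simps flip: scaleR_add_left)
  thus t: "tr (X^2) = -2" using nz by simp
  have E2: "- 2 *\<^sub>R X^3 - 8 *\<^sub>R X^5 + (3 * tr (X^4) - 2) *\<^sub>R X - 2 *\<^sub>R X^3 = 0"
    using ad_cubic_contract[OF X, of "X^2"] tp2 t by (simp add: mp)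
  show "8 *\<^sub>R X^5 + 4 *\<^sub>R X^3 = (3 * tr (X^4) - 2) *\<^sub>R X"
    using E2 by (simp add: algebra_simps flip: scaleR_add_left)
  have E4: "tr (X^4) *\<^sub>R X^3 - 8 *\<^sub>R X^7 + (3 * tr (X^6) + tr (X^4)) *\<^sub>R X - 2 *\<^sub>R X^5 = 0"
    using ad_cubic_contract[OF X, of "X^4"] tp4 t by (simp add: mp)
  have "tr ((- 2 *\<^sub>R X^3 - 8 *\<^sub>R X^5 + (3 * tr (X^4) - 2) *\<^sub>R X - 2 *\<^sub>R X^3) * X) = 0"
    unfolding E2 by simp
  hence a: "- 4 * tr (X^4) - 8 * tr (X^6) - 2 * (3 * tr (X^4) - 2) = 0"
    using t by (simp add: algebra_simps mp)
  have "tr ((- 2 *\<^sub>R X^3 - 8 *\<^sub>R X^5 + (3 * tr (X^4) - 2) *\<^sub>R X - 2 *\<^sub>R X^3) * X^3) = 0"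
    unfolding E2 by simp
  hence b: "- 4 * tr (X^6) - 8 * tr (X^8) + (3 * tr (X^4) - 2) * tr (X^4) = 0"
    by (simp add: algebra_simps mp)
  have "tr ((tr (X^4) *\<^sub>R X^3 - 8 *\<^sub>R X^7 + (3 * tr (X^6) + tr (X^4)) *\<^sub>R X - 2 *\<^sub>R X^5) * X) = 0"
    unfolding E4 by simp
  hence c: "tr (X^4) * tr (X^4) - 8 * tr (X^8) - 2 * (3 * tr (X^6) + tr (X^4)) - 2 * tr (X^6) = 0"
    using t by (simp add: algebra_simps mp)
  define q where "q = tr (X^4)"
  have p6: "tr (X^6) = 1/2 - 5/4 * q" using a unfolding q_def by argo
  have p8: "8 * tr (X^8) = (3 * q - 2) * q - 2 + 5 * q" using b p6 unfolding q_def by linarith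
  have "(2 * q - 1) * (q - 2) = 0"
    using c p8 p6 unfolding q_def[symmetric] by (simp add: algebra_simps)
  thus "tr (X^4) = 1/2 \<or> tr (X^4) = 2" unfolding q_def by auto
qed

lemma symm_sq_zero: "tp A = A \<Longrightarrow> tr (A * A) = 0 \<Longrightarrow> A = 0"
  using tr_tp_eq_0[of A] by simp

text \<open>The two roots of the quadratic equation for \<open>tr (X\<^sup>4)\<close> correspond to the two kinds of \<open>X\<close>. The degree five
  relation for \<open>X\<close> factors, and skewness of \<open>X\<close> removes the repeated or positive factor.\<close>

lemma ad_cubic_cases:
  assumes X: "ad_cubic X"
  shows "plane_rot X \<or> half_cs X"
proof -
  have so: "X \<in> so8" and sk: "tp X = - X" using X by (auto simp: ad_cubic_def so8_iff)
  have tp2: "tp (X^2) = X^2" and tp3: "tp (X^3) = - (X^3)"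
    using sk by (simp_all add: power2_eq_square power3_eq_cube mult.assoc)
  note t = ad_cubic_traces(1)[OF X] and E = ad_cubic_traces(3)[OF X]
  have mp: "X * X^n = X^(n + 1)" "X^n * X = X^(n + 1)" "X^m * X^n = X^(m + n)" "X * X = X^2" for m n
    by (simp_all add: power_add power_commutes power2_eq_square)
  from ad_cubic_traces(2)[OF X] show ?thesis
  proof
    assume q: "tr (X^4) = 1/2"
    \<comment> \<open>the relation reads \<open>X (4 X\<^sup>2 + 1)\<^sup>2 = 0\<close>; skew matrices have no nilpotent part\<close>
    let ?N = "4 *\<^sub>R X^3 + X"
    have "?N * ?N = (2 *\<^sub>R X) * (8 *\<^sub>R X^5 + 4 *\<^sub>R X^3 + (1/2) *\<^sub>R X)"
      by (simp add: algebra_simps mp flip: scaleR_add_left)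
    also have "\<dots> = 0" using E q by simp
    finally have NN: "?N * ?N = 0" .
    have "tp ?N = - ?N" using tp3 sk by simp
    hence "tp ?N * ?N = 0" by (simp only: mult_minus_left NN minus_zero)
    hence N: "?N = 0" unfolding tp_mult_eq_0 .
    \<comment> \<open>a symmetric idempotent of trace zero vanishes\<close>
    let ?R = "4 *\<^sub>R X^2 + 1"
    have "?R * ?R = (4 *\<^sub>R X) * ?N + ?R"
      by (simp add: algebra_simps mp flip: scaleR_add_left)
    hence "?R = 0" using N t tp2 by (intro symm_sq_zero) simp_all
    hence "4 *\<^sub>R X^2 = - 1" by (simp add: eq_neg_iff_add_eq_0)
    hence "(1/4) *\<^sub>R (4 *\<^sub>R X^2) = - ((1/4) *\<^sub>R 1)" by simp
    thus ?thesis using so by (simp add: half_cs_def)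
  next
    assume q: "tr (X^4) = 2"
    \<comment> \<open>the relation reads \<open>(2 X\<^sup>2 - 1) ?M = 0\<close>, and \<open>2 X\<^sup>2 - 1\<close> is negative definite\<close>
    let ?M = "X^3 + X"
    have tpM: "tp ?M = - ?M" using tp3 sk by simp
    have X2M: "X^2 * ?M = X^5 + X^3" by (simp add: distrib_left mp)
    have 84: "8 *\<^sub>R X^3 = 4 *\<^sub>R X^3 + 4 *\<^sub>R X^3" by (simp flip: scaleR_add_left)
    have "8 *\<^sub>R (X^2 * ?M) - 4 *\<^sub>R ?M = 8 *\<^sub>R X^5 + 4 *\<^sub>R X^3 - 4 *\<^sub>R X"
      unfolding X2M scaleR_add_right 84 by simp
    also have "\<dots> = 0" using E q by simp
    finally have "(1/4) *\<^sub>R (8 *\<^sub>R (X^2 * ?M) - 4 *\<^sub>R ?M) = (1/4) *\<^sub>R 0" by simp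
    hence M: "?M = 2 *\<^sub>R (X^2 * ?M)" by (simp add: scaleR_diff_right)
    have "tp ?M * ?M = 2 *\<^sub>R (tp ?M * X^2 * ?M)" by (subst (2) M) (simp add: mult.assoc)
    also have "tp ?M * X^2 * ?M = - (tp (X * ?M) * (X * ?M))"
      using sk by (simp add: power2_eq_square mult.assoc)
    finally have "tr (tp ?M * ?M) = - 2 * tr (tp (X * ?M) * (X * ?M))" by simp
    hence "tr (tp ?M * ?M) = 0" using tr_tp_nonneg[of ?M] tr_tp_nonneg[of "X * ?M"] by linarith
    hence "?M = 0" unfolding tr_tp_eq_0 .
    thus ?thesis using so t by (simp add: plane_rot_def eq_neg_iff_add_eq_0)
  qed
qed

lemma not_plane_rot_half_cs: "plane_rot X \<Longrightarrow> \<not> half_cs X"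
proof
  assume a: "plane_rot X" "half_cs X"
  have "X^3 = X^2 * X" by (simp add: power3_eq_cube power2_eq_square)
  hence "- X = - ((1/4) *\<^sub>R X)" using a by (simp add: plane_rot_def half_cs_def)
  hence "1 *\<^sub>R X = (1/4) *\<^sub>R X" by (simp only: scaleR_one neg_equal_iff_equal)
  hence "X = 0" unfolding scaleR_cancel_right by simp
  thus False using a by (simp add: plane_rot_def)
qed

lemma plane_rot_proj:
  assumes "plane_rot X"
  defines "P \<equiv> - (X^2)"
  shows "tp P = P" "P * P = P" "tr P = 2" "P * X = X" "X * P = X" "X * X = - P"
proof -
  have s: "tp X = - X" and c: "X * (X * X) = - X" and t: "tr (X * X) = -2"
    using assms(1) by (auto simp: plane_rot_def so8_iff power3_eq_cube power2_eq_square mult.assoc)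
  have c': "X * (X * (X * A)) = - (X * A)" for A
    using arg_cong[OF c, of "\<lambda>z. z * A"] by (simp add: mult.assoc)
  show "tp P = P" "P * P = P" "tr P = 2" "P * X = X" "X * P = X" "X * X = - P"
    by (simp_all add: P_def s c t c' power2_eq_square mult.assoc)
qed

text \<open>The bracket relation says that \<open>Y\<close> spans with \<open>X\<close> a copy of \<open>so(3)\<close> in which it is orthogonal to \<open>X\<close>.
  In blocks with respect to the plane of \<open>X\<close>, the equation kills both diagonal blocks of \<open>Y\<close>.\<close>

lemma compression:
  assumes X: "plane_rot X" and rel: "br X (br X Y) = - Y"
  defines "P \<equiv> - (X^2)"
  shows "P * (Y * P) = 0" "Y = P * Y + Y * P"
proof -
  note p = plane_rot_proj[OF X, folded P_def]
  have pp: "P * (P * A) = P * A" "P * (X * A) = X * A" "X * (P * A) = X * A" "X * (X * A) = - (P * A)" for A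
    using p by (simp_all flip: mult.assoc)
  have R: "P * Y + 2 *\<^sub>R (X * (Y * X)) + Y * P = Y"
    using rel by (simp add: br_def algebra_simps p pp scaleR_2 eq_neg_iff_add_eq_0 add_eq_0_iff2)
  have "P * (P * Y + 2 *\<^sub>R (X * (Y * X)) + Y * P) * P = P * Y * P" unfolding R ..
  hence 1: "P * (Y * P) = - 2 *\<^sub>R (X * (Y * X))"
    by (simp add: algebra_simps p pp scaleR_2 eq_neg_iff_add_eq_0)
  have "X * (Y * X) = X * (P * (Y * P)) * X" by (simp add: p pp mult.assoc)
  also have "\<dots> = - 2 *\<^sub>R (X * (X * (Y * X)) * X)" unfolding 1 by (simp add: mult.assoc)
  also have "\<dots> = - 2 *\<^sub>R (P * (Y * P))" by (simp add: mult.assoc p pp)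
  finally have XYX: "X * (Y * X) = - 2 *\<^sub>R (P * (Y * P))" .
  have "P * (Y * P) = 4 *\<^sub>R (P * (Y * P))" by (subst 1, subst XYX) simp
  hence "(4 - 1) *\<^sub>R (P * (Y * P)) = 0" unfolding scaleR_diff_left by simp
  thus 0: "P * (Y * P) = 0" by simp
  hence "X * (Y * X) = 0" using 1 by simp
  thus "Y = P * Y + Y * P" using R by simp
qed

text \<open>Half the squared norm of \<open>Y\<close> would lie in the two rows of the plane of \<open>X\<close>, while for half a
  complex structure those two rows carry a quarter of it.\<close>

lemma plane_rot_not_linked_half_cs:
  assumes X: "plane_rot X" and Y: "half_cs Y" and rel: "br X (br X Y) = - Y"
  shows False
proof -
  define P where "P = - (X^2)"
  note p = plane_rot_proj[OF X, folded P_def] and c = compression[OF X rel, folded P_def]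
  have YY: "Y * Y = - ((1/4) *\<^sub>R 1)" using Y by (simp add: half_cs_def power2_eq_square)
  have "tr (Y * Y) = tr ((P * Y + Y * P) * Y)" using c(2) by simp
  also have "\<dots> = 2 * tr (P * (Y * Y))"
    using tr_commute[of "Y * P" Y] tr_commute[of "Y * Y" P] by (simp add: algebra_simps)
  also have "\<dots> = - 1" using p by (simp add: YY)
  finally show False by (simp add: YY)
qed

section \<open>Automorphisms, orthogonal conjugations and columns\<close>

text \<open>Homomorphisms are kept apart from automorphisms because triality is seen to be bijective only by
  comparing its square, a homomorphism, with the identity on generators.\<close>

definition hom8 :: "(mat8 \<Rightarrow> mat8) \<Rightarrow> bool" where
  "hom8 \<phi> \<longleftrightarrow> (\<forall>X\<in>so8. \<phi> X \<in> so8) \<and> (\<forall>X\<in>so8. \<forall>Y\<in>so8. \<phi> (X + Y) = \<phi> X + \<phi> Y) \<and>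
     (\<forall>c. \<forall>X\<in>so8. \<phi> (c *\<^sub>R X) = c *\<^sub>R \<phi> X) \<and>
     (\<forall>X\<in>so8. \<forall>Y\<in>so8. \<phi> (br X Y) = br (\<phi> X) (\<phi> Y))"

lemma homD:
  assumes "hom8 \<phi>"
  shows "X \<in> so8 \<Longrightarrow> \<phi> X \<in> so8"
    "X \<in> so8 \<Longrightarrow> Y \<in> so8 \<Longrightarrow> \<phi> (X + Y) = \<phi> X + \<phi> Y"
    "X \<in> so8 \<Longrightarrow> \<phi> (c *\<^sub>R X) = c *\<^sub>R \<phi> X"
    "X \<in> so8 \<Longrightarrow> Y \<in> so8 \<Longrightarrow> \<phi> (br X Y) = br (\<phi> X) (\<phi> Y)"
    "\<phi> 0 = 0" "X \<in> so8 \<Longrightarrow> \<phi> (- X) = - \<phi> X"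
proof -
  show sc: "X \<in> so8 \<Longrightarrow> \<phi> (c *\<^sub>R X) = c *\<^sub>R \<phi> X" for X c using assms by (simp add: hom8_def)
  show "\<phi> 0 = 0" "X \<in> so8 \<Longrightarrow> \<phi> (- X) = - \<phi> X" using sc[of 0 0] sc[of X "-1"] by simp_all
qed (use assms in \<open>simp_all add: hom8_def\<close>)

definition aut :: "(mat8 \<Rightarrow> mat8) \<Rightarrow> bool" where
  "aut \<phi> \<longleftrightarrow> bij_betw \<phi> so8 so8 \<and> (\<forall>X\<in>so8. \<forall>Y\<in>so8. \<phi> (X + Y) = \<phi> X + \<phi> Y) \<and>
     (\<forall>c. \<forall>X\<in>so8. \<phi> (c *\<^sub>R X) = c *\<^sub>R \<phi> X) \<and>
     (\<forall>X\<in>so8. \<forall>Y\<in>so8. \<phi> (br X Y) = br (\<phi> X) (\<phi> Y))"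

lemma autD:
  assumes "aut \<phi>"
  shows "bij_betw \<phi> so8 so8" "X \<in> so8 \<Longrightarrow> \<phi> X \<in> so8"
    "X \<in> so8 \<Longrightarrow> Y \<in> so8 \<Longrightarrow> \<phi> (X + Y) = \<phi> X + \<phi> Y"
    "X \<in> so8 \<Longrightarrow> \<phi> (c *\<^sub>R X) = c *\<^sub>R \<phi> X"
    "X \<in> so8 \<Longrightarrow> Y \<in> so8 \<Longrightarrow> \<phi> (br X Y) = br (\<phi> X) (\<phi> Y)"
  using assms by (auto simp: aut_def bij_betw_def)

lemma aut_lin:
  assumes "aut \<phi>"
  shows "\<phi> 0 = 0" "X \<in> so8 \<Longrightarrow> \<phi> (- X) = - \<phi> X"
    "X \<in> so8 \<Longrightarrow> Y \<in> so8 \<Longrightarrow> \<phi> X = \<phi> Y \<longleftrightarrow> X = Y"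
    "Y \<in> so8 \<Longrightarrow> \<exists>X\<in>so8. Y = \<phi> X"
  using autD(4)[OF assms, of 0 0] autD(4)[OF assms, of X "-1"] autD(1)[OF assms]
  by (auto simp: bij_betw_def inj_on_def)

lemma so8_sum: "(\<And>x. x \<in> S \<Longrightarrow> f x \<in> so8) \<Longrightarrow> sum f S \<in> so8"
  by (induction S rule: infinite_finite_induct) auto

lemma so8_ent: "X \<in> so8 \<Longrightarrow> k < 8 \<Longrightarrow> l < 8 \<Longrightarrow> ent X l k = - ent X k l"
  by (metis ent_simps(5,7) so8_iff)

lemma aut_hom: "aut \<phi> \<Longrightarrow> hom8 \<phi>"
  unfolding hom8_def by (simp add: autD)

lemma aut_iff_hom: "aut \<phi> \<longleftrightarrow> bij_betw \<phi> so8 so8 \<and> hom8 \<phi>"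
  unfolding aut_def hom8_def bij_betw_def by auto

lemma hom_comp: "hom8 \<phi> \<Longrightarrow> hom8 \<psi> \<Longrightarrow> hom8 (\<phi> \<circ> \<psi>)"
  by (simp add: hom8_def)

lemma hom_sum:
  assumes "hom8 \<phi>" "\<And>x. x \<in> S \<Longrightarrow> f x \<in> so8"
  shows "\<phi> (sum f S) = (\<Sum>x\<in>S. \<phi> (f x))"
  using assms(2)
  by (induction S rule: infinite_finite_induct)
    (auto simp: homD[OF assms(1)] so8_sum)

lemma aut_id: "aut id" by (auto simp: aut_def)

lemma aut_comp: "aut \<phi> \<Longrightarrow> aut \<psi> \<Longrightarrow> aut (\<phi> \<circ> \<psi>)"
  unfolding aut_def by (auto intro: bij_betw_trans simp: bij_betwE)

lemma aut_inv:
  assumes "aut \<phi>"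
  shows "aut (inv_into so8 \<phi>)" "X \<in> so8 \<Longrightarrow> inv_into so8 \<phi> (\<phi> X) = X"
    "X \<in> so8 \<Longrightarrow> \<phi> (inv_into so8 \<phi> X) = X"
proof -
  have b: "bij_betw \<phi> so8 so8" using assms by (rule autD)
  have bi: "bij_betw (inv_into so8 \<phi>) so8 so8" using b by (rule bij_betw_inv_into)
  have l: "inv_into so8 \<phi> (\<phi> X) = X" if "X \<in> so8" for X
    using b that by (simp add: bij_betw_inv_into_left)
  have r: "\<phi> (inv_into so8 \<phi> X) = X" if "X \<in> so8" for X
    using b that by (simp add: bij_betw_inv_into_right)
  have m: "inv_into so8 \<phi> X \<in> so8" if "X \<in> so8" for X using bi that by (auto simp: bij_betw_def)
  define f where "f = inv_into so8 \<phi>"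
  note lmr = l[folded f_def] m[folded f_def] r[folded f_def]
  have "f (X + Y) = f X + f Y" "f (br X Y) = br (f X) (f Y)" "f (c *\<^sub>R X) = c *\<^sub>R f X"
    if "X \<in> so8" "Y \<in> so8" for X Y c
  proof -
    have "\<phi> (f X + f Y) = X + Y" "\<phi> (br (f X) (f Y)) = br X Y" "\<phi> (c *\<^sub>R f X) = c *\<^sub>R X"
      using that by (simp_all add: autD(3-5)[OF assms] lmr)
    moreover have "f X + f Y \<in> so8" "br (f X) (f Y) \<in> so8" "c *\<^sub>R f X \<in> so8"
      using that by (simp_all add: lmr)
    ultimately show "f (X + Y) = f X + f Y" "f (br X Y) = br (f X) (f Y)" "f (c *\<^sub>R X) = c *\<^sub>R f X"
      using lmr(1) by metis+
  qed
  thus "aut (inv_into so8 \<phi>)" using bi unfolding aut_def f_def[symmetric] by simp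
  show "X \<in> so8 \<Longrightarrow> inv_into so8 \<phi> (\<phi> X) = X" "X \<in> so8 \<Longrightarrow> \<phi> (inv_into so8 \<phi> X) = X"
    using l r by auto
qed

lemma O8_simps:
  assumes "g \<in> O8"
  shows "tp g * g = 1" "g * tp g = 1" "tp g * (g * A) = A" "g * (tp g * A) = A"
  using assms O8_right[OF assms] by (simp_all add: O8_def flip: mult.assoc)

lemma O8_closed: "1 \<in> O8" "g \<in> O8 \<Longrightarrow> h \<in> O8 \<Longrightarrow> g * h \<in> O8" "g \<in> O8 \<Longrightarrow> tp g \<in> O8"
proof -
  show "g * h \<in> O8" if "g \<in> O8" "h \<in> O8"
    using O8_simps[OF that(1)] O8_simps[OF that(2)] by (simp add: O8_def mult.assoc)
qed (auto simp: O8_def O8_right)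

definition Ad :: "mat8 \<Rightarrow> mat8 \<Rightarrow> mat8" where "Ad g X = g * X * tp g"

lemma Ad_Ad: "Ad g (Ad h X) = Ad (g * h) X" by (simp add: Ad_def mult.assoc)

lemma Ad_inverse: "g \<in> O8 \<Longrightarrow> Ad g (Ad (tp g) X) = X" "g \<in> O8 \<Longrightarrow> Ad (tp g) (Ad g X) = X"
  by (simp_all add: Ad_def mult.assoc O8_simps)

lemma aut_Ad: assumes g: "g \<in> O8" shows "aut (Ad g)"
proof -
  have so: "Ad h X \<in> so8" if "X \<in> so8" for X h
    using that by (simp add: so8_iff Ad_def mult.assoc)
  have "bij_betw (Ad g) so8 so8"
    by (rule bij_betwI[of _ _ _ "Ad (tp g)"]) (auto simp: so Ad_inverse[OF g])
  thus ?thesis using O8_simps[OF g] by (auto simp: aut_def Ad_def br_def algebra_simps)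
qed

text \<open>A vector of \<open>\<real>\<^sup>8\<close> is represented by the matrix having it as first column and zeros elsewhere, so
  that \<open>tp u * v\<close> is the inner product times \<open>E 0 0\<close> and \<open>u * tp v\<close> the rank one matrix.\<close>

definition unit_col :: "mat8 \<Rightarrow> bool" where "unit_col u \<longleftrightarrow> u * E 0 0 = u \<and> tp u * u = E 0 0"

lemma col_product:
  assumes "u * E 0 0 = u" "v * E 0 0 = v"
  shows "tp u * v = tr (tp u * v) *\<^sub>R E 0 0" "tp u * A * v = tr (tp u * A * v) *\<^sub>R E 0 0"
proof -
  have *: "tp u * A * v = tr (tp u * A * v) *\<^sub>R E 0 0" for A
  proof -
    have "tp u * A * v = tp (u * E 0 0) * A * (v * E 0 0)" using assms by simp
    also have "\<dots> = ent (tp u * A * v) 0 0 *\<^sub>R E 0 0"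
      by (simp add: mult.assoc flip: E_mult_ent)
    finally have 1: "tp u * A * v = ent (tp u * A * v) 0 0 *\<^sub>R E 0 0" .
    have "tr (tp u * A * v) = ent (tp u * A * v) 0 0" by (subst 1) simp
    with 1 show ?thesis by simp
  qed
  show "tp u * A * v = tr (tp u * A * v) *\<^sub>R E 0 0" by (rule *)
  show "tp u * v = tr (tp u * v) *\<^sub>R E 0 0" using *[of 1] by simp
qed

lemma skew_form_zero:
  assumes "tp A = - A" "u * E 0 0 = u"
  shows "tp u * (A * u) = 0"
proof -
  have t: "tp (tp u * A * u) = - (tp u * A * u)" using assms(1) by (simp add: mult.assoc)
  have "tr (tp u * A * u) = - tr (tp u * A * u)"
    using tr_simps(7)[of "tp u * A * u"] unfolding t tr_simps(5) by simp
  hence "tr (tp u * A * u) = 0" by simp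
  thus ?thesis using col_product(2)[OF assms(2) assms(2), of A] by (simp add: mult.assoc)
qed

lemma ex_unit_col:
  assumes "A \<noteq> 0"
  obtains B where "unit_col (A * B)"
proof -
  obtain i where i: "i < 8" "A * E i 0 \<noteq> 0"
  proof (rule ccontr)
    assume "\<not> thesis"
    hence 0: "A * E i 0 = 0" if "i < 8" for i using \<open>i < 8 \<Longrightarrow> A * E i 0 \<noteq> 0 \<Longrightarrow> thesis\<close> that that by auto
    have "A = A * (\<Sum>i<8. E i i)" by (simp add: sum_E_diag)
    also have "\<dots> = (\<Sum>i<8. A * E i 0 * E 0 i)" by (simp add: sum_distrib_left mult.assoc)
    finally show False using 0 assms by simp
  qed
  define w where "w = A * E i 0"
  define c where "c = tr (tp w * w)"
  have w0: "w * E 0 0 = w" using i by (simp add: w_def mult.assoc)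
  have c: "c > 0" using tr_tp_nonneg[of w] i(2) tr_tp_eq_0[of w] unfolding c_def w_def by linarith
  have ww: "tp w * w = c *\<^sub>R E 0 0" using col_product(1)[OF w0 w0] by (simp add: c_def)
  have "unit_col ((1 / sqrt c) *\<^sub>R w)"
    using c by (simp add: unit_col_def w0 ww flip: power2_eq_square)
  hence "unit_col (A * ((1 / sqrt c) *\<^sub>R E i 0))" by (simp add: w_def)
  thus ?thesis by (rule that)
qed

definition frame :: "(nat \<Rightarrow> mat8) \<Rightarrow> mat8" where "frame f = (\<Sum>i<8. f i * E 0 i)"

definition onb :: "(nat \<Rightarrow> mat8) \<Rightarrow> bool" where
  "onb f \<longleftrightarrow> (\<forall>i<8. f i * E 0 0 = f i) \<and> (\<forall>i<8. \<forall>j<8. tp (f i) * f j = (if i = j then E 0 0 else 0))"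

lemma frame_E:
  assumes "onb f" "i < 8"
  shows "frame f * E i 0 = f i" "j < 8 \<Longrightarrow> frame f * E i j = f i * E 0 j"
proof -
  have *: "frame f * E i j = f i * E 0 j" if j: "j < 8" for j
  proof -
    have "frame f * E i j = (\<Sum>k<8. f k * (E 0 k * E i j))"
      by (simp add: frame_def sum_distrib_right mult.assoc)
    also have "\<dots> = (\<Sum>k<8. if k = i then f k * E 0 j else 0)"
      using assms j by (intro sum.cong refl) auto
    also have "\<dots> = f i * E 0 j" using assms by simp
    finally show ?thesis .
  qed
  show "j < 8 \<Longrightarrow> frame f * E i j = f i * E 0 j" by (rule *)
  show "frame f * E i 0 = f i" using *[of 0] assms by (simp add: onb_def)
qed

lemma frame_O8:
  assumes "onb f"
  shows "frame f \<in> O8"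
proof -
  have "tp (frame f) * frame f = (\<Sum>i<8. \<Sum>j<8. E i 0 * (tp (f i) * f j) * E 0 j)"
    by (simp add: frame_def tp_sum sum_product mult.assoc)
  also have "\<dots> = (\<Sum>i<8. \<Sum>j<8. if i = j then E i i else 0)"
    using assms by (intro sum.cong refl) (auto simp: onb_def)
  also have "\<dots> = (\<Sum>i<8. E i i)" by simp
  finally show ?thesis by (simp add: O8_def sum_E_diag)
qed

lemma Ad_frame:
  assumes f: "onb f" and "i < 8" "j < 8"
  shows "Ad (frame f) (E i j) = f i * tp (f j)"
proof -
  have "Ad (frame f) (E i j) = frame f * E i 0 * tp (frame f * E j 0)"
    using assms by (simp add: Ad_def mult.assoc del: tp_mult) (simp add: mult.assoc flip: mult.assoc[of "E i 0" "E 0 j"])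
  also have "\<dots> = f i * tp (f j)" using assms by (simp only: frame_E(1)[OF f])
  finally show ?thesis .
qed

lemma so8_expand: "X \<in> so8 \<Longrightarrow> X = (\<Sum>i<8. \<Sum>j<8. (ent X i j / 2) *\<^sub>R e i j)"
proof (rule mat8_eqI)
  fix k l :: nat assume X: "X \<in> so8" and kl: "k < 8" "l < 8"
  have "ent X l k = - ent X k l" using X kl by (rule so8_ent)
  hence "ent X k l = (1/2) * ent (X - tp X) k l" using kl by simp
  also have "X - tp X = (\<Sum>i<8. \<Sum>j<8. ent X i j *\<^sub>R e i j)"
    by (subst (1 2) mat8_expand[of X]) (simp add: tp_sum e_def sum_subtractf scaleR_diff_right)
  also have "(1/2) * ent (\<Sum>i<8. \<Sum>j<8. ent X i j *\<^sub>R e i j) k l =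
      ent (\<Sum>i<8. \<Sum>j<8. (ent X i j / 2) *\<^sub>R e i j) k l"
    using kl by (simp add: ent_sum sum_distrib_left)
  finally show "ent X k l = ent (\<Sum>i<8. \<Sum>j<8. (ent X i j / 2) *\<^sub>R e i j) k l" .
qed

lemma e_swap: "e j i = - e i j" and e_same [simp]: "e i i = 0" by (simp_all add: e_def)

lemma br_e0: "a < 8 \<Longrightarrow> b < 8 \<Longrightarrow> a \<noteq> 0 \<Longrightarrow> b \<noteq> 0 \<Longrightarrow> br (e 0 a) (e 0 b) = e b a"
  by (auto simp: br_def e_def algebra_simps)

text \<open>The \<open>e 0 a\<close> generate \<open>so(8)\<close>, since their brackets are the other \<open>e i j\<close>.\<close>

lemma hom_eqI:
  assumes \<phi>: "hom8 \<phi>" and \<psi>: "hom8 \<psi>" and eq: "\<And>a. a \<in> {1..7} \<Longrightarrow> \<phi> (e 0 a) = \<psi> (e 0 a)"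
    and X: "X \<in> so8"
  shows "\<phi> X = \<psi> X"
proof -
  have ee: "\<phi> (e i j) = \<psi> (e i j)" if "i < 8" "j < 8" for i j
  proof -
    consider "i = 0" "j = 0" | "i = 0" "j \<noteq> 0" | "i \<noteq> 0" "j = 0" | "i \<noteq> 0" "j \<noteq> 0" by blast
    thus ?thesis
    proof cases
      case 3
      have "\<phi> (- e 0 i) = \<psi> (- e 0 i)"
        using that 3 eq[of i] by (simp only: homD[OF \<phi>] homD[OF \<psi>] e_so8) auto
      thus ?thesis using 3 e_swap[of 0 i] by simp
    next
      case 4
      have "\<phi> (br (e 0 j) (e 0 i)) = \<psi> (br (e 0 j) (e 0 i))"
        using that 4 eq[of i] eq[of j] by (simp add: homD[OF \<phi>] homD[OF \<psi>])
      thus ?thesis using 4 that by (simp add: br_e0)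
    qed (use eq[of j] that in \<open>auto simp: homD[OF \<phi>] homD[OF \<psi>]\<close>)
  qed
  have "\<chi> (\<Sum>i<8. \<Sum>j<8. (ent X i j / 2) *\<^sub>R e i j) =
      (\<Sum>i<8. \<Sum>j<8. (ent X i j / 2) *\<^sub>R \<chi> (e i j))" if "hom8 \<chi>" for \<chi>
  proof -
    have "\<chi> (\<Sum>i<8. \<Sum>j<8. (ent X i j / 2) *\<^sub>R e i j) =
        (\<Sum>i<8. \<chi> (\<Sum>j<8. (ent X i j / 2) *\<^sub>R e i j))"
      by (rule hom_sum[OF that]) (intro so8_sum so8_closed e_so8, auto)
    also have "\<dots> = (\<Sum>i<8. \<Sum>j<8. \<chi> ((ent X i j / 2) *\<^sub>R e i j))"
      by (intro sum.cong refl hom_sum[OF that] so8_closed e_so8) auto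
    also have "\<dots> = (\<Sum>i<8. \<Sum>j<8. (ent X i j / 2) *\<^sub>R \<chi> (e i j))"
      by (intro sum.cong refl homD(3)[OF that] e_so8) auto
    finally show ?thesis .
  qed
  note sums = this[OF \<phi>] this[OF \<psi>]
  have "\<phi> (\<Sum>i<8. \<Sum>j<8. (ent X i j / 2) *\<^sub>R e i j) = \<psi> (\<Sum>i<8. \<Sum>j<8. (ent X i j / 2) *\<^sub>R e i j)"
    unfolding sums by (intro sum.cong refl) (auto simp: ee)
  thus ?thesis using so8_expand[OF X] by simp
qed

lemma aut_eqI:
  assumes "aut \<phi>" "aut \<psi>" "\<And>a. a \<in> {1..7} \<Longrightarrow> \<phi> (e 0 a) = \<psi> (e 0 a)" "X \<in> so8"
  shows "\<phi> X = \<psi> X"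
  using hom_eqI[OF aut_hom aut_hom] assms by blast

lemma plane_rot_e: "i < 8 \<Longrightarrow> j < 8 \<Longrightarrow> i \<noteq> j \<Longrightarrow> plane_rot (e i j)"
  by (simp add: plane_rot_def) (simp add: e_def power3_eq_cube power2_eq_square algebra_simps)

text \<open>Compressing a skew form to a plane leaves a multiple of the rotation of that plane.\<close>

lemma e_sandwich:
  assumes "i < 8" "j < 8" "Y \<in> so8"
  shows "e i j * (Y * e i j) = (- ent Y i j) *\<^sub>R e i j"
proof -
  note sk = so8_ent[OF assms(3)]
  have "ent Y k k = 0" if "k < 8" for k using sk[OF that that] by simp
  thus ?thesis using assms by (simp add: e_def algebra_simps E_mult_ent sk[of i j])
qed

lemma ad_cubic_e: assumes "i < 8" "j < 8" "i \<noteq> j" shows "ad_cubic (e i j)"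
proof -
  have sq: "e i j * e i j = - E i i - E j j" using assms by (simp add: e_def algebra_simps)
  have cube: "e i j * (e i j * e i j) = - e i j" "e i j * (e i j * (e i j * A)) = - (e i j * A)" for A
  proof -
    show *: "e i j * (e i j * e i j) = - e i j"
      using plane_rot_e[OF assms] by (simp add: plane_rot_def power3_eq_cube mult.assoc)
    show "e i j * (e i j * (e i j * A)) = - (e i j * A)"
      using arg_cong[OF *, of "\<lambda>z. z * A"] by (simp add: mult.assoc)
  qed
  have "br (e i j) (br (e i j) (br (e i j) Y)) = - br (e i j) Y" if Y: "Y \<in> so8" for Y
  proof -
    note c = e_sandwich[OF assms(1,2) Y]
    have c': "e i j * (Y * (e i j * A)) = (- ent Y i j) *\<^sub>R (e i j * A)" for A
      using arg_cong[OF c, of "\<lambda>z. z * A"] by (simp add: mult.assoc)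
    show ?thesis by (simp add: br_def algebra_simps cube c c')
  qed
  moreover have "e i j \<noteq> 0" using plane_rot_e[OF assms] by (auto simp: plane_rot_def)
  ultimately show ?thesis using assms by (simp add: ad_cubic_def)
qed

lemma ad_cubic_image:
  assumes \<phi>: "aut \<phi>" and X: "ad_cubic X"
  shows "ad_cubic (\<phi> X)"
proof -
  have so: "X \<in> so8" "X \<noteq> 0" using X by (auto simp: ad_cubic_def)
  have "br (\<phi> X) (br (\<phi> X) (br (\<phi> X) Y)) = - br (\<phi> X) Y" if "Y \<in> so8" for Y
  proof -
    obtain Z where Z: "Z \<in> so8" "Y = \<phi> Z" using aut_lin(4)[OF \<phi> \<open>Y \<in> so8\<close>] by blast
    have "\<phi> (br X (br X (br X Z))) = \<phi> (- br X Z)" using X Z by (simp add: ad_cubic_def)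
    thus ?thesis using so Z by (simp add: autD[OF \<phi>] aut_lin[OF \<phi>])
  qed
  moreover have "\<phi> X \<noteq> 0" using aut_lin(3)[OF \<phi> so(1), of 0] so aut_lin(1)[OF \<phi>] by simp
  ultimately show ?thesis using so by (simp add: ad_cubic_def autD[OF \<phi>])
qed

lemma e0_linked:
  assumes \<phi>: "aut \<phi>" and "a < 8" "b < 8" "a \<noteq> 0" "b \<noteq> 0" "a \<noteq> b"
  shows "br (\<phi> (e 0 a)) (br (\<phi> (e 0 a)) (\<phi> (e 0 b))) = - \<phi> (e 0 b)"
proof -
  have "br (e 0 a) (br (e 0 a) (e 0 b)) = - e 0 b"
    using assms by (simp add: br_def e_def algebra_simps)
  from arg_cong[OF this, of \<phi>] show ?thesis using assms by (simp add: autD[OF \<phi>] aut_lin[OF \<phi>])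
qed

text \<open>Any two of the \<open>e 0 a\<close> are linked by the relation of \<open>compression\<close>, in either order, so their images cannot be
  of different kinds.\<close>

lemma aut_dichotomy:
  assumes \<phi>: "aut \<phi>"
  shows "(\<forall>a\<in>{1..7}. plane_rot (\<phi> (e 0 a))) \<or> (\<forall>a\<in>{1..7}. half_cs (\<phi> (e 0 a)))"
proof (rule ccontr)
  assume "\<not> ?thesis"
  then obtain a b where ab: "a \<in> {1..7}" "b \<in> {1..7}" "\<not> half_cs (\<phi> (e 0 a))" "\<not> plane_rot (\<phi> (e 0 b))" by blast
  have t: "plane_rot (\<phi> (e 0 c)) \<or> half_cs (\<phi> (e 0 c))" if "c \<in> {1..7}" for c
    using that by (intro ad_cubic_cases ad_cubic_image[OF \<phi>] ad_cubic_e) auto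
  have "plane_rot (\<phi> (e 0 a))" "half_cs (\<phi> (e 0 b))" using t ab by blast+
  moreover from this have "a \<noteq> b" using not_plane_rot_half_cs by auto
  ultimately show False
    using ab plane_rot_not_linked_half_cs e0_linked[OF \<phi>, of a b] by auto
qed

section \<open>Automorphisms preserving rotations of planes\<close>

definition orth_proj :: "mat8 \<Rightarrow> bool" where "orth_proj P \<longleftrightarrow> tp P = P \<and> P * P = P"

lemma orth_proj_tr0: "orth_proj P \<Longrightarrow> tr P = 0 \<Longrightarrow> P = 0"
  by (rule symm_sq_zero) (auto simp: orth_proj_def)

lemma orth_proj_tr_nonneg: "orth_proj P \<Longrightarrow> tr P \<ge> 0"
  using tr_tp_nonneg[of P] by (simp add: orth_proj_def)

lemma orth_proj_mult: "orth_proj P \<Longrightarrow> orth_proj Q \<Longrightarrow> P * Q = Q * P \<Longrightarrow> orth_proj (P * Q)"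
  unfolding orth_proj_def by (metis mult.assoc tp_mult)

lemma orth_proj_compl: "orth_proj P \<Longrightarrow> orth_proj (1 - P)"
  by (simp add: orth_proj_def algebra_simps)

lemma unit_col_simps:
  assumes "unit_col u"
  shows "u * E 0 0 = u" "tp u * u = E 0 0" "E 0 0 * tp u = tp u" "tp u * (u * A) = E 0 0 * A"
    "u * (E 0 0 * A) = u * A" "tr (u * tp u) = 1" "u \<noteq> 0"
proof -
  show *: "u * E 0 0 = u" "tp u * u = E 0 0" using assms by (auto simp: unit_col_def)
  show "E 0 0 * tp u = tp u" using arg_cong[OF *(1), of tp] by simp
  show "tp u * (u * A) = E 0 0 * A" "u * (E 0 0 * A) = u * A" using * by (simp_all flip: mult.assoc)
  show "tr (u * tp u) = 1" by (subst tr_commute) (simp add: *)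
  thus "u \<noteq> 0" by auto
qed

lemma orth_proj_fixed_unit_col:
  assumes "orth_proj P" "P \<noteq> 0"
  obtains u where "unit_col u" "P * u = u"
proof -
  obtain B where "unit_col (P * B)" using ex_unit_col[OF assms(2)] by blast
  moreover have "P * (P * B) = P * B" using assms by (simp add: orth_proj_def flip: mult.assoc)
  ultimately show ?thesis by (rule that)
qed

lemma orth_proj_minus_unit_col:
  assumes P: "orth_proj P" and u: "unit_col u" "P * u = u"
  shows "orth_proj (P - u * tp u)" "tr (P - u * tp u) = tr P - 1"
proof -
  have "tp u * P = tp u" using arg_cong[OF u(2), of tp] P by (simp add: orth_proj_def)
  moreover have "P * (u * A) = u * A" for A using u by (simp flip: mult.assoc)
  ultimately show "orth_proj (P - u * tp u)"
    using P unit_col_simps[OF u(1)] by (simp add: orth_proj_def algebra_simps)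
  show "tr (P - u * tp u) = tr P - 1" using unit_col_simps[OF u(1)] by simp
qed

lemma orth_proj_rank1:
  assumes "orth_proj U" "tr U = 1"
  obtains u where "unit_col u" "U = u * tp u"
proof -
  have "U \<noteq> 0" using assms by auto
  then obtain u where u: "unit_col u" "U * u = u" using orth_proj_fixed_unit_col assms(1) by blast
  have "U - u * tp u = 0"
    using orth_proj_minus_unit_col[OF assms(1) u] assms(2) by (intro orth_proj_tr0) auto
  thus ?thesis using u that by simp
qed

text \<open>The two planes meet perpendicularly in a line.\<close>

lemma plane_rot_linked_projs:
  assumes X: "plane_rot X" and Y: "plane_rot Y" and rel: "br X (br X Y) = - Y"
  shows "X^2 * Y^2 = Y^2 * X^2" "tr (X^2 * Y^2) = 1"
proof -
  define P where "P = - (X^2)"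
  note c = compression(2)[OF X rel, folded P_def]
  have PY: "P * Y = Y - Y * P" using c by (simp add: algebra_simps)
  have "P * (Y * Y) = (Y - Y * P) * Y" by (simp flip: PY mult.assoc)
  also have "\<dots> = Y * Y - Y * (P * Y)" by (simp add: algebra_simps)
  also have "\<dots> = Y * Y * P" unfolding PY by (simp add: algebra_simps)
  finally have com: "P * (Y * Y) = Y * Y * P" .
  thus "X^2 * Y^2 = Y^2 * X^2" by (simp add: P_def power2_eq_square[of Y])
  have "tr (Y * Y) = tr (P * Y * Y) + tr (Y * (P * Y))"
    by (subst (1) c) (simp add: algebra_simps)
  also have "tr (Y * (P * Y)) = tr (P * Y * Y)" by (rule tr_commute)
  finally have "tr (P * (Y * Y)) = -1" using Y by (simp add: plane_rot_def power2_eq_square mult.assoc)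
  thus "tr (X^2 * Y^2) = 1" by (simp add: P_def power2_eq_square[of Y])
qed

lemma plane_rot_orth_proj: "plane_rot X \<Longrightarrow> orth_proj (- (X^2))"
  using plane_rot_proj[of X] by (simp add: orth_proj_def)

text \<open>Think of \<open>A\<close>, \<open>B\<close>, \<open>C\<close> as planes that pairwise meet perpendicularly in a line. Either all three
  share a line, or they are the coordinate planes of a three-dimensional space. The second case is excluded by
  the witness \<open>T\<close>: it commutes with \<open>A\<close> and \<open>B\<close>, hence would commute with \<open>C\<close>, but it is off-diagonal with respect to \<open>C\<close>.\<close>

lemma meeting_plane:
  assumes A: "orth_proj A" "tr A = 2" and B: "orth_proj B" "tr B = 2" and C: "orth_proj C" "tr C = 2"
    and AB: "A * B = B * A" "tr (A * B) = 1"
    and AC: "A * C = C * A" "tr (A * C) = 1"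
    and BC: "B * C = C * B" "tr (B * C) = 1"
    and TA: "A * T = T * A" and TB: "B * T = T * B"
    and TC: "C * (T * C) = 0" "T = C * T + T * C" and T: "T \<noteq> 0"
  shows "C * (A * B) = A * B"
proof -
  obtain u where u: "unit_col u" "A * B = u * tp u"
    using orth_proj_rank1[OF orth_proj_mult[OF A(1) B(1) AB(1)] AB(2)] by blast
  note us = unit_col_simps[OF u(1)]
  define l where "l = tr (tp u * C * u)"
  have com: "C * (A * B) = A * B * C" using AC BC by (metis mult.assoc)
  have "C * u = C * (A * B) * u" using us by (simp add: u(2) mult.assoc)
  also have "\<dots> = A * B * C * u" unfolding com ..
  also have "\<dots> = u * (tp u * C * u)" unfolding u(2) by (simp add: mult.assoc)
  also have "\<dots> = l *\<^sub>R u"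
    by (subst col_product(2)[OF us(1) us(1)]) (simp add: l_def us)
  finally have Cu: "C * u = l *\<^sub>R u" .
  have "C * (C * u) = C * u" using C by (simp add: orth_proj_def flip: mult.assoc)
  hence "(l * l) *\<^sub>R u = l *\<^sub>R u" by (simp add: Cu)
  hence "l = 0 \<or> l = 1" using us(7) by auto
  moreover have "l \<noteq> 0"
  proof
    assume "l = 0"
    hence CAB: "C * (A * B) = 0" using Cu u(2) by (simp flip: mult.assoc)
    hence ABC: "A * (B * C) = 0" using com by (simp add: mult.assoc)
    \<comment> \<open>a projection, of trace \<open>2 - 1 - 1 + 0\<close>\<close>
    have three: "X * ((1 - Y) * (1 - Z)) = 0"
      if "orth_proj X" "tr X = 2" "orth_proj Y" "orth_proj Z" "X * Y = Y * X" "X * Z = Z * X" "Y * Z = Z * Y"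
        "tr (X * Y) = 1" "tr (X * Z) = 1" "X * (Y * Z) = 0" for X Y Z
    proof (rule orth_proj_tr0)
      have "(1 - Y) * (1 - Z) = (1 - Z) * (1 - Y)" using that by (simp add: algebra_simps)
      hence "orth_proj ((1 - Y) * (1 - Z))" using that by (intro orth_proj_mult orth_proj_compl)
      moreover have "X * ((1 - Y) * (1 - Z)) = ((1 - Y) * (1 - Z)) * X"
        using that by (simp add: algebra_simps) (metis mult.assoc)
      ultimately show "orth_proj (X * ((1 - Y) * (1 - Z)))" using that orth_proj_mult by blast
      show "tr (X * ((1 - Y) * (1 - Z))) = 0" using that by (simp add: algebra_simps)
    qed
    have "C * ((1 - A) * (1 - B)) = 0" using A B C AB AC BC CAB by (intro three) simp_all
    hence 1: "C = C * A + C * B" using CAB by (simp add: algebra_simps)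
    have "A * ((1 - B) * (1 - C)) = 0" using A B C AB AC BC ABC by (intro three) simp_all
    hence 2: "C * A = A - A * B" using ABC AC by (simp add: algebra_simps)
    have BAC: "B * (A * C) = 0" using ABC AB by (metis mult.assoc)
    have "B * ((1 - A) * (1 - C)) = 0" using A B C AB AC BC BAC by (intro three) simp_all
    hence 3: "C * B = B - A * B" using BAC BC AB by (simp add: algebra_simps)
    \<comment> \<open>the planes lie in a common three-dimensional space\<close>
    have C': "C = A + B - A * B - A * B" using 1 2 3 by simp
    have ABT: "A * (T * B) = T * (A * B)" using TA by (metis mult.assoc)
    have CT: "C * T = T * C" unfolding C' by (simp add: algebra_simps TA TB ABT)
    have "C * T = C * (C * T)" using C by (simp add: orth_proj_def flip: mult.assoc)
    also have "\<dots> = 0" using TC(1) CT by simp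
    finally show False using TC(2) T CT by simp
  qed
  ultimately have "C * u = u" using Cu by simp
  thus ?thesis unfolding u(2) by (simp flip: mult.assoc)
qed

lemma commute_square: "X * T = T * X \<Longrightarrow> X^2 * T = T * X^2" for X :: mat8
  by (metis mult.assoc power2_eq_square)

text \<open>The planes of the images of the \<open>e 0 a\<close> all contain a common unit vector \<open>u\<close>; conjugation by the
  orthogonal matrix with columns \<open>u\<close> and \<open>- \<phi> (e 0 a) * u\<close> agrees with \<open>\<phi>\<close> on the generators.\<close>

lemma aut_preserving_plane_rot:
  assumes \<phi>: "aut \<phi>" and 1: "plane_rot (\<phi> (e 0 1))"
  obtains g where "g \<in> O8" "\<And>X. X \<in> so8 \<Longrightarrow> \<phi> X = Ad g X"
proof -
  define F where "F a = \<phi> (e 0 a)" for a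
  define P where "P a = - ((F a)^2)" for a
  have rot: "plane_rot (F a)" if "a \<in> {1..7}" for a
    using aut_dichotomy[OF \<phi>] 1 not_plane_rot_half_cs[OF 1] that unfolding F_def by force
  have sk: "tp (F a) = - F a" if "a \<in> {1..7}" for a using rot[OF that] by (simp add: plane_rot_def so8_iff)
  note p = plane_rot_proj[OF rot, folded P_def]
  have sp: "orth_proj (P a)" if "a \<in> {1..7}" for a using plane_rot_orth_proj[OF rot[OF that]] by (simp add: P_def)
  have link: "br (F a) (br (F a) (F b)) = - F b" if "a \<in> {1..7}" "b \<in> {1..7}" "a \<noteq> b" for a b
    using that e0_linked[OF \<phi>, of a b] by (simp add: F_def)
  have PP: "P a * P b = P b * P a" "tr (P a * P b) = 1" if "a \<in> {1..7}" "b \<in> {1..7}" "a \<noteq> b" for a b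
    using plane_rot_linked_projs[OF rot[OF that(1)] rot[OF that(2)] link[OF that]] by (simp_all add: P_def)
  obtain u where u: "unit_col u" "P 1 * P 2 = u * tp u"
    using orth_proj_rank1[OF orth_proj_mult[OF sp sp] PP(2)[of 1 2]] PP(1)[of 1 2] by auto
  note us = unit_col_simps[OF u(1)]
  have PUU: "P c * (P 1 * P 2) = P 1 * P 2" if c: "c \<in> {1..7}" for c
  proof (cases "c = 1 \<or> c = 2")
    case True
    thus ?thesis using p(2)[of 1] p(2)[of 2] PP(1)[of 1 2] by (auto simp flip: mult.assoc) (simp add: mult.assoc)
  next
    case False
    \<comment> \<open>\<open>e c d\<close> commutes with \<open>e 0 1\<close> and \<open>e 0 2\<close> but not with \<open>e 0 c\<close>, so its image is a witness for \<open>meeting_plane\<close>\<close>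
    define d :: nat where "d = (if c = 3 then 4 else 3)"
    have cd: "c < 8" "d < 8" "c \<noteq> 0" "c \<noteq> 1" "c \<noteq> 2" "d \<noteq> 0" "d \<noteq> 1" "d \<noteq> 2" "c \<noteq> d"
      using c False by (auto simp: d_def)
    define T where "T = \<phi> (e c d)"
    have com: "F a * T = T * F a" if "a = 1 \<or> a = 2" for a
    proof -
      have "br (e 0 a) (e c d) = 0" using that cd by (auto simp: br_def e_def algebra_simps)
      from arg_cong[OF this, of \<phi>] have "br (F a) T = 0"
        using that cd by (auto simp: F_def T_def autD[OF \<phi>] aut_lin[OF \<phi>])
      thus ?thesis by (simp add: br_def)
    qed
    have "br (e 0 c) (br (e 0 c) (e c d)) = - e c d" using cd by (simp add: br_def e_def algebra_simps)
    from arg_cong[OF this, of \<phi>] have "br (F c) (br (F c) T) = - T"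
      using cd by (simp add: F_def T_def autD[OF \<phi>] aut_lin[OF \<phi>])
    note comp = compression[OF rot[OF c] this, folded P_def]
    have "e c d \<noteq> 0" using ad_cubic_e[of c d] cd by (auto simp: ad_cubic_def)
    hence "T \<noteq> 0" using aut_lin(3)[OF \<phi>, of "e c d" 0] cd by (simp add: T_def aut_lin[OF \<phi>])
    moreover have "P 1 * T = T * P 1" "P 2 * T = T * P 2"
      using com[of 1] com[of 2] by (simp_all add: P_def commute_square)
    ultimately show ?thesis
      using c cd comp p(3) sp PP by (intro meeting_plane[where T = T]) auto
  qed
  have Pu: "P c * u = u" if "c \<in> {1..7}" for c
  proof -
    have "u = P 1 * P 2 * u" unfolding u(2) using us by (simp add: mult.assoc)
    thus ?thesis using PUU[OF that] by (metis mult.assoc)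
  qed
  have FFu: "F c * (F c * u) = - u" if "c \<in> {1..7}" for c
    using p(6)[OF that] Pu[OF that] by (simp flip: mult.assoc)
  have FFuA: "F c * (F c * (u * A)) = - (u * A)" if "c \<in> {1..7}" for A c
    using arg_cong[OF FFu[OF that], of "\<lambda>z. z * A"] by (simp add: mult.assoc)
  have uF0: "tp u * (F c * u) = 0" if "c \<in> {1..7}" for c
    using skew_form_zero[OF sk[OF that] us(1)] .
  define f where "f c = (if c = 0 then u else - (F c * u))" for c
  have "onb f"
  proof -
    have "tp (F c * u) * (F d * u) = (if c = d then E 0 0 else 0)" if c: "c \<in> {1..7}" and d: "d \<in> {1..7}" for c d
    proof (cases "c = d")
      case True
      thus ?thesis using FFu[OF d] us by (simp add: sk[OF d] mult.assoc)
    next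
      case False
      have "tp (F c * u) * (F d * u) = - (tp u * (F c * (P c * (F d * (P c * u)))))"
        using Pu[OF c] p(5)[OF c] by (simp add: sk[OF c] mult.assoc) (simp flip: mult.assoc[of "F c" "P c"])
      also have "\<dots> = 0"
        using compression(1)[OF rot[OF c] link[OF c d False], folded P_def]
        by (metis minus_zero mult.assoc mult_zero_left mult_zero_right)
      finally show ?thesis using False by simp
    qed
    moreover have "tp (F c * u) * u = 0" if "c \<in> {1..7}" for c
      using uF0[OF that] by (simp add: sk[OF that] mult.assoc)
    ultimately show ?thesis using uF0 us by (auto simp: onb_def f_def mult.assoc simp del: tp_mult)
  qed
  have Fc: "F c = u * tp (f c) - f c * tp u" if c: "c \<in> {1..7}" for c
  proof -
    have v: "unit_col (f c)" using \<open>onb f\<close> c by (auto simp: onb_def unit_col_def)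
    have 1: "orth_proj (P c - u * tp u)" "tr (P c - u * tp u) = 1"
      using orth_proj_minus_unit_col[OF sp[OF c] u(1) Pu[OF c]] p(3)[OF c] by simp_all
    have "P c * (F c * u) = F c * u" using p(4)[OF c] by (simp flip: mult.assoc)
    hence "(P c - u * tp u) * f c = f c"
      using c uF0[OF c] by (simp add: f_def algebra_simps)
    from orth_proj_minus_unit_col[OF 1(1) v this] 1(2)
    have "P c - u * tp u - f c * tp (f c) = 0" by (intro orth_proj_tr0) auto
    hence Pc: "P c = u * tp u + f c * tp (f c)" by (simp add: algebra_simps)
    have "F c = F c * P c" using p(5)[OF c] by simp
    also have "\<dots> = F c * u * tp u - F c * (F c * (u * tp (f c)))"
      unfolding Pc using c by (simp add: f_def algebra_simps)
    also have "\<dots> = u * tp (f c) - f c * tp u" using c FFuA[OF c] by (simp add: f_def)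
    finally show ?thesis .
  qed
  have "\<phi> X = Ad (frame f) X" if "X \<in> so8" for X
  proof (rule aut_eqI[OF \<phi> aut_Ad[OF frame_O8[OF \<open>onb f\<close>]] _ that])
    fix a :: nat assume a: "a \<in> {1..7}"
    have "Ad (frame f) (e 0 a) = Ad (frame f) (E 0 a) - Ad (frame f) (E a 0)"
      by (simp add: Ad_def e_def algebra_simps)
    also have "\<dots> = F a" using a by (subst Fc[OF a]) (simp add: Ad_frame[OF \<open>onb f\<close>] f_def[of 0])
    finally show "\<phi> (e 0 a) = Ad (frame f) (e 0 a)" by (simp add: F_def)
  qed
  thus ?thesis using frame_O8[OF \<open>onb f\<close>] that by blast
qed

section \<open>Triality from the octonions\<close>

text \<open>The signs of the octonion products \<open>e\<^sub>a e\<^sub>b = \<plusminus>e\<^bsub>a xor b\<^esub>\<close>, for the basis in which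
  \<open>e\<^sub>1 e\<^sub>2 = e\<^sub>3\<close>, \<open>e\<^sub>1 e\<^sub>4 = e\<^sub>5\<close>, \<open>e\<^sub>2 e\<^sub>4 = e\<^sub>6\<close> and \<open>e\<^sub>3 e\<^sub>4 = e\<^sub>7\<close>.\<close>

definition oct_table :: "nat \<Rightarrow> nat \<Rightarrow> int" where
  "oct_table a b = [[1,1,1,1,1,1,1,1],[1,-1,1,-1,1,-1,-1,1],[1,-1,-1,1,1,1,-1,-1],[1,1,-1,-1,1,-1,1,-1],
    [1,-1,-1,-1,-1,1,1,1],[1,1,-1,1,-1,-1,-1,1],[1,1,1,-1,-1,1,-1,-1],[1,-1,1,1,-1,-1,1,-1]] ! a ! b"

definition oct_sign :: "nat \<Rightarrow> nat \<Rightarrow> real" where "oct_sign a b = real_of_int (oct_table a b)"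

lemma xor_less8: "a < 8 \<Longrightarrow> b < 8 \<Longrightarrow> xor a b < (8 :: nat)"
proof -
  have "\<forall>a\<in>set [0..<8]. \<forall>b\<in>set [0..<8]. xor a b < (8 :: nat)" by code_simp
  thus "a < 8 \<Longrightarrow> b < 8 \<Longrightarrow> xor a b < (8 :: nat)" by simp
qed

lemma xor_xor: "xor a (xor a b) = (b :: nat)" by (simp flip: xor.assoc)

lemma oct_sign_0: "c < 8 \<Longrightarrow> oct_sign 0 c = 1" "c < 8 \<Longrightarrow> oct_sign c 0 = 1"
proof -
  have "\<forall>c\<in>set [0..<8]. oct_table 0 c = 1 \<and> oct_table c 0 = 1" by code_simp
  thus "c < 8 \<Longrightarrow> oct_sign 0 c = 1" "c < 8 \<Longrightarrow> oct_sign c 0 = 1" by (simp_all add: oct_sign_def)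
qed

lemma oct_sign_skew: "a \<in> {1..7} \<Longrightarrow> c < 8 \<Longrightarrow> oct_sign a (xor a c) = - oct_sign a c"
proof -
  have "\<forall>a\<in>set [1..<8]. \<forall>c\<in>set [0..<8]. oct_table a (xor a c) = - oct_table a c" by code_simp
  thus "a \<in> {1..7} \<Longrightarrow> c < 8 \<Longrightarrow> oct_sign a (xor a c) = - oct_sign a c" by (simp add: oct_sign_def)
qed

lemma oct_sign_sq: "a < 8 \<Longrightarrow> c < 8 \<Longrightarrow> oct_sign a c * oct_sign a c = 1"
proof -
  have "\<forall>a\<in>set [0..<8]. \<forall>c\<in>set [0..<8]. oct_table a c * oct_table a c = 1" by code_simp
  thus "a < 8 \<Longrightarrow> c < 8 \<Longrightarrow> oct_sign a c * oct_sign a c = 1" by (simp add: oct_sign_def flip: of_int_mult)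
qed

lemma oct_sign_anti:
  assumes "a \<in> {1..7}" "b \<in> {1..7}" "a \<noteq> b" "c < 8"
  shows "oct_sign a (xor b c) * oct_sign b c = - (oct_sign b (xor a c) * oct_sign a c)"
proof -
  have "\<forall>a\<in>set [1..<8]. \<forall>b\<in>set [1..<8]. a \<noteq> b \<longrightarrow>
    (\<forall>c\<in>set [0..<8]. oct_table a (xor b c) * oct_table b c = - (oct_table b (xor a c) * oct_table a c))" by code_simp
  moreover have "a \<in> set [1..<8]" "b \<in> set [1..<8]" "c \<in> set [0..<8]" using assms by auto
  ultimately have "oct_table a (xor b c) * oct_table b c = - (oct_table b (xor a c) * oct_table a c)" using assms(3) by blast
  thus ?thesis unfolding oct_sign_def by (metis of_int_minus of_int_mult)
qed

lemma oct_sign_triality: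
  assumes "a \<in> {1..7}" "d < 8"
  shows "(\<Sum>c<8. oct_sign a c * (oct_sign c (xor c d) * oct_sign (xor a c) (xor c d))) = (if d = a then -8 else if d = 0 then 8 else 0)"
proof -
  have "\<forall>a\<in>set [1..<8]. \<forall>d\<in>set [0..<8].
    (\<Sum>c\<leftarrow>[0..<8]. oct_table a c * (oct_table c (xor c d) * oct_table (xor a c) (xor c d))) = (if d = a then -8 else if d = 0 then 8 else 0)"
    by code_simp
  hence "(\<Sum>c<8. oct_table a c * (oct_table c (xor c d) * oct_table (xor a c) (xor c d))) = (if d = a then -8 else if d = 0 then 8 else 0)"
    using assms by (simp add: interv_sum_list_conv_sum_set_nat lessThan_atLeast0)
  hence "real_of_int (\<Sum>c<8. oct_table a c * (oct_table c (xor c d) * oct_table (xor a c) (xor c d))) =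
     (if d = a then -8 else if d = 0 then 8 else 0)" by simp
  thus ?thesis by (simp add: oct_sign_def)
qed

text \<open>Left multiplication by an octonion unit.\<close>

definition G :: "nat \<Rightarrow> mat8" where "G a = (\<Sum>c<8. oct_sign a c *\<^sub>R E (xor a c) c)"

lemma G_E:
  assumes "a < 8" "c < 8"
  shows "G a * E c 0 = oct_sign a c *\<^sub>R E (xor a c) 0"
proof -
  have "G a * E c 0 = (\<Sum>k<8. if k = c then oct_sign a c *\<^sub>R E (xor a c) 0 else 0)"
    unfolding G_def sum_distrib_right using assms by (intro sum.cong refl) (auto simp: xor_less8)
  thus ?thesis using assms by simp
qed

lemma mat8_eq_colI: "(\<And>c. c < 8 \<Longrightarrow> A * E c 0 = B * E c 0) \<Longrightarrow> A = B"
proof -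
  assume *: "\<And>c. c < 8 \<Longrightarrow> A * E c 0 = B * E c 0"
  have **: "Z = (\<Sum>c<8. Z * E c 0 * E 0 c)" for Z
    by (simp add: mult.assoc sum_E_diag flip: sum_distrib_left)
  have "(\<Sum>c<8. A * E c 0 * E 0 c) = (\<Sum>c<8. B * E c 0 * E 0 c)" using * by (intro sum.cong) auto
  thus "A = B" using **[of A] **[of B] by simp
qed

lemma G_0 [simp]: "G 0 = 1"
  by (rule mat8_eq_colI) (simp add: G_E oct_sign_0)

lemma tp_G: assumes "a \<in> {1..7}" shows "tp (G a) = - G a"
proof -
  have "G a = (\<Sum>c<8. oct_sign a (xor a c) *\<^sub>R E (xor a (xor a c)) (xor a c))"
    unfolding G_def using assms
    by (intro sum.reindex_bij_witness[of _ "xor a" "xor a"]) (auto simp: xor_less8 xor_xor)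
  also have "\<dots> = - tp (G a)"
    unfolding G_def tp_sum sum_negf[symmetric] using assms
    by (intro sum.cong refl) (auto simp: xor_less8 xor_xor oct_sign_skew)
  finally have "G a = - tp (G a)" .
  thus ?thesis by (metis minus_minus)
qed

definition clifford :: "(nat \<Rightarrow> mat8) \<Rightarrow> bool" where
  "clifford J \<longleftrightarrow> (\<forall>a\<in>{1..7}. tp (J a) = - J a \<and> J a * J a = - 1) \<and>
     (\<forall>a\<in>{1..7}. \<forall>b\<in>{1..7}. a \<noteq> b \<longrightarrow> J a * J b = - (J b * J a))"

lemma clifford_G: "clifford G"
  unfolding clifford_def
proof (intro conjI ballI impI)
  fix a :: nat assume a: "a \<in> {1..7}"
  show "tp (G a) = - G a" using a by (rule tp_G)
  show "G a * G a = - 1"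
    using a by - (rule mat8_eq_colI, simp add: mult.assoc G_E xor_less8 xor_xor oct_sign_skew oct_sign_sq)
  fix b :: nat assume b: "b \<in> {1..7}" and ab: "a \<noteq> b"
  show "G a * G b = - (G b * G a)"
  proof (rule mat8_eq_colI)
    fix c :: nat assume c: "c < 8"
    have GG: "G a * G b * E c 0 = (oct_sign a (xor b c) * oct_sign b c) *\<^sub>R E (xor a (xor b c)) 0"
      if "a \<in> {1..7}" "b \<in> {1..7}" for a b
      using that c by (simp add: mult.assoc G_E xor_less8)
    have "- (G b * G a) * E c 0 = (- (oct_sign b (xor a c) * oct_sign a c)) *\<^sub>R E (xor b (xor a c)) 0"
      by (simp only: GG[OF b a] mult_minus_left scaleR_minus_left)
    thus "G a * G b * E c 0 = - (G b * G a) * E c 0"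
      by (simp only: GG[OF a b] oct_sign_anti[OF a b ab c] xor.left_commute[of b a c])
  qed
qed

text \<open>The Clifford relations, with \<open>G 0\<close> included on equal terms.\<close>

lemma G_rel:
  assumes "a < 8" "b < 8"
  shows "tp (G a) * G b = (if a = b then 2 else 0) *\<^sub>R 1 - tp (G b) * G a"
    "G a * tp (G b) = (if a = b then 2 else 0) *\<^sub>R 1 - G b * tp (G a)"
proof -
  consider "a = 0" "b = 0" | "a = 0" "b \<in> {1..7}" | "a \<in> {1..7}" "b = 0" | "a \<in> {1..7}" "b \<in> {1..7}" "a = b"
    | "a \<in> {1..7}" "b \<in> {1..7}" "a \<noteq> b" using assms by force
  hence "tp (G a) * G b = (if a = b then 2 else 0) *\<^sub>R 1 - tp (G b) * G a \<and>
    G a * tp (G b) = (if a = b then 2 else 0) *\<^sub>R 1 - G b * tp (G a)"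
  proof cases
    case 4
    hence "G b * G b = - 1" using clifford_G by (simp add: clifford_def)
    thus ?thesis using 4 by (simp add: tp_G scaleR_2)
  next
    case 5
    hence "G a * G b = - (G b * G a)" using clifford_G unfolding clifford_def by blast
    thus ?thesis using 5 by (simp add: tp_G)
  qed (auto simp: tp_G scaleR_2)
  thus "tp (G a) * G b = (if a = b then 2 else 0) *\<^sub>R 1 - tp (G b) * G a"
    "G a * tp (G b) = (if a = b then 2 else 0) *\<^sub>R 1 - G b * tp (G a)" by auto
qed

text \<open>A half-spin representation: it sends \<open>e a b\<close> to half of \<open>G a * tp (G b)\<close>. In this basis it is
  moreover an involution of \<open>so8\<close>.\<close>

definition triality :: "mat8 \<Rightarrow> mat8" where
  "triality X = (\<Sum>a<8. \<Sum>b<8. (ent X a b / 4) *\<^sub>R (G a * tp (G b)))"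

text \<open>The other half-spin representation, needed to express that \<open>x \<mapsto> \<Sum>a. x\<^sub>a G a\<close> intertwines the
  vector representation with the two half-spin representations.\<close>

definition triality' :: "mat8 \<Rightarrow> mat8" where
  "triality' X = (\<Sum>a<8. \<Sum>b<8. (ent X a b / 4) *\<^sub>R (tp (G a) * G b))"

lemma triality_skew:
  assumes "X \<in> so8"
  shows "tp (triality X) = - triality X" "tp (triality' X) = - triality' X"
proof -
  note sk = so8_ent[OF assms]
  have "tp (triality X) = (\<Sum>a<8. \<Sum>b<8. (ent X b a / 4) *\<^sub>R (G a * tp (G b)))"
    unfolding triality_def tp_sum by (subst sum.swap) simp
  also have "\<dots> = - triality X"
    unfolding triality_def sum_negf[symmetric] by (intro sum.cong refl) (simp add: sk[symmetric] flip: scaleR_minus_left)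
  finally show "tp (triality X) = - triality X" .
  have "tp (triality' X) = (\<Sum>a<8. \<Sum>b<8. (ent X b a / 4) *\<^sub>R (tp (G a) * G b))"
    unfolding triality'_def tp_sum by (subst sum.swap) simp
  also have "\<dots> = - triality' X"
    unfolding triality'_def sum_negf[symmetric] by (intro sum.cong refl) (simp add: sk[symmetric] flip: scaleR_minus_left)
  finally show "tp (triality' X) = - triality' X" .
qed

text \<open>The infinitesimal form of Clifford multiplication being equivariant; moving \<open>G c\<close> through the products
  with the Clifford relations leaves only the terms in which \<open>c\<close> meets an index.\<close>

lemma triality_deriv:
  assumes X: "X \<in> so8" and c: "c < 8"
  shows "triality X * G c - G c * triality' X = (\<Sum>a<8. ent X a c *\<^sub>R G a)"
proof -
  have t: "G a * tp (G b) * G c - G c * tp (G a) * G b =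
     (if b = c then 2 else 0) *\<^sub>R G a - (if a = c then 2 else 0) *\<^sub>R G b" if "a < 8" "b < 8" for a b
  proof -
    have "G a * (tp (G b) * G c) = (if b = c then 2 else 0) *\<^sub>R G a - G a * (tp (G c) * G b)"
      by (subst G_rel(1)[OF that(2) c]) (simp add: algebra_simps)
    moreover have "G c * tp (G a) * G b = (if a = c then 2 else 0) *\<^sub>R G b - G a * (tp (G c) * G b)"
      by (subst G_rel(2)[OF c that(1)]) (auto simp: algebra_simps)
    ultimately show ?thesis by (simp add: mult.assoc)
  qed
  have "triality X * G c - G c * triality' X =
      (\<Sum>a<8. \<Sum>b<8. (ent X a b / 4) *\<^sub>R (G a * tp (G b) * G c - G c * tp (G a) * G b))"
    unfolding triality_def triality'_def
    by (simp add: sum_distrib_left sum_distrib_right sum_subtractf scaleR_diff_right mult.assoc)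
  also have "\<dots> = (\<Sum>a<8. \<Sum>b<8. (if b = c then (ent X a c / 2) *\<^sub>R G a else 0)) -
      (\<Sum>a<8. \<Sum>b<8. (if a = c then (ent X c b / 2) *\<^sub>R G b else 0))"
    unfolding sum_subtractf[symmetric] by (intro sum.cong refl) (auto simp: t)
  also have "(\<Sum>a<8. \<Sum>b<8. (if b = c then (ent X a c / 2) *\<^sub>R G a else 0)) = (\<Sum>a<8. (ent X a c / 2) *\<^sub>R G a)"
    using c by simp
  also have "(\<Sum>a<8. \<Sum>b<8. (if a = c then (ent X c b / 2) *\<^sub>R G b else 0)) = (\<Sum>b<8. (ent X c b / 2) *\<^sub>R G b)"
    using c by (subst sum.swap) simp
  also have "\<dots> = - (\<Sum>a<8. (ent X a c / 2) *\<^sub>R G a)"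
    unfolding sum_negf[symmetric] using so8_ent[OF X c] by (intro sum.cong refl) simp
  also have "(\<Sum>a<8. (ent X a c / 2) *\<^sub>R G a) - - (\<Sum>a<8. (ent X a c / 2) *\<^sub>R G a) = (\<Sum>a<8. ent X a c *\<^sub>R G a)"
    by (simp add: sum.distrib[symmetric] scaleR_add_left[symmetric])
  finally show ?thesis .
qed

lemma triality_deriv_tp:
  assumes X: "X \<in> so8" and c: "c < 8"
  shows "triality' X * tp (G c) - tp (G c) * triality X = (\<Sum>a<8. ent X a c *\<^sub>R tp (G a))"
  using arg_cong[OF triality_deriv[OF assms], of tp] by (simp add: triality_skew[OF X] tp_sum)

text \<open>By the derivation rule, the bracket with \<open>triality X\<close> acts on \<open>G k * tp (G l)\<close> through \<open>X\<close> on both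
  indices, which is how \<open>ad X\<close> acts on \<open>e k l\<close>.\<close>

lemma triality_br:
  assumes X: "X \<in> so8" and Y: "Y \<in> so8"
  shows "triality (br X Y) = br (triality X) (triality Y)"
proof -
  have com: "triality X * (G k * tp (G l)) - (G k * tp (G l)) * triality X =
     (\<Sum>m<8. ent X m k *\<^sub>R (G m * tp (G l))) + (\<Sum>m<8. ent X m l *\<^sub>R (G k * tp (G m)))"
    if "k < 8" "l < 8" for k l
  proof -
    have "triality X * (G k * tp (G l)) - (G k * tp (G l)) * triality X =
      (triality X * G k - G k * triality' X) * tp (G l) + G k * (triality' X * tp (G l) - tp (G l) * triality X)"
      by (simp add: algebra_simps)
    thus ?thesis unfolding triality_deriv[OF X that(1)] triality_deriv_tp[OF X that(2)]
      by (simp add: sum_distrib_left sum_distrib_right)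
  qed
  have "br (triality X) (triality Y) = (\<Sum>k<8. \<Sum>l<8. (ent Y k l / 4) *\<^sub>R
      (triality X * (G k * tp (G l)) - (G k * tp (G l)) * triality X))"
    unfolding br_def by (subst (2 3) triality_def)
      (simp add: sum_distrib_left sum_distrib_right sum_subtractf scaleR_diff_right mult.assoc)
  also have "\<dots> = (\<Sum>k<8. \<Sum>l<8. \<Sum>m<8. (ent X m k * ent Y k l / 4) *\<^sub>R (G m * tp (G l))) +
      (\<Sum>k<8. \<Sum>l<8. \<Sum>m<8. (ent Y k l * ent X m l / 4) *\<^sub>R (G k * tp (G m)))"
    unfolding sum.distrib[symmetric]
    by (intro sum.cong refl) (simp add: com scaleR_add_right scaleR_sum_right sum.distrib mult.commute)
  also have "(\<Sum>k<8. \<Sum>l<8. \<Sum>m<8. (ent X m k * ent Y k l / 4) *\<^sub>R (G m * tp (G l))) =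
      (\<Sum>m<8. \<Sum>l<8. \<Sum>k<8. (ent X m k * ent Y k l / 4) *\<^sub>R (G m * tp (G l)))"
    by (subst sum.swap, subst (2) sum.swap, subst sum.swap) (rule refl)
  also have "\<dots> = (\<Sum>m<8. \<Sum>l<8. (ent (X * Y) m l / 4) *\<^sub>R (G m * tp (G l)))"
    by (intro sum.cong refl) (simp add: ent_mult sum_divide_distrib flip: scaleR_sum_left)
  also have "(\<Sum>k<8. \<Sum>l<8. \<Sum>m<8. (ent Y k l * ent X m l / 4) *\<^sub>R (G k * tp (G m))) =
      (\<Sum>k<8. \<Sum>m<8. \<Sum>l<8. (ent Y k l * ent X m l / 4) *\<^sub>R (G k * tp (G m)))"
    by (rule sum.cong[OF refl], rule sum.swap)
  also have "\<dots> = (\<Sum>k<8. \<Sum>m<8. (- ent (Y * X) k m / 4) *\<^sub>R (G k * tp (G m)))"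
  proof (intro sum.cong refl)
    fix k m :: nat assume km: "k \<in> {..<8}" "m \<in> {..<8}"
    have "ent X m l = - ent X l m" if "l \<in> {..<8}" for l
      using so8_ent[OF X, of l m] km that by simp
    hence "(\<Sum>l<8. ent Y k l * ent X m l / 4) = (\<Sum>l<8. - (ent Y k l * ent X l m / 4))"
      by (intro sum.cong refl) (metis divide_minus_left mult_minus_right)
    also have "\<dots> = - ent (Y * X) k m / 4"
      using km by (simp add: ent_mult sum_divide_distrib sum_negf)
    finally have "(\<Sum>l<8. ent Y k l * ent X m l / 4) = - ent (Y * X) k m / 4" .
    thus "(\<Sum>l<8. (ent Y k l * ent X m l / 4) *\<^sub>R (G k * tp (G m))) = (- ent (Y * X) k m / 4) *\<^sub>R (G k * tp (G m))"
      by (simp flip: scaleR_sum_left)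
  qed
  also have "(\<Sum>m<8. \<Sum>l<8. (ent (X * Y) m l / 4) *\<^sub>R (G m * tp (G l))) +
      (\<Sum>k<8. \<Sum>m<8. (- ent (Y * X) k m / 4) *\<^sub>R (G k * tp (G m))) = triality (br X Y)"
    unfolding triality_def sum.distrib[symmetric]
    by (intro sum.cong refl) (simp add: br_def diff_divide_distrib scaleR_diff_left)
  finally show ?thesis by simp
qed

lemma hom_triality: "hom8 triality"
  unfolding hom8_def
proof (intro conjI ballI allI)
  fix X Y :: mat8 and c :: real assume X: "X \<in> so8"
  show "triality X \<in> so8" using triality_skew[OF X] by (simp add: so8_iff)
  show "triality (X + Y) = triality X + triality Y"
    unfolding triality_def sum.distrib[symmetric]
    by (intro sum.cong refl) (simp add: add_divide_distrib scaleR_add_left)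
  show "triality (c *\<^sub>R X) = c *\<^sub>R triality X"
    unfolding triality_def scaleR_sum_right by (intro sum.cong refl) simp
  show "triality (br X Y) = br (triality X) (triality Y)" if "Y \<in> so8" using X that by (rule triality_br)
qed

lemma triality_e0:
  assumes a: "a \<in> {1..7}"
  shows "triality (e 0 a) = - ((1/2) *\<^sub>R G a)"
proof -
  have "triality (e 0 a) = (\<Sum>i<8. \<Sum>j<8. (if i = 0 then if j = a then (1/4) *\<^sub>R (G i * tp (G j)) else 0 else 0))
     - (\<Sum>i<8. \<Sum>j<8. (if j = 0 then if i = a then (1/4) *\<^sub>R (G i * tp (G j)) else 0 else 0))"
    unfolding triality_def sum_subtractf[symmetric] using a
    by (intro sum.cong refl) (auto simp: e_def)
  also have "(\<Sum>i<8. \<Sum>j<8. (if i = 0 then if j = a then (1/4) *\<^sub>R (G i * tp (G j)) else 0 else 0)) =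
      (1/4) *\<^sub>R tp (G a)" using a by (subst sum.swap) simp
  also have "(\<Sum>i<8. \<Sum>j<8. (if j = 0 then if i = a then (1/4) *\<^sub>R (G i * tp (G j)) else 0 else 0)) = (1/4) *\<^sub>R G a"
    using a by simp
  finally have 1: "triality (e 0 a) = - ((1/4) *\<^sub>R G a) - (1/4) *\<^sub>R G a" using a by (simp add: tp_G)
  have 2: "(1/2) *\<^sub>R G a = (1/4) *\<^sub>R G a + (1/4) *\<^sub>R G a" by (simp flip: scaleR_add_left)
  show ?thesis unfolding 1 2 by simp
qed

lemma triality_G:
  assumes a: "a \<in> {1..7}"
  shows "triality (G a) = - 2 *\<^sub>R e 0 a"
proof (rule mat8_eq_colI)
  fix d :: nat assume d: "d < 8"
  have tG: "tp (G c) * E d 0 = oct_sign c (xor c d) *\<^sub>R E (xor c d) 0" if "c < 8" "d < 8" for c d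
  proof (cases "c = 0")
    case False
    thus ?thesis using that by (simp add: tp_G G_E oct_sign_skew)
  qed (use that in \<open>simp add: oct_sign_0\<close>)
  have entG: "ent (G a) i j = (if i = xor a j then oct_sign a j else 0)" if "i < 8" "j < 8" for i j
  proof -
    have "ent (G a) i j = (\<Sum>c<8. oct_sign a c * (if i = xor a c \<and> j = c then 1 else 0))"
      using that by (simp add: ent_sum G_def)
    also have "\<dots> = (\<Sum>c<8. if c = j then (if i = xor a j then oct_sign a j else 0) else 0)"
      by (intro sum.cong refl) auto
    finally have "ent (G a) i j = \<dots>" .
    thus ?thesis using that by simp
  qed
  have "triality (G a) * E d 0 =
     (\<Sum>i<8. \<Sum>j<8. if i = xor a j then (oct_sign a j / 4) *\<^sub>R (G i * (tp (G j) * E d 0)) else 0)"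
    unfolding triality_def sum_distrib_right by (intro sum.cong refl) (auto simp: entG mult.assoc)
  also have "\<dots> = (\<Sum>j<8. (oct_sign a j / 4) *\<^sub>R (G (xor a j) * (tp (G j) * E d 0)))"
    using a by (subst sum.swap) (simp add: xor_less8)
  also have "\<dots> = (\<Sum>j<8. (1/4 * (oct_sign a j * (oct_sign j (xor j d) * oct_sign (xor a j) (xor j d)))) *\<^sub>R E (xor a d) 0)"
  proof (intro sum.cong refl)
    fix j :: nat assume "j \<in> {..<8}"
    hence j: "j < 8" "xor a j < 8" "xor j d < 8" using a d by (auto simp: xor_less8)
    have "xor (xor a j) (xor j d) = xor a d" by (metis xor.assoc xor_xor)
    thus "(oct_sign a j / 4) *\<^sub>R (G (xor a j) * (tp (G j) * E d 0)) =
        (1/4 * (oct_sign a j * (oct_sign j (xor j d) * oct_sign (xor a j) (xor j d)))) *\<^sub>R E (xor a d) 0"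
      using j d by (simp add: tG G_E)
  qed
  also have "\<dots> = (1/4 * (\<Sum>j<8. oct_sign a j * (oct_sign j (xor j d) * oct_sign (xor a j) (xor j d)))) *\<^sub>R E (xor a d) 0"
    by (simp add: sum_distrib_left flip: scaleR_sum_left)
  also have "\<dots> = (if d = a then -2 else if d = 0 then 2 else 0) *\<^sub>R E (xor a d) 0"
    unfolding oct_sign_triality[OF a d] by simp
  also have "\<dots> = - 2 *\<^sub>R e 0 a * E d 0" using a d by (auto simp: e_def algebra_simps)
  finally show "triality (G a) * E d 0 = - 2 *\<^sub>R e 0 a * E d 0" .
qed

lemma G_so8: "a \<in> {1..7} \<Longrightarrow> G a \<in> so8" by (simp add: so8_iff tp_G)

text \<open>Both sides are homomorphisms, so the generators \<open>e 0 a\<close> suffice.\<close>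

lemma triality_involutive:
  assumes "X \<in> so8" shows "triality (triality X) = X"
proof -
  have id: "hom8 id" by (simp add: hom8_def)
  have "(triality \<circ> triality) X = id X"
  proof (rule hom_eqI[OF hom_comp[OF hom_triality hom_triality] id _ assms])
    fix a :: nat assume a: "a \<in> {1..7}"
    have "triality (- ((1/2) *\<^sub>R G a)) = e 0 a"
      using G_so8[OF a] by (simp only: homD[OF hom_triality] so8_closed triality_G[OF a]) simp
    thus "(triality \<circ> triality) (e 0 a) = id (e 0 a)" using a by (simp add: triality_e0)
  qed
  thus ?thesis by simp
qed

lemma aut_triality: "aut triality"
  unfolding aut_iff_hom
proof
  show "bij_betw triality so8 so8"
    by (rule bij_betwI[of _ _ _ triality]) (auto simp: triality_involutive homD[OF hom_triality])
qed (rule hom_triality)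

section \<open>Automorphisms exchanging rotations and complex structures\<close>

lemma cliffordD:
  assumes "clifford J" "a \<in> {1..7}"
  shows "tp (J a) = - J a" "J a * J a = - 1" "J a * (J a * A) = - A"
    "b \<in> {1..7} \<Longrightarrow> a \<noteq> b \<Longrightarrow> J a * J b = - (J b * J a)"
    "b \<in> {1..7} \<Longrightarrow> a \<noteq> b \<Longrightarrow> J a * (J b * A) = - (J b * (J a * A))"
proof -
  show *: "tp (J a) = - J a" "J a * J a = - 1" using assms by (auto simp: clifford_def)
  show "J a * (J a * A) = - A" using * by (simp flip: mult.assoc)
  show **: "J a * J b = - (J b * J a)" if "b \<in> {1..7}" "a \<noteq> b" for b
    using assms that unfolding clifford_def by blast
  show "J a * (J b * A) = - (J b * (J a * A))" if "b \<in> {1..7}" "a \<noteq> b"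
    using arg_cong[OF **[OF that], of "\<lambda>z. z * A"] by (simp add: mult.assoc)
qed

text \<open>For an involution \<open>T\<close> and \<open>A \<noteq> 0\<close>, one of \<open>A + T A\<close> and \<open>A - T A\<close> is a nonzero eigenvector, and it
  keeps the eigenvalues under everything that commutes with \<open>T\<close>.\<close>

lemma joint_eigen:
  assumes "\<forall>T\<in>set Ts. T * T = 1 \<and> (\<forall>S\<in>set Ts. T * S = S * T)"
  shows "\<exists>A::mat8. A \<noteq> 0 \<and> (\<forall>T\<in>set Ts. \<exists>\<epsilon>\<in>{1, -1}. T * A = \<epsilon> *\<^sub>R A)"
  using assms
proof (induction Ts)
  case Nil
  show ?case by (auto intro!: exI[of _ 1])
next
  case (Cons T Ts)
  then obtain A where A: "A \<noteq> 0" "\<forall>S\<in>set Ts. \<exists>\<epsilon>\<in>{1, -1}. S * A = \<epsilon> *\<^sub>R A" by auto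
  have TT: "T * (T * A) = A" using Cons.prems by (simp flip: mult.assoc)
  have "\<exists>\<epsilon>\<in>{1, -1}. A + \<epsilon> *\<^sub>R (T * A) \<noteq> 0"
  proof (rule ccontr)
    assume "\<not> ?thesis"
    hence "A + T * A = 0" "A - T * A = 0" by auto
    hence "(A + T * A) + (A - T * A) = 0" by simp
    hence "2 *\<^sub>R A = 0" by (simp add: scaleR_2)
    thus False using A by simp
  qed
  then obtain \<epsilon> :: real where e: "\<epsilon> \<in> {1, -1}" "A + \<epsilon> *\<^sub>R (T * A) \<noteq> 0" by blast
  let ?B = "A + \<epsilon> *\<^sub>R (T * A)"
  have "T * ?B = \<epsilon> *\<^sub>R ?B" using e(1) by (auto simp: algebra_simps TT)
  moreover have "\<exists>\<eta>\<in>{1, -1}. S * ?B = \<eta> *\<^sub>R ?B" if S: "S \<in> set Ts" for S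
  proof -
    obtain \<eta> where h: "\<eta> \<in> {1, -1}" "S * A = \<eta> *\<^sub>R A" using A S by blast
    have "S * (T * A) = \<eta> *\<^sub>R (T * A)"
      using Cons.prems S h(2) by (metis list.set_intros(1) list.set_intros(2) mult.assoc mult_scaleR_right)
    hence "S * ?B = \<eta> *\<^sub>R ?B" using h(2) by (simp add: algebra_simps)
    thus ?thesis using h(1) by blast
  qed
  ultimately show ?case using e by (intro exI[of _ ?B]) auto
qed

lemma clifford_scale:
  assumes J: "clifford J" and d: "\<And>a. \<delta> a \<in> {1, -1 :: real}"
  shows "clifford (\<lambda>a. \<delta> a *\<^sub>R J a)"
proof -
  have dd: "\<delta> a * \<delta> a = 1" for a using d[of a] by auto
  show ?thesis
    unfolding clifford_def
  proof (intro conjI ballI impI)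
    fix a :: nat assume a: "a \<in> {1..7}"
    show "tp (\<delta> a *\<^sub>R J a) = - (\<delta> a *\<^sub>R J a)" "\<delta> a *\<^sub>R J a * \<delta> a *\<^sub>R J a = - 1"
      using cliffordD(1,2)[OF J a] dd[of a] by simp_all
    fix b :: nat assume b: "b \<in> {1..7}" and ab: "a \<noteq> b"
    show "\<delta> a *\<^sub>R J a * \<delta> b *\<^sub>R J b = - (\<delta> b *\<^sub>R J b * \<delta> a *\<^sub>R J a)"
      by (simp only: mult_scaleR_left mult_scaleR_right cliffordD(4)[OF J a b ab] scaleR_scaleR
          scaleR_minus_right mult.commute[of "\<delta> a"])
  qed
qed

text \<open>The four products that determine the octonion table, evaluated at \<open>u\<close> in the role of the unit.\<close>

definition octonionic :: "(nat \<Rightarrow> mat8) \<Rightarrow> mat8 \<Rightarrow> bool" where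
  "octonionic J u \<longleftrightarrow> J 1 * (J 2 * u) = J 3 * u \<and> J 1 * (J 4 * u) = J 5 * u \<and>
     J 2 * (J 4 * u) = J 6 * u \<and> J 3 * (J 4 * u) = J 7 * u"

text \<open>The products \<open>J a * J b * J c\<close> along four lines of the Fano plane are commuting involutions, because any two
  of the lines share one point. A joint eigenvector gives the four octonion products up to sign, and
  each of the lines contains one of the indices 3, 5, 6, 7 whose sign is still free.\<close>

lemma clifford_vector:
  assumes J: "clifford J"
  obtains u and \<delta> :: "nat \<Rightarrow> real" where "unit_col u" "\<delta> 0 = 1" "\<And>a. \<delta> a \<in> {1, -1}"
    "octonionic (\<lambda>a. \<delta> a *\<^sub>R J a) u"
proof -
  note c = cliffordD[OF J]
  define T where "T a b c = J a * (J b * J c)" for a b c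
  have sq: "T a b c * T a b c = 1" if "a \<in> {1..7}" "b \<in> {1..7}" "c \<in> {1..7}" "a < b" "b < c" for a b c
  proof -
    have *: "J c * J a = - (J a * J c)" "J b * J a = - (J a * J b)" "J c * J b = - (J b * J c)"
      "J c * (J a * A) = - (J a * (J c * A))" "J b * (J a * A) = - (J a * (J b * A))"
      "J c * (J b * A) = - (J b * (J c * A))" "J a * (J a * A) = - A" "J b * (J b * A) = - A" "J c * J c = - 1" "J b * J b = - 1" "J a * J a = - 1" for A
      using that by (auto intro: c)
    show ?thesis unfolding T_def mult.assoc by (simp add: *)
  qed
  have comm: "T a b c * T a d f = T a d f * T a b c"
    if "a \<in> {1..7}" "b \<in> {1..7}" "c \<in> {1..7}" "d \<in> {1..7}" "f \<in> {1..7}" "distinct [a, b, c, d, f]" for a b c d f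
  proof -
    have *: "J d * (J b * A) = - (J b * (J d * A))" "J d * (J c * A) = - (J c * (J d * A))"
      "J f * (J b * A) = - (J b * (J f * A))" "J f * (J c * A) = - (J c * (J f * A))"
      "J b * (J a * A) = - (J a * (J b * A))" "J c * (J a * A) = - (J a * (J c * A))"
      "J d * (J a * A) = - (J a * (J d * A))" "J f * (J a * A) = - (J a * (J f * A))"
      "J f * J c = - (J c * J f)" "J a * (J a * A) = - A" for A
      using that by (auto intro: c)
    show ?thesis unfolding T_def mult.assoc by (simp add: *)
  qed
  have rot: "T a b c = T b c a" "T a b c = T c a b"
    if "a \<in> {1..7}" "b \<in> {1..7}" "c \<in> {1..7}" "distinct [a, b, c]" for a b c
  proof -
    have *: "T x y z = T y z x" if "x \<in> {1..7}" "y \<in> {1..7}" "z \<in> {1..7}" "distinct [x, y, z]" for x y z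
      unfolding T_def using that by (subst c(5)[of x y], simp_all, subst c(4)[of x z], simp_all)
    show "T a b c = T b c a" "T a b c = T c a b" using * that by auto
  qed
  let ?Ts = "[T 1 2 3, T 1 4 5, T 2 4 6, T 3 4 7]"
  have r: "T 2 4 6 = T 4 6 2" "T 3 4 7 = T 4 7 3" "T 1 4 5 = T 4 5 1" "T 1 2 3 = T 2 3 1" "T 1 2 3 = T 3 1 2"
    by (rule rot; simp)+
  have cm: "T 1 2 3 * T 1 4 5 = T 1 4 5 * T 1 2 3" by (rule comm) simp_all
  have cm2: "T 1 2 3 * T 2 4 6 = T 2 4 6 * T 1 2 3" unfolding r(4) by (rule comm) simp_all
  have cm3: "T 1 2 3 * T 3 4 7 = T 3 4 7 * T 1 2 3" unfolding r(5) by (rule comm) simp_all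
  have cm4: "T 1 4 5 * T 2 4 6 = T 2 4 6 * T 1 4 5" unfolding r(1,3) by (rule comm) simp_all
  have cm5: "T 1 4 5 * T 3 4 7 = T 3 4 7 * T 1 4 5" unfolding r(2,3) by (rule comm) simp_all
  have cm6: "T 2 4 6 * T 3 4 7 = T 3 4 7 * T 2 4 6" unfolding r(1,2) by (rule comm) simp_all
  have "S * S' = S' * S" if "S \<in> set ?Ts" "S' \<in> set ?Ts" for S S'
    using that unfolding list.set insert_iff empty_iff
    by (elim disjE) (simp_all only: cm cm2 cm3 cm4 cm5 cm6)
  moreover have "S * S = 1" if "S \<in> set ?Ts" for S
    using that unfolding list.set insert_iff empty_iff by (elim disjE) (simp_all add: sq)
  ultimately have "\<forall>S\<in>set ?Ts. S * S = 1 \<and> (\<forall>S'\<in>set ?Ts. S * S' = S' * S)" by blast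
  from joint_eigen[OF this] obtain A where A: "A \<noteq> 0" "\<forall>S\<in>set ?Ts. \<exists>\<epsilon>\<in>{1, -1}. S * A = \<epsilon> *\<^sub>R A" by blast
  obtain B where u: "unit_col (A * B)" using ex_unit_col[OF A(1)] .
  define u where "u = A * B"
  have eig: "\<exists>\<eta>\<in>{1, -1}. J a * (J b * u) = \<eta> *\<^sub>R (J c * u)"
    if T: "T a b c \<in> set ?Ts" and "a \<in> {1..7}" "b \<in> {1..7}" "c \<in> {1..7}" "distinct [a, b, c]" for a b c
  proof -
    obtain \<epsilon> where e: "\<epsilon> \<in> {1, -1}" "T a b c * A = \<epsilon> *\<^sub>R A"
      using bspec[OF A(2) T] by (elim bexE)
    \<comment> \<open>multiplying the eigenvalue equation by \<open>J c\<close> moves \<open>J c\<close> to the other side\<close>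
    have "J c * (T a b c * u) = \<epsilon> *\<^sub>R (J c * u)" using e(2) by (simp add: u_def flip: mult.assoc)
    moreover have "J c * (T a b c * u) = - (J a * (J b * u))"
      using that by (simp add: T_def mult.assoc c(5)[of c a] c(5)[of c b] c(3))
    ultimately have "J a * (J b * u) = (- \<epsilon>) *\<^sub>R (J c * u)" by (metis minus_minus scaleR_minus_left)
    thus ?thesis using e(1) by (intro bexI[of _ "- \<epsilon>"]) auto
  qed
  have "\<exists>\<eta>\<in>{1, -1}. J 1 * (J 2 * u) = \<eta> *\<^sub>R (J 3 * u)" by (rule eig) simp_all
  then obtain p where p: "p \<in> {1, -1}" "J 1 * (J 2 * u) = p *\<^sub>R (J 3 * u)" by (elim bexE)
  have "\<exists>\<eta>\<in>{1, -1}. J 1 * (J 4 * u) = \<eta> *\<^sub>R (J 5 * u)" by (rule eig) simp_all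
  then obtain q where q: "q \<in> {1, -1}" "J 1 * (J 4 * u) = q *\<^sub>R (J 5 * u)" by (elim bexE)
  have "\<exists>\<eta>\<in>{1, -1}. J 2 * (J 4 * u) = \<eta> *\<^sub>R (J 6 * u)" by (rule eig) simp_all
  then obtain r where r: "r \<in> {1, -1}" "J 2 * (J 4 * u) = r *\<^sub>R (J 6 * u)" by (elim bexE)
  have "\<exists>\<eta>\<in>{1, -1}. J 3 * (J 4 * u) = \<eta> *\<^sub>R (J 7 * u)" by (rule eig) simp_all
  then obtain s where s: "s \<in> {1, -1}" "J 3 * (J 4 * u) = s *\<^sub>R (J 7 * u)" by (elim bexE)
  \<comment> \<open>the product along 3, 4, 7 already involves the sign chosen for 3\<close>
  define \<delta> where "\<delta> a = (if a = 3 then p else if a = 5 then q else if a = 6 then r else if a = 7 then p * s else 1)"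
    for a :: nat
  show ?thesis
  proof (rule that[of u \<delta>])
    show "octonionic (\<lambda>a. \<delta> a *\<^sub>R J a) u"
      unfolding octonionic_def by (simp only: mult_scaleR_left mult_scaleR_right p(2) q(2) r(2) s(2)) (simp add: \<delta>_def)
    show "\<delta> a \<in> {1, -1}" for a using p q r s by (auto simp: \<delta>_def)
  qed (use u in \<open>simp_all add: \<delta>_def u_def\<close>)
qed

text \<open>All \<open>J c * u\<close> are monomials in \<open>J 1\<close>, \<open>J 2\<close>, \<open>J 4\<close> applied to \<open>u\<close>, so the anticommutation rules
  reproduce the whole multiplication table.\<close>

lemma octonionic_table:
  assumes J: "clifford J" and u: "octonionic J u" and a: "a \<in> {1..7}" and c: "c < 8"
  defines "f \<equiv> \<lambda>c. if c = 0 then u else J c * u"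
  shows "J a * f c = oct_sign a c *\<^sub>R f (xor a c)"
proof -
  note c' = cliffordD(3,5)[OF J]
  have sw: "J b * (J a * A) = - (J a * (J b * A))"
    if "(a, b) \<in> {(1, 2), (1, 4), (2, 4), (1,3), (1,5), (1,6), (1,7), (2,3), (2,5), (2,6), (2,7), (4,3), (4,5), (4,6), (4,7)}" for a b A
    using that c'(2)[of b a A] by auto
  have "J 7 * u = J 3 * (J 4 * u)" using u by (simp add: octonionic_def)
  also have "\<dots> = - (J 4 * (J 3 * u))" by (rule c'(2)) auto
  also have "J 3 * u = J 1 * (J 2 * u)" using u by (simp add: octonionic_def)
  also have "- (J 4 * (J 1 * (J 2 * u))) = - (J 1 * (J 2 * (J 4 * u)))" using sw[of 1 4] sw[of 2 4] by simp
  finally have 7: "J 7 * u = - (J 1 * (J 2 * (J 4 * u)))" .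
  define m where "m = (\<lambda>c::nat. [u, J 1 * u, J 2 * u, J 1 * (J 2 * u), J 4 * u, J 1 * (J 4 * u),
     J 2 * (J 4 * u), - (J 1 * (J 2 * (J 4 * u)))] ! c)"
  have c8: "c = 0 \<or> c = 1 \<or> c = 2 \<or> c = 3 \<or> c = 4 \<or> c = 5 \<or> c = 6 \<or> c = 7" if "c < 8" for c :: nat
    using that by linarith
  have fm: "f c = m c" if "c < 8" for c
    using c8[OF that] u 7 unfolding octonionic_def by (auto simp: f_def m_def simp del: One_nat_def)
  have base: "J 3 * u = J 1 * (J 2 * u)" "J 5 * u = J 1 * (J 4 * u)" "J 6 * u = J 2 * (J 4 * u)"
    using u by (auto simp: octonionic_def)
  note rules = base 7 c'(1)[of 1] c'(1)[of 2] c'(1)[of 4]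
    sw[of 1 2] sw[of 1 4] sw[of 2 4] sw[of 1 3] sw[of 1 5] sw[of 1 6] sw[of 1 7] sw[of 2 3] sw[of 2 5] sw[of 2 6]
    sw[of 2 7] sw[of 4 3] sw[of 4 5] sw[of 4 6] sw[of 4 7]
  have a7: "a = 1 \<or> a = 2 \<or> a = 3 \<or> a = 4 \<or> a = 5 \<or> a = 6 \<or> a = 7" using a by auto
  have "J a * m c = oct_sign a c *\<^sub>R m (xor a c)"
    by (insert c8[OF c] a7, elim disjE) (simp_all add: m_def oct_sign_def oct_table_def rules[simplified])
  thus ?thesis using fm[OF c] fm[OF xor_less8[OF _ c]] a by simp
qed

definition diag8 :: "(nat \<Rightarrow> real) \<Rightarrow> mat8" where "diag8 \<delta> = (\<Sum>i<8. \<delta> i *\<^sub>R E i i)"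

lemma diag8_E: "i < 8 \<Longrightarrow> j < 8 \<Longrightarrow> diag8 \<delta> * E i j = \<delta> i *\<^sub>R E i j"
proof -
  assume ij: "i < 8" "j < 8"
  have "diag8 \<delta> * E i j = (\<Sum>k<8. if k = i then \<delta> i *\<^sub>R E i j else 0)"
    unfolding diag8_def sum_distrib_right using ij by (intro sum.cong refl) auto
  thus ?thesis using ij by simp
qed

lemma tp_diag8 [simp]: "tp (diag8 \<delta>) = diag8 \<delta>" by (simp add: diag8_def tp_sum)

lemma E_diag8: "i < 8 \<Longrightarrow> j < 8 \<Longrightarrow> E i j * diag8 \<delta> = \<delta> j *\<^sub>R E i j"
  using arg_cong[OF diag8_E[of j i \<delta>], of tp] by simp

lemma diag8_O8:
  assumes "\<And>i. \<delta> i \<in> {1, -1}"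
  shows "diag8 \<delta> \<in> O8"
proof -
  have "\<delta> c * \<delta> c = 1" for c using assms[of c] by auto
  hence "diag8 \<delta> * diag8 \<delta> = 1" by - (rule mat8_eq_colI, simp add: mult.assoc diag8_E)
  thus ?thesis by (simp add: O8_def)
qed

lemma Ad_diag8_e: "i < 8 \<Longrightarrow> j < 8 \<Longrightarrow> Ad (diag8 \<delta>) (e i j) = (\<delta> i * \<delta> j) *\<^sub>R e i j"
  by (simp add: Ad_def e_def algebra_simps diag8_E E_diag8)

lemma Ad_lin: "Ad g (c *\<^sub>R X) = c *\<^sub>R Ad g X" "Ad g (- X) = - Ad g X" "Ad g (X + Y) = Ad g X + Ad g Y"
  by (simp_all add: Ad_def algebra_simps)

lemma Ad_so8 [simp]: "X \<in> so8 \<Longrightarrow> Ad g X \<in> so8" by (simp add: so8_iff Ad_def mult.assoc)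

lemma half_cs_linked_anticommute:
  assumes X: "half_cs X" and rel: "br X (br X Y) = - Y"
  shows "X * Y = - (Y * X)"
proof -
  have XX: "X * X = - ((1/4) *\<^sub>R 1)" "X * (X * A) = - ((1/4) *\<^sub>R A)" for A
    using X by (simp_all add: half_cs_def power2_eq_square flip: mult.assoc)
  have q: "Y = (1/4) *\<^sub>R Y + (1/4) *\<^sub>R Y + (1/4) *\<^sub>R Y + (1/4) *\<^sub>R Y"
    by (simp flip: scaleR_add_left)
  have "br X (br X Y) = - ((1/4) *\<^sub>R Y) - 2 *\<^sub>R (X * (Y * X)) - (1/4) *\<^sub>R Y"
    by (simp add: br_def algebra_simps XX scaleR_2)
  also have "br X (br X Y) = - ((1/4) *\<^sub>R Y + (1/4) *\<^sub>R Y + (1/4) *\<^sub>R Y + (1/4) *\<^sub>R Y)"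
    unfolding rel using q by (rule arg_cong)
  finally have "2 *\<^sub>R (X * (Y * X)) = 2 *\<^sub>R ((1/4) *\<^sub>R Y)"
    unfolding scaleR_2 by (simp add: algebra_simps)
  hence "X * (Y * X) = (1/4) *\<^sub>R Y" by (simp only: scaleR_cancel_left) simp
  hence "X * (X * (Y * X)) = (1/4) *\<^sub>R (X * Y)" by simp
  hence "(1/4) *\<^sub>R (X * Y) = (1/4) *\<^sub>R (- (Y * X))" by (simp add: XX)
  thus ?thesis by (simp only: scaleR_cancel_left) simp
qed

text \<open>Minus twice the images of the \<open>e 0 a\<close> form a Clifford system \<open>J\<close>. After sign changes, which
  conjugation by a diagonal matrix realises on the source, the matrix with columns \<open>u\<close> and \<open>J a * u\<close>
  intertwines \<open>G\<close> with \<open>J\<close>.\<close>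

lemma aut_half_cs:
  assumes \<phi>: "aut \<phi>" and h: "\<forall>a\<in>{1..7}. half_cs (\<phi> (e 0 a))"
  obtains g and \<delta> :: "nat \<Rightarrow> real" where "g \<in> O8" "\<delta> 0 = 1" "\<And>a. \<delta> a \<in> {1, -1}"
    "\<And>X. X \<in> so8 \<Longrightarrow> \<phi> (Ad (diag8 \<delta>) X) = Ad g (triality X)"
proof -
  define J where "J a = (-2) *\<^sub>R \<phi> (e 0 a)" for a
  have J: "clifford J"
    unfolding clifford_def
  proof (intro conjI ballI impI)
    fix a :: nat assume a: "a \<in> {1..7}"
    have ha: "half_cs (\<phi> (e 0 a))" using h a by blast
    show "tp (J a) = - J a" "J a * J a = - 1"
      using ha by (simp_all add: J_def half_cs_def so8_iff power2_eq_square)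
    fix b :: nat assume b: "b \<in> {1..7}" and ab: "a \<noteq> b"
    have "\<phi> (e 0 a) * \<phi> (e 0 b) = - (\<phi> (e 0 b) * \<phi> (e 0 a))"
      using a b ab by (intro half_cs_linked_anticommute[OF ha] e0_linked[OF \<phi>]) auto
    thus "J a * J b = - (J b * J a)" by (simp add: J_def)
  qed
  obtain u \<delta> where u: "unit_col u" "\<delta> 0 = 1" "\<And>a. \<delta> a \<in> {1, -1 :: real}" "octonionic (\<lambda>a. \<delta> a *\<^sub>R J a) u"
    using clifford_vector[OF J] by metis
  define J' where "J' a = \<delta> a *\<^sub>R J a" for a
  have J': "clifford J'" using clifford_scale[OF J, of \<delta>] u(3) by (simp add: J'_def[abs_def])
  have o: "octonionic J' u" using u(4) by (simp add: J'_def[abs_def])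
  define f where "f c = (if c = 0 then u else J' c * u)" for c
  have table: "J' a * f c = oct_sign a c *\<^sub>R f (xor a c)" if "a \<in> {1..7}" "c < 8" for a c
    using octonionic_table[OF J' o that] by (simp add: f_def)
  note us = unit_col_simps[OF u(1)]
  have f0: "tp u * (J' k * u) = 0" if "k \<in> {1..7}" for k
    using skew_form_zero[OF cliffordD(1)[OF J' that] us(1)] .
  have "onb f"
  proof -
    have "tp (J' a * u) * (J' b * u) = (if a = b then E 0 0 else 0)" if a: "a \<in> {1..7}" and b: "b \<in> {1..7}" for a b
    proof (cases "a = b")
      case True
      thus ?thesis using us(2) cliffordD(1,3)[OF J' b] by (simp add: mult.assoc)
    next
      case False
      have "xor a b \<noteq> 0"
      proof
        assume "xor a b = 0"
        hence "xor a (xor a b) = a" by simp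
        thus False using False unfolding xor_xor by simp
      qed
      hence k: "xor a b \<in> {1..7}" using xor_less8[of a b] a b by auto
      have fb: "f b = J' b * u" "f (xor a b) = J' (xor a b) * u" using b k by (auto simp: f_def)
      have "tp (J' a * u) * (J' b * u) = - (tp u * (J' a * f b))"
        unfolding fb using cliffordD(1)[OF J' a] by (simp add: mult.assoc)
      also have "J' a * f b = oct_sign a b *\<^sub>R (J' (xor a b) * u)" using table[OF a, of b] b unfolding fb by simp
      also have "- (tp u * oct_sign a b *\<^sub>R (J' (xor a b) * u)) = - (oct_sign a b *\<^sub>R (tp u * (J' (xor a b) * u)))" by simp
      finally show ?thesis using False f0[OF k] by simp
    qed
    moreover have "tp (J' a * u) * u = 0" if "a \<in> {1..7}" for a
      using arg_cong[OF f0[OF that], of tp] by (simp add: mult.assoc)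
    ultimately show ?thesis using f0 us by (auto simp: onb_def f_def mult.assoc simp del: tp_mult)
  qed
  define g where "g = frame f"
  have g: "g \<in> O8" using frame_O8[OF \<open>onb f\<close>] by (simp add: g_def)
  have AdG: "Ad g (G a) = J' a" if a: "a \<in> {1..7}" for a
  proof -
    have "g * G a = J' a * g"
    proof (rule mat8_eq_colI)
      fix c :: nat assume c: "c < 8"
      have "g * G a * E c 0 = oct_sign a c *\<^sub>R f (xor a c)"
        using a c frame_E(1)[OF \<open>onb f\<close>] by (simp add: mult.assoc G_E g_def xor_less8)
      thus "g * G a * E c 0 = J' a * g * E c 0"
        using table[OF a c] frame_E(1)[OF \<open>onb f\<close> c] by (simp add: mult.assoc g_def)
    qed
    thus ?thesis using O8_simps(2)[OF g] by (simp add: Ad_def mult.assoc)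
  qed
  have d: "diag8 \<delta> \<in> O8" using u(3) by (rule diag8_O8)
  have "(\<phi> \<circ> Ad (diag8 \<delta>)) X = (Ad g \<circ> triality) X" if "X \<in> so8" for X
  proof (rule aut_eqI[OF aut_comp[OF \<phi> aut_Ad[OF d]] aut_comp[OF aut_Ad[OF g] aut_triality] _ that])
    fix a :: nat assume a: "a \<in> {1..7}"
    \<comment> \<open>the factor \<open>-2\<close> in \<open>J\<close> matches \<open>triality_e0\<close>\<close>
    have "(\<phi> \<circ> Ad (diag8 \<delta>)) (e 0 a) = \<delta> a *\<^sub>R \<phi> (e 0 a)"
      using a u(2) by (simp add: Ad_diag8_e autD[OF \<phi>])
    also have "\<dots> = - ((1/2) *\<^sub>R J' a)" by (simp add: J'_def J_def)
    also have "\<dots> = (Ad g \<circ> triality) (e 0 a)" using a by (simp add: triality_e0 Ad_lin AdG)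
    finally show "(\<phi> \<circ> Ad (diag8 \<delta>)) (e 0 a) = (Ad g \<circ> triality) (e 0 a)" .
  qed
  thus ?thesis using g u(2,3) that by simp
qed

section \<open>The three cosets of orthogonal conjugations\<close>

lemma Ad_1 [simp]: "Ad 1 X = X" by (simp add: Ad_def)

lemma G_O8: "a \<in> {1..7} \<Longrightarrow> G a \<in> O8"
  using cliffordD(2)[OF clifford_G] by (simp add: O8_def tp_G)

lemma Ad_G_G:
  assumes "a \<in> {1..7}" "b \<in> {1..7}"
  shows "Ad (G a) (G b) = (if a = b then 1 else -1) *\<^sub>R G b"
proof (cases "a = b")
  case True
  thus ?thesis using assms cliffordD(2)[OF clifford_G, of b] by (simp add: Ad_def tp_G)
next
  case False
  have "Ad (G a) (G b) = - (G a * (G b * G a))" using assms by (simp add: Ad_def tp_G mult.assoc)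
  also have "\<dots> = G b * (G a * G a)"
    using cliffordD(5)[OF clifford_G assms False, of "G a"] by simp
  also have "\<dots> = - G b" using cliffordD(2)[OF clifford_G assms(1)] by simp
  finally show ?thesis using False by simp
qed

text \<open>Conjugation by \<open>G m\<close> fixes \<open>G m\<close> and negates the other \<open>G b\<close>; up to a global sign this changes the sign of
  \<open>G m\<close> alone, and composing such conjugations gives every sign pattern.\<close>

lemma clifford_sign_change:
  assumes d: "\<And>a. \<delta> a \<in> {1, -1 :: real}"
  shows "n \<le> 7 \<Longrightarrow> \<exists>K\<in>O8. \<exists>s\<in>{1, -1}. \<forall>b\<in>{1..7}. Ad K (G b) = (s * (if b \<le> n then \<delta> b else 1)) *\<^sub>R G b"
proof (induction n)
  case 0
  show ?case by (rule bexI[of _ 1], rule bexI[of _ 1]) (auto simp: O8_closed)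
next
  case (Suc n)
  hence "n \<le> 7" by simp
  from Suc.IH[OF this] obtain K s where K: "K \<in> O8" "s \<in> {1, -1}"
    and K': "\<forall>b\<in>{1..7}. Ad K (G b) = (s * (if b \<le> n then \<delta> b else 1)) *\<^sub>R G b" by (elim bexE)
  note K = K K'[rule_format]
  show ?case
  proof (cases "\<delta> (Suc n) = 1")
    case True
    hence "Ad K (G b) = (s * (if b \<le> Suc n then \<delta> b else 1)) *\<^sub>R G b" if "b \<in> {1..7}" for b
      using K(3)[OF that] by (auto simp: le_Suc_eq)
    thus ?thesis using K by blast
  next
    case False
    hence dn: "\<delta> (Suc n) = -1" using d[of "Suc n"] by auto
    have n: "Suc n \<in> {1..7}" using Suc.prems by simp
    have "Ad (G (Suc n) * K) (G b) = ((- s) * (if b \<le> Suc n then \<delta> b else 1)) *\<^sub>R G b" if b: "b \<in> {1..7}" for b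
      unfolding Ad_Ad[symmetric] K(3)[OF b] Ad_lin Ad_G_G[OF n b] using dn by (auto simp: le_Suc_eq)
    thus ?thesis using K G_O8[OF n] O8_closed(2) by (intro bexI[of _ "G (Suc n) * K"] bexI[of _ "- s"]) auto
  qed
qed

text \<open>\<open>\<phi>\<close> and \<open>\<psi>\<close> lie in the same right coset of the group of orthogonal conjugations.\<close>

definition same_coset :: "(mat8 \<Rightarrow> mat8) \<Rightarrow> (mat8 \<Rightarrow> mat8) \<Rightarrow> bool" where
  "same_coset \<phi> \<psi> \<longleftrightarrow> (\<exists>g\<in>O8. \<forall>X\<in>so8. \<phi> X = Ad g (\<psi> X))"

lemma same_coset_refl: "(\<And>X. X \<in> so8 \<Longrightarrow> \<phi> X = \<psi> X) \<Longrightarrow> same_coset \<phi> \<psi>"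
  unfolding same_coset_def by (rule bexI[of _ 1]) (auto simp: O8_closed)

lemma same_coset_sym: "same_coset \<phi> \<psi> \<Longrightarrow> same_coset \<psi> \<phi>"
  unfolding same_coset_def by (metis Ad_inverse(2) O8_closed(3))

lemma same_coset_trans: "same_coset \<phi> \<psi> \<Longrightarrow> same_coset \<psi> \<chi> \<Longrightarrow> same_coset \<phi> \<chi>"
  unfolding same_coset_def by (metis Ad_Ad O8_closed(2))

lemma same_coset_comp: "same_coset \<phi> \<psi> \<Longrightarrow> aut \<sigma> \<Longrightarrow> same_coset (\<phi> \<circ> \<sigma>) (\<psi> \<circ> \<sigma>)"
  unfolding same_coset_def using autD(2) by fastforce

text \<open>A reflection; it represents the outer automorphism of \<open>so(8)\<close> that exchanges the two half-spin
  representations.\<close>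

definition flip1 :: mat8 where "flip1 = diag8 (\<lambda>i. if i = 1 then -1 else 1)"

lemma flip1_O8: "flip1 \<in> O8" unfolding flip1_def by (rule diag8_O8) simp

lemma Ad_flip1_e: "a < 8 \<Longrightarrow> Ad flip1 (e 0 a) = (if a = 1 then -1 else 1) *\<^sub>R e 0 a"
  unfolding flip1_def by (subst Ad_diag8_e) auto

lemma aut_triality_flip1: "aut (triality \<circ> Ad flip1)"
  by (intro aut_comp aut_triality aut_Ad flip1_O8)

text \<open>An even number of sign changes passes through triality to an orthogonal conjugation, and an odd number does so
  after one more reflection.\<close>

lemma triality_signs:
  assumes d: "\<And>a. \<delta> a \<in> {1, -1 :: real}" and "\<delta> 0 = 1"
  shows "same_coset (triality \<circ> Ad (diag8 \<delta>)) triality \<or> same_coset (triality \<circ> Ad (diag8 \<delta>)) (triality \<circ> Ad flip1)"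
proof -
  obtain K s where K: "K \<in> O8" "s \<in> {1, -1}" "\<And>b. b \<in> {1..7} \<Longrightarrow> Ad K (G b) = (s * \<delta> b) *\<^sub>R G b"
  proof -
    from clifford_sign_change[of \<delta> 7, OF d order_refl] obtain K s where K: "K \<in> O8" "s \<in> {1, -1}"
      "\<forall>b\<in>{1..7}. Ad K (G b) = (s * (if b \<le> 7 then \<delta> b else 1)) *\<^sub>R G b" by (elim bexE)
    have "Ad K (G b) = (s * \<delta> b) *\<^sub>R G b" if "b \<in> {1..7}" for b
      using bspec[OF K(3) that] that by simp
    with K(1,2) that show thesis by blast
  qed
  have A: "aut (triality \<circ> Ad (diag8 \<delta>))" by (intro aut_comp aut_triality aut_Ad diag8_O8 d)
  have l: "(triality \<circ> Ad (diag8 \<delta>)) (e 0 a) = - ((\<delta> a / 2) *\<^sub>R G a)" if "a \<in> {1..7}" for a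
    using that assms(2) by (simp add: Ad_diag8_e autD[OF aut_triality] triality_e0)
  from K(2) consider "s = 1" | "s = -1" by blast
  thus ?thesis
  proof cases
    case 1
    have "(triality \<circ> Ad (diag8 \<delta>)) X = (Ad K \<circ> triality) X" if "X \<in> so8" for X
      by (rule aut_eqI[OF A aut_comp[OF aut_Ad[OF K(1)] aut_triality] _ that])
        (simp only: l, simp add: triality_e0 Ad_lin K(3) 1)
    hence "same_coset (triality \<circ> Ad (diag8 \<delta>)) triality" using K(1) unfolding same_coset_def by auto
    thus ?thesis ..
  next
    case 2
    \<comment> \<open>the extra factor \<open>G 1\<close> absorbs the global sign and the reflection \<open>flip1\<close>\<close>
    have O: "G 1 * K \<in> O8" using G_O8[of 1] K(1) by (intro O8_closed) auto
    have "(triality \<circ> Ad (diag8 \<delta>)) X = (Ad (G 1 * K) \<circ> (triality \<circ> Ad flip1)) X" if "X \<in> so8" for X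
    proof (rule aut_eqI[OF A aut_comp[OF aut_Ad[OF O] aut_triality_flip1] _ that])
      fix a :: nat assume a: "a \<in> {1..7}"
      have G1: "Ad (G 1) (G a) = (if 1 = a then 1 else -1) *\<^sub>R G a" by (rule Ad_G_G) (use a in auto)
      have "(Ad (G 1 * K) \<circ> (triality \<circ> Ad flip1)) (e 0 a) =
          (if a = 1 then -1 else 1) *\<^sub>R Ad (G 1) (Ad K (triality (e 0 a)))"
        using a by (simp only: comp_apply Ad_flip1_e Ad_Ad[symmetric]) (simp add: autD[OF aut_triality] Ad_flip1_e Ad_lin)
      also have "\<dots> = - ((\<delta> a / 2) *\<^sub>R G a)"
        unfolding triality_e0[OF a] Ad_lin K(3)[OF a] G1 using 2 by auto
      finally show "(triality \<circ> Ad (diag8 \<delta>)) (e 0 a) = (Ad (G 1 * K) \<circ> (triality \<circ> Ad flip1)) (e 0 a)"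
        unfolding l[OF a] ..
    qed
    hence "same_coset (triality \<circ> Ad (diag8 \<delta>)) (triality \<circ> Ad flip1)" using O unfolding same_coset_def by auto
    thus ?thesis ..
  qed
qed

lemma aut_three_cosets:
  assumes \<phi>: "aut \<phi>"
  shows "same_coset \<phi> id \<or> same_coset \<phi> triality \<or> same_coset \<phi> (triality \<circ> Ad flip1)"
proof (cases "plane_rot (\<phi> (e 0 1))")
  case True
  from aut_preserving_plane_rot[OF \<phi> this] show ?thesis unfolding same_coset_def by (metis id_apply)
next
  case False
  hence "\<forall>a\<in>{1..7}. half_cs (\<phi> (e 0 a))" using aut_dichotomy[OF \<phi>] by auto
  from aut_half_cs[OF \<phi> this] obtain g \<delta> where g: "g \<in> O8" "\<delta> 0 = 1" "\<And>a. \<delta> a \<in> {1, -1 :: real}"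
    "\<And>X. X \<in> so8 \<Longrightarrow> \<phi> (Ad (diag8 \<delta>) X) = Ad g (triality X)" by metis
  have "\<phi> X = Ad g ((triality \<circ> Ad (diag8 \<delta>)) X)" if X: "X \<in> so8" for X
    using g(4)[of "Ad (diag8 \<delta>) X"] X Ad_inverse(1)[OF diag8_O8[of \<delta>, OF g(3)], of X] by simp
  hence "same_coset \<phi> (triality \<circ> Ad (diag8 \<delta>))" using g(1) unfolding same_coset_def by blast
  thus ?thesis using triality_signs[of \<delta>, OF g(3) g(2)] same_coset_trans by blast
qed

lemma Ad_plane_rot: assumes "g \<in> O8" "plane_rot X" shows "plane_rot (Ad g X)"
proof -
  note g = O8_simps[OF assms(1)]
  have p: "(Ad g X)^n = Ad g (X^n)" for n
    by (induction n) (simp_all add: Ad_def g mult.assoc power_commutes)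
  have "tr (Ad g (X^2)) = tr (X^2)" unfolding Ad_def by (subst tr_commute) (simp add: g)
  thus ?thesis using assms(2) by (simp add: plane_rot_def p Ad_lin)
qed

lemma half_cs_triality: "c \<in> {1, -1} \<Longrightarrow> half_cs (triality (c *\<^sub>R e 0 1))"
  using cliffordD(2)[OF clifford_G, of 1]
  by (auto simp: autD[OF aut_triality] triality_e0 half_cs_def G_so8 power2_eq_square)

text \<open>Orthogonal conjugations preserve rotations of planes, whereas triality maps \<open>e 0 1\<close> to half a
  complex structure. For the last pair, the test element is \<open>triality (e 0 1)\<close>: reflecting it and
  applying triality gives \<open>e 0 1 + G 1 / 2\<close>, which is again half a complex structure.\<close>

lemma cosets_distinct:
  "\<not> same_coset triality id" "\<not> same_coset (triality \<circ> Ad flip1) id" "\<not> same_coset (triality \<circ> Ad flip1) triality"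
proof -
  have e: "plane_rot (e 0 1)" by (rule plane_rot_e) auto
  show "\<not> same_coset triality id"
  proof
    assume "same_coset triality id"
    then obtain g where "g \<in> O8" "triality (e 0 1) = Ad g (e 0 1)" unfolding same_coset_def by auto
    thus False using Ad_plane_rot[OF _ e] half_cs_triality[of 1] not_plane_rot_half_cs by fastforce
  qed
  show "\<not> same_coset (triality \<circ> Ad flip1) id"
  proof
    assume "same_coset (triality \<circ> Ad flip1) id"
    then obtain g where "g \<in> O8" "triality (Ad flip1 (e 0 1)) = Ad g (e 0 1)" unfolding same_coset_def by auto
    thus False using Ad_plane_rot[OF _ e] half_cs_triality[of "-1"] not_plane_rot_half_cs by (fastforce simp: Ad_flip1_e)
  qed
  have FG: "Ad flip1 (G 1) = G 1 + 2 *\<^sub>R e 0 1"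
  proof (rule mat8_eq_colI)
    fix c :: nat assume "c < 8"
    hence "c = 0 \<or> c = 1 \<or> c = 2 \<or> c = 3 \<or> c = 4 \<or> c = 5 \<or> c = 6 \<or> c = 7" by linarith
    thus "Ad flip1 (G 1) * E c 0 = (G 1 + 2 *\<^sub>R e 0 1) * E c 0"
      by (elim disjE) (simp_all add: Ad_def flip1_def diag8_E mult.assoc G_E oct_sign_def oct_table_def distrib_right e_def left_diff_distrib scaleR_2)
  qed
  show "\<not> same_coset (triality \<circ> Ad flip1) triality"
  proof
    assume "same_coset (triality \<circ> Ad flip1) triality"
    then obtain g where g: "g \<in> O8" "triality (Ad flip1 (triality (e 0 1))) = Ad g (triality (triality (e 0 1)))"
      unfolding same_coset_def using autD(2)[OF aut_triality, of "e 0 1"] by auto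
    define Z where "Z = Ad g (e 0 1)"
    have Z: "plane_rot Z" unfolding Z_def by (rule Ad_plane_rot[OF g(1) e])
    have inv: "triality (triality (e 0 1)) = e 0 1" by (rule triality_involutive) simp
    have "Z = triality (Ad flip1 (triality (e 0 1)))" using g(2) unfolding inv Z_def ..
    also have "triality (e 0 1) = - ((1/2) *\<^sub>R G 1)" by (rule triality_e0) simp
    also have "Ad flip1 (- ((1/2) *\<^sub>R G 1)) = triality (e 0 1) + - e 0 1"
      unfolding Ad_lin FG by (simp add: triality_e0 scaleR_add_right)
    also have "triality \<dots> = triality (triality (e 0 1)) - triality (e 0 1)"
      by (subst autD(3)[OF aut_triality]) (simp_all add: autD(2)[OF aut_triality] aut_lin(2)[OF aut_triality])
    also have "\<dots> = e 0 1 + (1/2) *\<^sub>R G 1" unfolding inv by (simp add: triality_e0)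
    finally have Zd: "Z = e 0 1 + (1/2) *\<^sub>R G 1" .
    \<comment> \<open>off the plane of \<open>e 0 1\<close> the matrix \<open>Z\<close> acts with eigenvalues of modulus one half\<close>
    have 1: "Z * E 2 0 = (1/2) *\<^sub>R E 3 0" "Z * E 3 0 = - ((1/2) *\<^sub>R E 2 0)"
      by (simp_all add: Zd distrib_right G_E oct_sign_def oct_table_def e_def left_diff_distrib)
    have "Z^3 * E 2 0 = - (1/8) *\<^sub>R E 3 0" by (simp add: power3_eq_cube mult.assoc 1)
    moreover have "Z^3 = - Z" using Z by (simp add: plane_rot_def)
    ultimately have "(1/2) *\<^sub>R E 3 0 = (1/8) *\<^sub>R E 3 0" using 1(1) by simp
    hence "E 3 0 = 0" by (simp only: scaleR_cancel_right) simp
    from arg_cong[OF this, of "\<lambda>A. ent A 3 0"] show False by simp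
  qed
qed

text \<open>An involution of a three-element set has a fixed point. If it is not fixed by \<open>t\<close>, then \<open>s\<close> also fixes its
  image under \<open>t\<close>, and \<open>s\<close> and \<open>t\<close> both fix the remaining point.\<close>

lemma common_fixed_of_three:
  fixes s t :: "nat \<Rightarrow> nat"
  assumes "\<And>i. i < 3 \<Longrightarrow> s i < 3" "\<And>i. i < 3 \<Longrightarrow> t i < 3" "\<And>i. i < 3 \<Longrightarrow> s (s i) = i"
    "\<And>i. i < 3 \<Longrightarrow> t (t i) = i" "\<And>i. i < 3 \<Longrightarrow> s (t i) = t (s i)"
  shows "\<exists>i<3. s i = i \<and> t i = i"
proof -
  have third: "\<exists>r<3. r \<noteq> p \<and> r \<noteq> q \<and> (\<forall>x<3. x \<noteq> p \<and> x \<noteq> q \<longrightarrow> x = r)"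
    if "p < 3" "q < 3" "p \<noteq> q" for p q :: nat
  proof -
    have "p = 0 \<or> p = 1 \<or> p = 2" "q = 0 \<or> q = 1 \<or> q = 2" using that by linarith+
    thus ?thesis using that(3) by (intro exI[of _ "3 - p - q"]) (elim disjE; auto)
  qed
  have swap: "f r = r" if f: "\<And>i. i < 3 \<Longrightarrow> f i < 3" "\<And>i. i < 3 \<Longrightarrow> f (f i) = i" and "f p = q" "r < 3"
    "r \<noteq> p" "r \<noteq> q" "p < 3" and all: "\<forall>x<3. x \<noteq> p \<and> x \<noteq> q \<longrightarrow> x = r" for f :: "nat \<Rightarrow> nat" and p q r
  proof -
    have "f r \<noteq> p" using f(2)[OF \<open>r < 3\<close>] \<open>f p = q\<close> \<open>r \<noteq> q\<close> by metis
    moreover have "f r \<noteq> q" using f(2)[OF \<open>r < 3\<close>] f(2)[OF \<open>p < 3\<close>] \<open>f p = q\<close> \<open>r \<noteq> p\<close> by metis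
    ultimately show ?thesis using all f(1)[of r] \<open>r < 3\<close> by blast
  qed
  have "\<exists>p<3. s p = p"
  proof (cases "s 0 = 0")
    case False
    have "s 0 < 3" by (rule assms(1)) simp
    from third[OF zero_less_numeral this False[symmetric]]
    obtain r where r: "r < 3" "r \<noteq> 0" "r \<noteq> s 0" "\<forall>x<3. x \<noteq> 0 \<and> x \<noteq> s 0 \<longrightarrow> x = r" by blast
    have "s r = r" by (rule swap[OF assms(1) assms(3) refl r(1-3) _ r(4)]) simp_all
    thus ?thesis using r(1) by blast
  qed (rule exI[of _ 0], simp)
  then obtain p where p: "p < 3" "s p = p" by blast
  show ?thesis
  proof (cases "t p = p")
    case False
    define q where "q = t p"
    have q: "q < 3" "q \<noteq> p" "s q = q" using assms(2)[OF p(1)] assms(5)[OF p(1)] p(2) False by (simp_all add: q_def)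
    from third[OF p(1) q(1) q(2)[symmetric]]
    obtain r where r: "r < 3" "r \<noteq> p" "r \<noteq> q" "\<forall>x<3. x \<noteq> p \<and> x \<noteq> q \<longrightarrow> x = r" by blast
    have "t r = r" by (rule swap[OF assms(2) assms(4) q_def[symmetric] r(1-3) p(1) r(4)]) simp_all
    moreover have "s r \<noteq> p" "s r \<noteq> q" using assms(3)[OF r(1)] p(2) q(3) r(2,3) by metis+
    hence "s r = r" using r assms(1)[of r] by blast
    ultimately show ?thesis using r by blast
  qed (use p in blast)
qed

text \<open>\<open>\<sigma>\<close> and \<open>\<tau>\<close> act on the three right cosets by composition on the right; a representative \<open>\<psi>\<close> of a common
  fixed coset conjugates both into the group of orthogonal conjugations.\<close>

lemma commuting_involutions_orthogonal:
  assumes \<sigma>: "aut \<sigma>" and \<tau>: "aut \<tau>"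
    and ss: "\<And>X. X \<in> so8 \<Longrightarrow> \<sigma> (\<sigma> X) = X" and tt: "\<And>X. X \<in> so8 \<Longrightarrow> \<tau> (\<tau> X) = X"
    and st: "\<And>X. X \<in> so8 \<Longrightarrow> \<sigma> (\<tau> X) = \<tau> (\<sigma> X)"
  obtains \<psi> g h where "aut \<psi>" "g \<in> O8" "h \<in> O8" "\<And>X. X \<in> so8 \<Longrightarrow> \<psi> (\<sigma> X) = Ad g (\<psi> X)"
    "\<And>X. X \<in> so8 \<Longrightarrow> \<psi> (\<tau> X) = Ad h (\<psi> X)"
proof -
  define R where "R i = [id, triality, triality \<circ> Ad flip1] ! i" for i
  have Raut: "aut (R i)" if "i < 3" for i
    using that aut_id aut_triality aut_triality_flip1 by (auto simp: R_def less_Suc_eq numeral_3_eq_3)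
  have ex: "\<exists>j<3. same_coset \<phi> (R j)" if "aut \<phi>" for \<phi>
  proof -
    have "same_coset \<phi> (R 0) \<or> same_coset \<phi> (R 1) \<or> same_coset \<phi> (R 2)"
      using aut_three_cosets[OF that] by (simp add: R_def)
    thus ?thesis by (elim disjE) (rule exI, rule conjI[rotated], assumption, simp)+
  qed
  have uniq: "i = j" if "same_coset (R i) (R j)" "i < 3" "j < 3" for i j
  proof -
    have ij: "i = 0 \<or> i = 1 \<or> i = 2" "j = 0 \<or> j = 1 \<or> j = 2" using that by linarith+
    have "\<not> same_coset id triality" "\<not> same_coset id (triality \<circ> Ad flip1)" "\<not> same_coset triality (triality \<circ> Ad flip1)"
      using cosets_distinct same_coset_sym by blast+
    with that(1) show ?thesis using cosets_distinct
      by (insert ij, elim disjE) (simp_all add: R_def)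
  qed
  define ac where "ac \<theta> i = (SOME j. j < 3 \<and> same_coset (R i \<circ> \<theta>) (R j))" for \<theta> i
  have ac: "ac \<theta> i < 3" "same_coset (R i \<circ> \<theta>) (R (ac \<theta> i))" if "aut \<theta>" "i < 3" for \<theta> i
    using someI_ex[OF ex[OF aut_comp[OF Raut[OF that(2)] that(1)]]] unfolding ac_def by auto
  have ac2: "same_coset (R i \<circ> (\<theta> \<circ> \<theta>')) (R (ac \<theta>' (ac \<theta> i)))" if "aut \<theta>" "aut \<theta>'" "i < 3" for \<theta> \<theta>' i
    using same_coset_trans[OF same_coset_comp[OF ac(2)[OF that(1,3)] that(2)] ac(2)[OF that(2) ac(1)[OF that(1,3)]]]
    by (simp add: comp_assoc)
  have "\<exists>i<3. ac \<sigma> i = i \<and> ac \<tau> i = i"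
  proof (rule common_fixed_of_three)
    fix i :: nat assume i: "i < 3"
    show "ac \<sigma> i < 3" "ac \<tau> i < 3" using ac i \<sigma> \<tau> by auto
    have sq: "ac \<theta> (ac \<theta> i) = i" if "aut \<theta>" "\<And>X. X \<in> so8 \<Longrightarrow> \<theta> (\<theta> X) = X" for \<theta>
    proof -
      have "same_coset (R i) (R i \<circ> (\<theta> \<circ> \<theta>))" by (rule same_coset_refl) (simp add: that)
      from uniq[OF same_coset_trans[OF this ac2[OF that(1,1) i]]] show ?thesis using ac that i by simp
    qed
    show "ac \<sigma> (ac \<sigma> i) = i" "ac \<tau> (ac \<tau> i) = i" using sq \<sigma> \<tau> ss tt by auto
    have "same_coset (R i \<circ> (\<tau> \<circ> \<sigma>)) (R i \<circ> (\<sigma> \<circ> \<tau>))" by (rule same_coset_refl) (simp add: st)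
    from uniq[OF same_coset_trans[OF same_coset_trans[OF same_coset_sym[OF ac2[OF \<tau> \<sigma> i]] this] ac2[OF \<sigma> \<tau> i]]]
    show "ac \<sigma> (ac \<tau> i) = ac \<tau> (ac \<sigma> i)" using ac \<sigma> \<tau> i by simp
  qed
  then obtain i where i: "i < 3" "same_coset (R i \<circ> \<sigma>) (R i)" "same_coset (R i \<circ> \<tau>) (R i)"
    using ac(2)[OF \<sigma>] ac(2)[OF \<tau>] by metis
  thus ?thesis using that[OF Raut[OF i(1)]] unfolding same_coset_def by auto
qed

section \<open>Centralisers of families of projections\<close>

fun block_index :: "nat list \<Rightarrow> nat \<Rightarrow> nat" where
  "block_index [] i = 0"
| "block_index (n # ns) i = (if i < n then 0 else Suc (block_index ns (i - n)))"

lemma block_index_less: "i < sum_list ns \<Longrightarrow> block_index ns i < length ns"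
  by (induction ns arbitrary: i) auto

definition ortho_list :: "mat8 list \<Rightarrow> bool" where
  "ortho_list us \<longleftrightarrow> (\<forall>i<length us. \<forall>j<length us. tp (us ! i) * us ! j = (if i = j then E 0 0 else 0)) \<and>
     (\<forall>u\<in>set us. u * E 0 0 = u)"

lemma ortho_list_append:
  assumes "ortho_list us" "ortho_list vs" "\<And>u v. u \<in> set us \<Longrightarrow> v \<in> set vs \<Longrightarrow> tp u * v = 0"
  shows "ortho_list (us @ vs)"
proof -
  have s: "tp v * u = 0" if "u \<in> set us" "v \<in> set vs" for u v
    using arg_cong[OF assms(3)[OF that], of tp] by simp
  show ?thesis using assms unfolding ortho_list_def
    by (auto simp: nth_append s)
qed

lemma ortho_list_single: "unit_col u \<Longrightarrow> ortho_list [u]" by (simp add: ortho_list_def unit_col_def)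

lemma orth_proj_sub_orth:
  assumes "tp P = P" "P * v = v" "P * u = 0"
  shows "tp u * v = 0"
proof -
  have "tp u * v = tp u * (P * v)" using assms(2) by simp
  also have "\<dots> = tp (P * u) * v" by (simp add: assms(1) mult.assoc)
  finally have "tp u * v = tp (P * u) * v" .
  thus ?thesis using assms(3) by simp
qed

lemma orth_proj_basis:
  "orth_proj P \<Longrightarrow> tr P < real n \<Longrightarrow> \<exists>us. ortho_list us \<and> (\<forall>u\<in>set us. P * u = u) \<and> tr P = real (length us)"
proof (induction n arbitrary: P)
  case 0
  thus ?case using orth_proj_tr_nonneg[of P] by simp
next
  case (Suc n)
  show ?case
  proof (cases "P = 0")
    case True
    thus ?thesis by (intro exI[of _ "[]"]) (simp add: ortho_list_def)
  next
    case False
    then obtain u where u: "unit_col u" "P * u = u" using orth_proj_fixed_unit_col[OF Suc.prems(1)] by blast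
    let ?P = "P - u * tp u"
    have s: "orth_proj ?P" "tr ?P = tr P - 1" using orth_proj_minus_unit_col[OF Suc.prems(1) u] by auto
    have Pu: "?P * u = 0" using u unit_col_simps[OF u(1)] by (simp add: algebra_simps)
    obtain us where us: "ortho_list us" "\<forall>v\<in>set us. ?P * v = v" "tr ?P = real (length us)"
      using Suc.IH[OF s(1)] s(2) Suc.prems(2) by auto
    have uv: "tp u * v = 0" if "v \<in> set us" for v
      using orth_proj_sub_orth[OF _ _ Pu] s(1) us(2) that by (simp add: orth_proj_def)
    have "P * v = v" if v: "v \<in> set us" for v
    proof -
      have "?P * v = v" using us(2) v by blast
      thus ?thesis using uv[OF v] by (simp add: algebra_simps)
    qed
    moreover have "ortho_list ([u] @ us)" using us(1) u uv by (intro ortho_list_append ortho_list_single) auto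
    ultimately show ?thesis using u s(2) us(3) by (intro exI[of _ "u # us"]) auto
  qed
qed

text \<open>Concatenating orthonormal bases of the images, in the order of the projections, makes the block structure
  visible in the positions.\<close>

lemma orth_proj_family_basis:
  assumes "\<forall>P\<in>set Ps. orth_proj P" "\<And>i j. i < j \<Longrightarrow> j < length Ps \<Longrightarrow> Ps ! i * Ps ! j = 0"
  shows "\<exists>us ns. length ns = length Ps \<and> length us = sum_list ns \<and> ortho_list us \<and>
    (\<forall>i<length us. Ps ! (block_index ns i) * us ! i = us ! i) \<and> (\<forall>a<length ns. tr (Ps ! a) = real (ns ! a))"
  using assms
proof (induction Ps)
  case Nil
  show ?case by (intro exI[of _ "[]"]) (simp add: ortho_list_def)
next
  case (Cons P Ps)
  have "Ps ! i * Ps ! j = 0" if "i < j" "j < length Ps" for i j using Cons.prems(2)[of "Suc i" "Suc j"] that by simp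
  with Cons obtain us ns where IH: "length ns = length Ps" "length us = sum_list ns" "ortho_list us"
    "\<forall>i<length us. Ps ! (block_index ns i) * us ! i = us ! i" "\<forall>a<length ns. tr (Ps ! a) = real (ns ! a)" by auto
  have P: "orth_proj P" using Cons.prems by simp
  obtain n :: nat where "tr P < real n" using reals_Archimedean2 by blast
  from orth_proj_basis[OF P this] obtain vs where
    vs: "ortho_list vs" "\<forall>u\<in>set vs. P * u = u" "tr P = real (length vs)" by blast
  have "tp v * u = 0" if v: "v \<in> set vs" and u: "u \<in> set us" for u v
  proof -
    obtain i where i: "i < length us" "u = us ! i" using u by (auto simp: in_set_conv_nth)
    hence b: "block_index ns i < length Ps" using block_index_less[of i ns] IH by simp
    have "P * Ps ! (block_index ns i) = 0" using Cons.prems(2)[of 0 "Suc (block_index ns i)"] b by simp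
    moreover have "u = Ps ! (block_index ns i) * u" using IH(4) i by simp
    ultimately have "P * u = 0" by (metis mult.assoc mult_zero_left)
    hence "tp u * v = 0" using orth_proj_sub_orth[of P v u] P vs(2) v by (simp add: orth_proj_def)
    from arg_cong[OF this, of tp] show ?thesis by simp
  qed
  hence o: "ortho_list (vs @ us)" by (intro ortho_list_append vs IH)
  show ?case
  proof (intro exI conjI)
    show "ortho_list (vs @ us)" by (rule o)
    show "length (length vs # ns) = length (P # Ps)" using IH by simp
    show "length (vs @ us) = sum_list (length vs # ns)" using IH by simp
    show "\<forall>i<length (vs @ us). (P # Ps) ! (block_index (length vs # ns) i) * (vs @ us) ! i = (vs @ us) ! i"
      using IH(4) vs(2) by (auto simp: nth_append)
    show "\<forall>a<length (length vs # ns). tr ((P # Ps) ! a) = real ((length vs # ns) ! a)"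
      using IH(5) vs(3) by (auto simp: nth_Cons split: nat.split)
  qed
qed

lemma onb_ortho_list: "ortho_list us \<Longrightarrow> length us = 8 \<Longrightarrow> onb (\<lambda>i. us ! i)"
  by (auto simp: ortho_list_def onb_def)

lemma ent_diag8:
  assumes "i < 8" "j < 8"
  shows "ent (diag8 \<delta> * Y) i j = \<delta> i * ent Y i j" "ent (Y * diag8 \<delta>) i j = ent Y i j * \<delta> j"
proof -
  have d: "ent (diag8 \<delta>) k l = (if k = l then \<delta> l else 0)" if "k < 8" "l < 8" for k l
  proof -
    have "ent (diag8 \<delta>) k l = (\<Sum>x<8. \<delta> x * (if k = x \<and> l = x then 1 else 0))"
      using that by (simp add: diag8_def ent_sum)
    also have "\<dots> = (\<Sum>x<8. if x = l then if k = l then \<delta> l else 0 else 0)"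
      by (intro sum.cong refl) auto
    finally show ?thesis using that by simp
  qed
  have "ent (diag8 \<delta> * Y) i j = (\<Sum>k<8. ent (diag8 \<delta>) i k * ent Y k j)" by (rule ent_mult[OF assms])
  also have "\<dots> = (\<Sum>k<8. if k = i then \<delta> i * ent Y i j else 0)"
    by (intro sum.cong refl) (use assms in \<open>auto simp: d\<close>)
  finally have "ent (diag8 \<delta> * Y) i j = \<dots>" .
  thus "ent (diag8 \<delta> * Y) i j = \<delta> i * ent Y i j" using assms by simp
  have "ent (Y * diag8 \<delta>) i j = (\<Sum>k<8. ent Y i k * ent (diag8 \<delta>) k j)" by (rule ent_mult[OF assms])
  also have "\<dots> = (\<Sum>k<8. if k = j then ent Y i j * \<delta> j else 0)"
    by (intro sum.cong refl) (use assms in \<open>auto simp: d\<close>)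
  finally have "ent (Y * diag8 \<delta>) i j = \<dots>" .
  thus "ent (Y * diag8 \<delta>) i j = ent Y i j * \<delta> j" using assms by simp
qed

definition so_blocks :: "nat list \<Rightarrow> mat8 set" where
  "so_blocks ns = {Y \<in> so8. \<forall>i<8. \<forall>j<8. block_index ns i \<noteq> block_index ns j \<longrightarrow> ent Y i j = 0}"

lemma Ad_commute_iff:
  assumes "g \<in> O8"
  shows "X * Ad g D = Ad g D * X \<longleftrightarrow> Ad (tp g) X * D = D * Ad (tp g) X"
proof -
  note g = O8_simps[OF assms]
  have "Ad (tp g) (X * Ad g D) = Ad (tp g) X * D" "Ad (tp g) (Ad g D * X) = D * Ad (tp g) X"
    by (simp_all add: Ad_def mult.assoc g)
  thus ?thesis by (metis Ad_inverse(1)[OF assms])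
qed

text \<open>In an adapted orthonormal basis the projections are the diagonal indicator matrices of the blocks, and a
  matrix commutes with these exactly if its entries between different blocks vanish.\<close>

lemma commutant_of_projs:
  assumes "\<forall>P\<in>set Ps. orth_proj P" "\<And>i j. i < j \<Longrightarrow> j < length Ps \<Longrightarrow> Ps ! i * Ps ! j = 0"
    and sum: "sum_list Ps = 1" and nz: "0 \<notin> set Ps"
  obtains g ns where "g \<in> O8" "length ns = length Ps" "sum_list ns = 8" "\<forall>n\<in>set ns. n \<ge> 1"
    "Ad g ` {X \<in> so8. \<forall>P\<in>set Ps. X * P = P * X} = so_blocks ns"
proof -
  obtain us ns where un: "length ns = length Ps" "length us = sum_list ns" "ortho_list us"
    "\<forall>i<length us. Ps ! (block_index ns i) * us ! i = us ! i" "\<forall>a<length ns. tr (Ps ! a) = real (ns ! a)"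
    using orth_proj_family_basis[OF assms(1,2)] by blast
  have "tr (sum_list Ps) = (\<Sum>P\<leftarrow>Ps. tr P)" by (induction Ps) auto
  also have "\<dots> = (\<Sum>a<length Ps. tr (Ps ! a))" by (simp add: sum_list_sum_nth lessThan_atLeast0)
  also have "\<dots> = (\<Sum>a<length ns. real (ns ! a))" using un(1,5) by (intro sum.cong) auto
  also have "\<dots> = real (sum_list ns)" by (simp add: sum_list_sum_nth lessThan_atLeast0)
  finally have s8: "sum_list ns = 8" using sum by simp
  define f where "f i = us ! i" for i
  have f: "onb f" using onb_ortho_list[OF un(3)] un(2) s8 by (simp add: f_def[abs_def])
  let ?g = "frame f"
  have g: "?g \<in> O8" by (rule frame_O8[OF f])
  define d where "d a i = (if block_index ns i = a then 1 else 0 :: real)" for a i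
  have orth: "Ps ! a * Ps ! b = 0" if "a < length Ps" "b < length Ps" "a \<noteq> b" for a b
  proof (cases "a < b")
    case False
    hence "Ps ! b * Ps ! a = 0" using assms(2) that by simp
    hence "tp (Ps ! b * Ps ! a) = 0" by simp
    thus ?thesis using assms(1) that by (simp add: orth_proj_def)
  qed (use assms(2) that in auto)
  have PD: "Ps ! a = Ad ?g (diag8 (d a))" if a: "a < length Ps" for a
  proof -
    have "Ps ! a * ?g = ?g * diag8 (d a)"
    proof (rule mat8_eq_colI)
      fix c :: nat assume c: "c < 8"
      let ?b = "block_index ns c"
      have b: "?b < length Ps" using block_index_less[of c ns] c s8 un(1) by simp
      have fb: "Ps ! ?b * f c = f c" using un(2,4) c s8 by (simp add: f_def)
      have "Ps ! a * f c = d a c *\<^sub>R f c"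
      proof (cases "a = ?b")
        case False
        hence "Ps ! a * f c = 0" using orth[OF a b] fb by (metis mult.assoc mult_zero_left)
        thus ?thesis using False by (simp add: d_def)
      qed (simp add: d_def fb)
      thus "Ps ! a * ?g * E c 0 = ?g * diag8 (d a) * E c 0"
        using c by (simp add: mult.assoc frame_E(1)[OF f] diag8_E)
    qed
    from arg_cong[OF this, of "\<lambda>z. z * tp ?g"] show ?thesis
      by (simp add: Ad_def mult.assoc O8_simps[OF g])
  qed
  have iff: "(\<forall>P\<in>set Ps. X * P = P * X) \<longleftrightarrow> Ad (tp ?g) X \<in> so_blocks ns" if X: "X \<in> so8" for X
  proof -
    define Y where "Y = Ad (tp ?g) X"
    have "(\<forall>P\<in>set Ps. X * P = P * X) \<longleftrightarrow> (\<forall>a<length Ps. X * Ps ! a = Ps ! a * X)"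
      by (simp add: all_set_conv_all_nth)
    also have "\<dots> \<longleftrightarrow> (\<forall>a<length Ps. Y * diag8 (d a) = diag8 (d a) * Y)"
      unfolding Y_def using PD Ad_commute_iff[OF g] by metis
    also have "\<dots> \<longleftrightarrow> (\<forall>i<8. \<forall>j<8. block_index ns i \<noteq> block_index ns j \<longrightarrow> ent Y i j = 0)"
    proof safe
      fix i j :: nat assume a: "\<forall>a<length Ps. Y * diag8 (d a) = diag8 (d a) * Y" and ij: "i < 8" "j < 8" "block_index ns i \<noteq> block_index ns j"
      have "block_index ns i < length Ps" using block_index_less[of i ns] ij s8 un(1) by simp
      hence "ent (Y * diag8 (d (block_index ns i))) i j = ent (diag8 (d (block_index ns i)) * Y) i j" using a by simp
      thus "ent Y i j = 0" using ij by (simp add: ent_diag8) (simp add: d_def)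
    next
      fix a assume *: "\<forall>i<8. \<forall>j<8. block_index ns i \<noteq> block_index ns j \<longrightarrow> ent Y i j = 0"
      show "Y * diag8 (d a) = diag8 (d a) * Y"
      proof (rule mat8_eqI)
        fix i j :: nat assume ij: "i < 8" "j < 8"
        have "d a i = d a j \<or> ent Y i j = 0" using * ij by (auto simp: d_def)
        thus "ent (Y * diag8 (d a)) i j = ent (diag8 (d a) * Y) i j" using ij by (auto simp: ent_diag8)
      qed
    qed
    finally show ?thesis using X by (simp add: so_blocks_def Y_def)
  qed
  have "Ad (tp ?g) ` {X \<in> so8. \<forall>P\<in>set Ps. X * P = P * X} = so_blocks ns"
  proof (intro equalityI subsetI)
    fix Y assume "Y \<in> so_blocks ns"
    hence "Y \<in> so8" "Ad (tp ?g) (Ad ?g Y) \<in> so_blocks ns" by (auto simp: so_blocks_def Ad_inverse[OF g])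
    thus "Y \<in> Ad (tp ?g) ` {X \<in> so8. \<forall>P\<in>set Ps. X * P = P * X}"
      using iff[of "Ad ?g Y"] by (intro image_eqI[of _ _ "Ad ?g Y"]) (auto simp: Ad_inverse[OF g])
  qed (use iff in auto)
  moreover have "\<forall>n\<in>set ns. n \<ge> 1"
  proof
    fix n assume "n \<in> set ns"
    then obtain a where a: "a < length ns" "n = ns ! a" by (auto simp: in_set_conv_nth)
    hence "Ps ! a \<in> set Ps" using un(1) by simp
    hence "tr (Ps ! a) \<noteq> 0" using nz assms(1) orth_proj_tr0 by metis
    thus "n \<ge> 1" using un(5) a by auto
  qed
  ultimately show ?thesis using that[OF O8_closed(3)[OF g] un(1) s8] by simp
qed

definition J_std :: mat8 where "J_std = (\<Sum>i<4. E (i + 4) i - E i (i + 4))"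
definition D_std :: mat8 where "D_std = diag8 (\<lambda>i. if i = 3 \<or> i = 7 then -1 else 1)"
text \<open>The algebra \<open>u(3) + u(1)\<close>, as the centraliser of the standard complex structure and of the
  reflection in the fourth complex coordinate.\<close>

definition u3_u1 :: "mat8 set" where "u3_u1 = {Y \<in> so8. Y * J_std = J_std * Y \<and> Y * D_std = D_std * Y}"

definition conj_standard :: "mat8 set \<Rightarrow> bool" where
  "conj_standard k \<longleftrightarrow> (\<exists>\<phi>. aut \<phi> \<and> ((\<exists>ns. (length ns = 3 \<or> length ns = 4) \<and> sum_list ns = 8 \<and> (\<forall>n\<in>set ns. n \<ge> 1) \<and>
     \<phi> ` k = so_blocks ns) \<or> \<phi> ` k = u3_u1))"

lemma conj_standard_image:
  assumes "aut \<psi>" "conj_standard (\<psi> ` k)"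
  shows "conj_standard k"
proof -
  from assms(2) obtain \<phi> where "aut \<phi>" and *: "(\<exists>ns. (length ns = 3 \<or> length ns = 4) \<and> sum_list ns = 8 \<and>
     (\<forall>n\<in>set ns. n \<ge> 1) \<and> \<phi> ` \<psi> ` k = so_blocks ns) \<or> \<phi> ` \<psi> ` k = u3_u1" unfolding conj_standard_def by (elim exE conjE)
  from * show ?thesis unfolding conj_standard_def image_comp by (intro exI[of _ "\<phi> \<circ> \<psi>"] conjI aut_comp \<open>aut \<phi>\<close> assms)
qed

text \<open>The joint eigenprojections are \<open>(1 \<plusminus> g) (1 \<plusminus> h) / 4\<close>. If two of them vanished, then one of \<open>g\<close>, \<open>h\<close>,
  \<open>g h\<close> would be \<open>\<plusminus>1\<close>: each sum of two is \<open>(1 \<plusminus> g) / 2\<close>, \<open>(1 \<plusminus> h) / 2\<close> or \<open>(1 \<plusminus> g h) / 2\<close>.\<close>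

lemma conj_standard_diagonal:
  assumes g: "g \<in> O8" "g * g = 1" "g \<noteq> 1" "g \<noteq> -1" and h: "h \<in> O8" "h * h = 1" "h \<noteq> 1" "h \<noteq> -1"
    and gh: "g * h = h * g" "g \<noteq> h" "g \<noteq> - h"
  shows "conj_standard {X \<in> so8. X * g = g * X \<and> X * h = h * X}"
proof -
  have sym: "tp g = g" "tp h = h" using g(1,2) h(1,2) by (metis O8_simps(3) mult_1_right)+
  have r: "g * (g * A) = A" "h * (h * A) = A" "h * (g * A) = g * (h * A)" for A
    using g(2) h(2) gh(1) by (simp_all flip: mult.assoc)
  define p where "p = (1/4 :: real) *\<^sub>R ((1 + g) * (1 + h))"
  define q where "q = (1/4 :: real) *\<^sub>R ((1 + g) * (1 - h))"
  define u where "u = (1/4 :: real) *\<^sub>R ((1 - g) * (1 + h))"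
  define v where "v = (1/4 :: real) *\<^sub>R ((1 - g) * (1 - h))"
  define Ps where "Ps = filter (\<lambda>P. P \<noteq> 0) [p, q, u, v]"
  \<comment> \<open>splitting scalars into sums lets ring normalisation verify the identities below\<close>
  have quarter: "A = (1/4) *\<^sub>R A + (1/4) *\<^sub>R A + (1/4) *\<^sub>R A + (1/4) *\<^sub>R A" for A :: mat8
    by (simp flip: scaleR_add_left)
  have half: "(1/2) *\<^sub>R A = (1/4) *\<^sub>R A + (1/4) *\<^sub>R A" for A :: mat8
    by (simp flip: scaleR_add_left)
  have idem: "orth_proj ((1/4 :: real) *\<^sub>R ((1 + a *\<^sub>R g) * (1 + b *\<^sub>R h)))" if "a \<in> {1, -1}" "b \<in> {1, -1}" for a b
  proof -
    have ab: "a * a = 1" "b * b = 1" using that by auto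
    have hs: "orth_proj ((1/2 :: real) *\<^sub>R (1 + c *\<^sub>R s))" if "c * c = 1" "tp s = s" "s * s = 1" for c s
    proof -
      have "c *\<^sub>R s * c *\<^sub>R s = 1" using that by simp
      hence "(1 + c *\<^sub>R s) * (1 + c *\<^sub>R s) = 2 *\<^sub>R (1 + c *\<^sub>R s)"
        unfolding scaleR_2 distrib_left distrib_right by simp
      thus ?thesis using that by (simp add: orth_proj_def)
    qed
    hence "orth_proj (((1/2 :: real) *\<^sub>R (1 + a *\<^sub>R g)) * ((1/2 :: real) *\<^sub>R (1 + b *\<^sub>R h)))"
      by (intro orth_proj_mult hs ab sym g(2) h(2)) (simp add: algebra_simps gh(1))
    thus ?thesis by simp
  qed
  have sp: "orth_proj p" "orth_proj q" "orth_proj u" "orth_proj v"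
    using idem[of 1 1] idem[of 1 "-1"] idem[of "-1" 1] idem[of "-1" "-1"] by (simp_all add: p_def q_def u_def v_def)
  have orth: "p * q = 0" "p * u = 0" "p * v = 0" "q * u = 0" "q * v = 0" "u * v = 0"
    by (simp_all add: p_def q_def u_def v_def algebra_simps r g(2) h(2) gh(1)[symmetric])
  have sum: "p + q + u + v = 1" "p + q - u - v = g" "p - q + u - v = h"
    using quarter[of 1] quarter[of g] quarter[of h] by (simp_all add: p_def q_def u_def v_def algebra_simps)
  have sums: "p + q = (1/2 :: real) *\<^sub>R (1 + g)" "p + u = (1/2 :: real) *\<^sub>R (1 + h)" "p + v = (1/2 :: real) *\<^sub>R (1 + g * h)"
    "q + u = (1/2 :: real) *\<^sub>R (1 - g * h)" "q + v = (1/2 :: real) *\<^sub>R (1 - h)" "u + v = (1/2 :: real) *\<^sub>R (1 - g)"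
    unfolding half by (simp_all add: p_def q_def u_def v_def algebra_simps)
  have ghn: "1 + g * h \<noteq> 0" "1 - g * h \<noteq> 0"
  proof -
    have "g * (1 + g * h) = g + h" "g * (1 - g * h) = g - h" by (simp_all add: algebra_simps r)
    thus "1 + g * h \<noteq> 0" "1 - g * h \<noteq> 0" using gh(2,3) by (metis add_eq_0_iff2 mult_zero_right, metis eq_iff_diff_eq_0 mult_zero_right)
  qed
  have n: "p + q \<noteq> 0" "p + u \<noteq> 0" "p + v \<noteq> 0" "q + u \<noteq> 0" "q + v \<noteq> 0" "u + v \<noteq> 0"
  proof -
    have "- g \<noteq> 1" "- h \<noteq> 1" using g(4) h(4) by (metis minus_minus)+
    thus "p + q \<noteq> 0" "p + u \<noteq> 0" "p + v \<noteq> 0" "q + u \<noteq> 0" "q + v \<noteq> 0" "u + v \<noteq> 0"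
      unfolding sums using g h ghn by (simp_all add: add_eq_0_iff2 add_eq_0_iff)
  qed
  hence len: "length Ps = 3 \<or> length Ps = 4" by (auto simp: Ps_def)
  have setPs: "set Ps = {p, q, u, v} - {0}" unfolding Ps_def set_filter by auto
  have com: "(\<forall>P\<in>set Ps. X * P = P * X) \<longleftrightarrow> X * g = g * X \<and> X * h = h * X" for X
  proof
    assume *: "\<forall>P\<in>set Ps. X * P = P * X"
    have "X * P = P * X" if "P \<in> {p, q, u, v}" for P using * that unfolding setPs by (cases "P = 0") auto
    hence "X * p = p * X" "X * q = q * X" "X * u = u * X" "X * v = v * X" by auto
    thus "X * g = g * X \<and> X * h = h * X" unfolding sum(2,3)[symmetric] by (simp add: algebra_simps)
  next
    assume *: "X * g = g * X \<and> X * h = h * X"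
    hence "X * (g * h) = g * h * X" by (metis mult.assoc)
    with * show "\<forall>P\<in>set Ps. X * P = P * X"
      unfolding setPs by (auto simp: p_def q_def u_def v_def algebra_simps)
  qed
  have sl: "sum_list Ps = 1"
  proof -
    have *: "sum_list (filter (\<lambda>P. P \<noteq> 0) Qs) = sum_list Qs" for Qs :: "mat8 list" by (induction Qs) auto
    show ?thesis unfolding Ps_def * using sum(1) by (simp add: add.assoc)
  qed
  have "sorted_wrt (\<lambda>P Q. P * Q = 0) Ps" unfolding Ps_def by (rule sorted_wrt_filter) (simp add: orth)
  hence o: "Ps ! i * Ps ! j = 0" if "i < j" "j < length Ps" for i j using that by (simp add: sorted_wrt_iff_nth_less)
  have a: "\<forall>P\<in>set Ps. orth_proj P" "0 \<notin> set Ps" using sp unfolding setPs by auto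
  from commutant_of_projs[OF a(1) o sl a(2)] obtain s ns where "s \<in> O8" "length ns = length Ps" "sum_list ns = 8"
    "\<forall>n\<in>set ns. n \<ge> 1" "Ad s ` {X \<in> so8. \<forall>P\<in>set Ps. X * P = P * X} = so_blocks ns" by blast
  thus ?thesis unfolding com conj_standard_def using len aut_Ad[of s]
    by (intro exI[of _ "Ad s"] conjI, simp, intro disjI1 exI[of _ ns], simp)
qed

section \<open>Complex structures\<close>

text \<open>A unitary basis of the image of a projection that commutes with \<open>J\<close>, found by splitting off one
  complex line at a time.\<close>

lemma complex_basis:
  assumes J: "tp J = - J" "J * J = -1"
  shows "orth_proj P \<Longrightarrow> P * J = J * P \<Longrightarrow> tr P < real n \<Longrightarrow> \<exists>us. ortho_list us \<and> (\<forall>u\<in>set us. P * u = u) \<and>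
    (\<forall>u\<in>set us. \<forall>v\<in>set us. tp u * (J * v) = 0) \<and> tr P = 2 * real (length us)"
proof (induction n arbitrary: P)
  case 0
  thus ?case using orth_proj_tr_nonneg[of P] by simp
next
  case (Suc n)
  have JJ: "J * (J * A) = - A" for A using J(2) by (simp flip: mult.assoc)
  show ?case
  proof (cases "P = 0")
    case True
    thus ?thesis by (intro exI[of _ "[]"]) (simp add: ortho_list_def)
  next
    case False
    then obtain u where u: "unit_col u" "P * u = u" using orth_proj_fixed_unit_col[OF Suc.prems(1)] by blast
    note us = unit_col_simps[OF u(1)]
    define w where "w = J * u"
    have uw: "tp u * w = 0" unfolding w_def by (rule skew_form_zero[OF J(1) us(1)])
    have wu: "tp w * u = 0" using arg_cong[OF uw, of tp] by simp
    have w: "unit_col w" using us by (simp add: unit_col_def w_def mult.assoc J(1) JJ)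
    note ws = unit_col_simps[OF w]
    let ?P = "P - u * tp u" and ?R = "P - u * tp u - w * tp w"
    have s1: "orth_proj ?P" "tr ?P = tr P - 1" using orth_proj_minus_unit_col[OF Suc.prems(1) u] by auto
    have "P * w = w" unfolding w_def using Suc.prems(2) u(2) by (metis mult.assoc)
    hence "?P * w = w" using uw by (simp add: algebra_simps)
    note s2 = orth_proj_minus_unit_col[OF s1(1) w this]
    have "?R * J = J * ?R"
      using Suc.prems(2) by (simp add: w_def algebra_simps J JJ)
    then obtain us' where us': "ortho_list us'" "\<forall>v\<in>set us'. ?R * v = v"
      "\<forall>u\<in>set us'. \<forall>v\<in>set us'. tp u * (J * v) = 0" "tr ?R = 2 * real (length us')"
      using Suc.IH[OF s2(1)] s1(2) s2(2) Suc.prems(3) by auto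
    have R0: "?R * u = 0" "?R * w = 0"
      using u \<open>P * w = w\<close> us ws uw wu by (simp_all add: algebra_simps)
    have uv: "tp u * v = 0" "tp w * v = 0" if "v \<in> set us'" for v
      using orth_proj_sub_orth[OF _ _ R0(1)] orth_proj_sub_orth[OF _ _ R0(2)] s2(1) us'(2) that by (simp_all add: orth_proj_def)
    have "P * v = v" if v: "v \<in> set us'" for v
    proof -
      have "?R * v = v" using us'(2) v by blast
      thus ?thesis using uv[OF v] by (simp add: algebra_simps)
    qed
    moreover have "ortho_list ([u] @ us')" using us'(1) u uv by (intro ortho_list_append ortho_list_single) auto
    moreover have "tp u * (J * v) = 0" "tp v * (J * u) = 0" if v: "v \<in> set us'" for v
    proof -
      show "tp u * (J * v) = 0" using uv(2)[OF v] by (simp add: w_def J(1) mult.assoc)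
      show "tp v * (J * u) = 0" using arg_cong[OF uv(2)[OF v], of tp] by (simp add: w_def)
    qed
    ultimately show ?thesis using u uw s1(2) s2(2) us'(3,4)
      by (intro exI[of _ "u # us'"]) (auto simp: w_def)
  qed
qed

lemma J_std_E: "c < 8 \<Longrightarrow> J_std * E c 0 = (if c < 4 then E (c + 4) 0 else - E (c - 4) 0)"
proof -
  assume c: "c < 8"
  have "J_std * E c 0 = (\<Sum>i<4. if i = c then E (c + 4) 0 else 0) - (\<Sum>i<4. if i = c - 4 then (if c < 4 then 0 else E (c - 4) 0) else 0)"
    unfolding J_std_def sum_distrib_right sum_subtractf[symmetric] using c
    by (intro sum.cong refl) (auto simp: left_diff_distrib)
  also have "\<dots> = (if c < 4 then E (c + 4) 0 else - E (c - 4) 0)" using c by auto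
  finally show ?thesis .
qed

lemma complex_frame:
  assumes J: "tp J = - J" "J * J = -1" and us: "ortho_list us" "length us = 4"
    and uJ: "\<forall>u\<in>set us. \<forall>v\<in>set us. tp u * (J * v) = 0"
  defines "f \<equiv> \<lambda>i. if i < 4 then us ! i else J * us ! (i - 4)"
  shows "onb f" "J = Ad (frame f) J_std"
proof -
  have JJ: "J * (J * A) = - A" for A using J(2) by (simp flip: mult.assoc)
  have uJ': "tp (us ! i) * (J * us ! j) = 0" if "i < 4" "j < 4" for i j using uJ us(2) that by auto
  have o: "tp (us ! i) * us ! j = (if i = j then E 0 0 else 0)" if "i < 4" "j < 4" for i j
    using us that by (simp add: ortho_list_def)
  have c: "us ! i * E 0 0 = us ! i" if "i < 4" for i using us that by (auto simp: ortho_list_def)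
  show f: "onb f"
    unfolding onb_def
  proof (intro conjI allI impI)
    fix i j :: nat assume i: "i < 8"
    show "f i * E 0 0 = f i" using i c by (auto simp: f_def mult.assoc)
    assume j: "j < 8"
    have l: "i - 4 < 4" "j - 4 < 4" using i j by auto
    show "tp (f i) * f j = (if i = j then E 0 0 else 0)"
      using o[of i j] o[OF l] uJ'[of i "j - 4"] arg_cong[OF uJ'[of j "i - 4"], of tp] i j
      by (auto simp: f_def J(1) JJ mult.assoc)
  qed
  have "J * frame f = frame f * J_std"
  proof (rule mat8_eq_colI)
    fix c :: nat assume c: "c < 8"
    have "J * f c = (if c < 4 then f (c + 4) else - f (c - 4))" using c by (auto simp: f_def JJ)
    moreover have "frame f * (J_std * E c 0) = (if c < 4 then f (c + 4) else - f (c - 4))"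
      using c frame_E(1)[OF f] by (simp add: J_std_E)
    ultimately show "J * frame f * E c 0 = frame f * J_std * E c 0" using c frame_E(1)[OF f] by (simp add: mult.assoc)
  qed
  from arg_cong[OF this, of "\<lambda>z. z * tp (frame f)"] show "J = Ad (frame f) J_std"
    by (simp add: Ad_def mult.assoc O8_simps[OF frame_O8[OF f]])
qed

lemma ex_complex_frame:
  assumes J: "tp J = - J" "J * J = -1"
  obtains g where "g \<in> O8" "J = Ad g J_std"
proof -
  have "orth_proj 1" by (simp add: orth_proj_def)
  from complex_basis[OF J this, of 9] obtain us where us: "ortho_list us" "length us = 4"
    "\<forall>u\<in>set us. \<forall>v\<in>set us. tp u * (J * v) = 0" by auto
  from complex_frame[OF J us] show ?thesis using that frame_O8 by blast
qed

text \<open>A unitary basis adapted to the eigenspaces of \<open>d\<close>; the trace of \<open>d\<close> says that these have complex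
  dimensions 3 and 1.\<close>

lemma ex_unitary_frame:
  assumes J: "tp J = - J" "J * J = -1" and d: "tp d = d" "d * d = 1" "d * J = J * d" "tr d = 4"
  obtains g where "g \<in> O8" "J = Ad g J_std" "d = Ad g D_std"
proof -
  define P Q where "P = (1/2 :: real) *\<^sub>R (1 + d)" and "Q = (1/2 :: real) *\<^sub>R (1 - d)"
  have PP: "(1 + d) * (1 + d) = 2 *\<^sub>R (1 + d)" "(1 - d) * (1 - d) = 2 *\<^sub>R (1 - d)"
    using d(2) unfolding scaleR_2 by (simp_all add: algebra_simps)
  have P: "orth_proj P" "P * J = J * P" "tr P = 6" and Q: "orth_proj Q" "Q * J = J * Q" "tr Q = 2"
  proof -
    have "P * P = P" "Q * Q = Q" by (simp_all add: P_def Q_def PP)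
    thus "orth_proj P" "orth_proj Q" using d(1) by (simp_all add: P_def Q_def orth_proj_def)
    show "P * J = J * P" "Q * J = J * Q" "tr P = 6" "tr Q = 2"
      using d(3,4) by (simp_all add: P_def Q_def algebra_simps)
  qed
  have PQ: "Q * P = 0" using d(2) by (simp add: P_def Q_def algebra_simps)
  obtain us where us: "ortho_list us" "\<forall>u\<in>set us. P * u = u" "\<forall>u\<in>set us. \<forall>v\<in>set us. tp u * (J * v) = 0" "length us = 3"
    using complex_basis[OF J P(1,2), of 7] P(3) by auto
  obtain vs where vs: "ortho_list vs" "\<forall>u\<in>set vs. Q * u = u" "\<forall>u\<in>set vs. \<forall>v\<in>set vs. tp u * (J * v) = 0" "length vs = 1"
    using complex_basis[OF J Q(1,2), of 3] Q(3) by auto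
  have Qu: "Q * u = 0" if "u \<in> set us" for u using us(2) that PQ by (metis mult.assoc mult_zero_left)
  have cross: "tp u * v = 0" "tp u * (J * v) = 0" "tp v * (J * u) = 0" if u: "u \<in> set us" and v: "v \<in> set vs" for u v
  proof -
    have Qv: "Q * v = v" "Q * (J * v) = J * v" using vs(2) v Q(2) by (auto, metis mult.assoc)
    show "tp u * v = 0" by (rule orth_proj_sub_orth[OF _ Qv(1) Qu[OF u]]) (use Q in \<open>simp add: orth_proj_def\<close>)
    show 0: "tp u * (J * v) = 0" by (rule orth_proj_sub_orth[OF _ Qv(2) Qu[OF u]]) (use Q in \<open>simp add: orth_proj_def\<close>)
    show "tp v * (J * u) = 0" using arg_cong[OF 0, of tp] by (simp add: J(1) mult.assoc)
  qed
  have o: "ortho_list (us @ vs)" using cross(1) by (intro ortho_list_append us vs)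
  have l: "length (us @ vs) = 4" using us(4) vs(4) by simp
  have uJ: "\<forall>u\<in>set (us @ vs). \<forall>v\<in>set (us @ vs). tp u * (J * v) = 0"
    using us(3) vs(3) cross by auto
  define f where "f i = (if i < 4 then (us @ vs) ! i else J * (us @ vs) ! (i - 4))" for i
  note F = complex_frame[OF J o l uJ, folded f_def[abs_def]]
  have dP: "d * u = u" if "u \<in> set us" for u
  proof -
    have "P * u - Q * u = d * u" by (simp add: P_def Q_def algebra_simps flip: scaleR_add_left)
    thus ?thesis using us(2) Qu that by simp
  qed
  have dQ: "d * v = - v" if "v \<in> set vs" for v
  proof -
    have "d * Q = - Q" using d(2) by (simp add: Q_def algebra_simps)
    moreover have "v = Q * v" using vs(2) that by simp
    ultimately show ?thesis by (metis mult.assoc mult_minus_left)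
  qed
  have dJ: "d * (J * A) = J * (d * A)" for A using d(3) by (simp flip: mult.assoc)
  have df: "d * f c = (if c = 3 \<or> c = 7 then -1 else 1) *\<^sub>R f c" if c: "c < 8" for c
  proof -
    have "d * (us @ vs) ! i = (if i = 3 then -1 else 1) *\<^sub>R (us @ vs) ! i" if "i < 4" for i
    proof (cases "i = 3")
      case True
      thus ?thesis using dQ us(4) vs(4) by (simp add: nth_append)
    next
      case False
      thus ?thesis using dP us(4) that by (simp add: nth_append)
    qed
    from this[of c] this[of "c - 4"] c show ?thesis by (auto simp: f_def dJ)
  qed
  let ?g = "frame f"
  have "d * ?g = ?g * D_std"
  proof (rule mat8_eq_colI)
    fix c :: nat assume c: "c < 8"
    show "d * ?g * E c 0 = ?g * D_std * E c 0"
      using c df[OF c] frame_E(1)[OF F(1)] by (simp add: mult.assoc D_std_def diag8_E)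
  qed
  from arg_cong[OF this, of "\<lambda>z. z * tp ?g"] have "d = Ad ?g D_std"
    by (simp add: Ad_def mult.assoc O8_simps[OF frame_O8[OF F(1)]])
  thus ?thesis using that[OF frame_O8[OF F(1)] F(2)] by blast
qed

lemma conj_standard_unitary:
  assumes J: "tp J = - J" "J * J = -1" and d: "tp d = d" "d * d = 1" "d * J = J * d" "tr d = 4"
  shows "conj_standard {X \<in> so8. X * d = d * X \<and> X * J = J * X}"
proof -
  obtain g where g: "g \<in> O8" "J = Ad g J_std" "d = Ad g D_std" using ex_unitary_frame[OF assms] .
  have "Ad (tp g) ` {X \<in> so8. X * d = d * X \<and> X * J = J * X} = u3_u1"
  proof (intro equalityI subsetI)
    fix Y assume "Y \<in> u3_u1"
    hence "Ad g Y \<in> {X \<in> so8. X * d = d * X \<and> X * J = J * X}"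
      unfolding g(2,3) by (simp add: u3_u1_def Ad_commute_iff[OF g(1)] Ad_inverse[OF g(1)])
    thus "Y \<in> Ad (tp g) ` {X \<in> so8. X * d = d * X \<and> X * J = J * X}"
      by (rule image_eqI[rotated]) (simp add: Ad_inverse[OF g(1)])
  next
    fix Y assume "Y \<in> Ad (tp g) ` {X \<in> so8. X * d = d * X \<and> X * J = J * X}"
    thus "Y \<in> u3_u1" unfolding g(2,3) by (auto simp: u3_u1_def Ad_commute_iff[OF g(1)])
  qed
  thus ?thesis unfolding conj_standard_def using aut_Ad[OF O8_closed(3)[OF g(1)]] by blast
qed

text \<open>The squares of the \<open>e i j\<close> produce the diagonal matrix units and then \<open>e i j\<close> all others, so only scalars
  commute with \<open>so(8)\<close>.\<close>

lemma commutant_so8: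
  assumes "\<And>X. X \<in> so8 \<Longrightarrow> A * X = X * A"
  obtains c where "A = c *\<^sub>R 1"
proof -
  have comm: "A * (X * Y) = X * Y * A" if "A * X = X * A" "A * Y = Y * A" for X Y
    using that by (metis mult.assoc)
  have ii: "A * E i i = E i i * A" if i: "i < 8" for i
  proof -
    \<comment> \<open>two further indices: \<open>E i i\<close> is the product of \<open>(e i j)\<^sup>2\<close> and \<open>(e i k)\<^sup>2\<close>\<close>
    define j k where "j = (if i = 0 then 1 else 0 :: nat)" and "k = (if i \<le> 1 then 2 else 1 :: nat)"
    have jk: "j < 8" "k < 8" "i \<noteq> j" "i \<noteq> k" "j \<noteq> k" by (auto simp: j_def k_def)
    have "A * (e i a * e i a) = e i a * e i a * A" if "a < 8" for a
      using assms i that by (intro comm) auto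
    from comm[OF this[OF jk(1)] this[OF jk(2)]]
    have "A * (e i j * e i j * (e i k * e i k)) = e i j * e i j * (e i k * e i k) * A" .
    moreover have "e i j * e i j * (e i k * e i k) = E i i"
      using i jk by (simp add: e_def algebra_simps)
    ultimately show ?thesis by simp
  qed
  have ij: "A * E i j = E i j * A" if "i < 8" "j < 8" for i j
  proof (cases "i = j")
    case False
    have "A * (e i j * E j j) = e i j * E j j * A" using that assms ii by (intro comm) auto
    moreover have "e i j * E j j = E i j" using that False by (simp add: e_def algebra_simps)
    ultimately show ?thesis by simp
  qed (use ii that in simp)
  have "A = (\<Sum>i<8. A * E i i)" by (simp add: sum_E_diag flip: sum_distrib_left)
  also have "\<dots> = (\<Sum>i<8. ent A 0 0 *\<^sub>R E i i)"
  proof (intro sum.cong refl)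
    fix i :: nat assume i: "i \<in> {..<8}"
    have "A * E i i = A * E i 0 * E 0 i" using i by (simp add: mult.assoc)
    also have "\<dots> = E i 0 * (A * E 0 i)" using ij[of i 0] i by (simp add: mult.assoc)
    also have "\<dots> = ent A 0 0 *\<^sub>R E i i" using i by (simp add: E_mult_ent)
    finally show "A * E i i = ent A 0 0 *\<^sub>R E i i" .
  qed
  also have "\<dots> = ent A 0 0 *\<^sub>R 1" by (simp add: sum_E_diag flip: scaleR_sum_right)
  finally show ?thesis using that by blast
qed

lemma Ad_fix_iff: "g \<in> O8 \<Longrightarrow> Ad g X = X \<longleftrightarrow> X * g = g * X"
proof -
  assume g: "g \<in> O8"
  have "Ad g X * g = g * X" by (simp add: Ad_def mult.assoc O8_simps[OF g])
  moreover have "X * g * tp g = X" by (simp add: mult.assoc O8_simps[OF g])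
  ultimately show ?thesis unfolding Ad_def by metis
qed

lemma Ad_trivial:
  assumes g: "g \<in> O8" and triv: "\<And>X. X \<in> so8 \<Longrightarrow> Ad g X = X"
  shows "g = 1 \<or> g = -1"
proof -
  obtain c where c: "g = c *\<^sub>R 1" using commutant_so8[of g] triv Ad_fix_iff[OF g] by metis
  have "(c * c) *\<^sub>R (1 :: mat8) = 1 *\<^sub>R 1" using O8_simps(1)[OF g] by (simp add: c)
  hence "c * c = 1" unfolding scaleR_cancel_right by simp
  hence "c = 1 \<or> c = -1" using square_eq_1_iff by blast
  thus ?thesis using c by auto
qed

lemma Ad_eq:
  assumes g: "g \<in> O8" and h: "h \<in> O8" and eq: "\<And>X. X \<in> so8 \<Longrightarrow> Ad g X = Ad h X"
  shows "g = h \<or> g = - h"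
proof -
  have "tp h * g = 1 \<or> tp h * g = -1"
    by (rule Ad_trivial) (auto simp: O8_closed g h eq Ad_inverse[OF h] simp flip: Ad_Ad)
  hence "h * (tp h * g) = h \<or> h * (tp h * g) = - h" by auto
  thus ?thesis by (simp add: O8_simps[OF h])
qed

text \<open>All complex structures are orthogonally conjugate, and triality exchanges \<open>e 0 1\<close> with minus half
  of \<open>G 1\<close>.\<close>

lemma to_plane_rotation:
  assumes J: "tp J = - J" "J * J = -1"
  obtains \<psi> where "aut \<psi>" "\<psi> ((1/2) *\<^sub>R J) = - e 0 1"
proof -
  have G: "tp (G 1) = - G 1" "G 1 * G 1 = -1" using cliffordD(1,2)[OF clifford_G, of 1] by auto
  obtain g where g: "g \<in> O8" "J = Ad g J_std" using ex_complex_frame[OF J] .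
  obtain h where h: "h \<in> O8" "G 1 = Ad h J_std" using ex_complex_frame[OF G] .
  have hg: "h * tp g \<in> O8" using g h by (intro O8_closed)
  have "Ad (h * tp g) J = G 1" using g(2) h(2) Ad_inverse(2)[OF g(1)] by (simp flip: Ad_Ad)
  hence "(triality \<circ> Ad (h * tp g)) ((1/2) *\<^sub>R J) = triality ((1/2) *\<^sub>R G 1)" by (simp add: Ad_lin)
  also have "(1/2) *\<^sub>R G 1 = - triality (e 0 1)" by (simp add: triality_e0)
  also have "triality \<dots> = - e 0 1"
    by (simp add: aut_lin(2)[OF aut_triality] autD(2)[OF aut_triality] triality_involutive del: triality_e0)
  finally show ?thesis by (rule that[OF aut_comp[OF aut_triality aut_Ad[OF hg]]])
qed

lemma aut_image_Collect:
  assumes \<psi>: "aut \<psi>" and iff: "\<And>Y. Y \<in> so8 \<Longrightarrow> A Y \<longleftrightarrow> B (\<psi> Y)"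
  shows "\<psi> ` {X \<in> so8. A X} = {X \<in> so8. B X}"
proof (intro equalityI subsetI)
  fix X assume X: "X \<in> {X \<in> so8. B X}"
  then obtain Y where "Y \<in> so8" "X = \<psi> Y" using aut_lin(4)[OF \<psi>, of X] by blast
  thus "X \<in> \<psi> ` {X \<in> so8. A X}" using X iff by auto
qed (use iff autD(2)[OF \<psi>] in auto)

text \<open>Conjugation by \<open>J\<close> is \<open>1 + 2 (ad (J / 2))\<^sup>2\<close>, so an automorphism \<open>\<psi>\<close> sending \<open>J / 2\<close> to \<open>- e 0 1\<close> turns it
  into conjugation by the diagonal matrix \<open>d = 1 + 2 (e 0 1)\<^sup>2\<close>. The other involution preserves the line through
  \<open>J / 2\<close>, so after \<open>\<psi>\<close> it maps a rotation of a plane to one and is still an orthogonal conjugation.\<close>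

lemma conj_standard_complex:
  assumes J: "J \<in> O8" "J * J = -1" and h: "h \<in> O8"
    and inv: "\<And>X. X \<in> so8 \<Longrightarrow> Ad h (Ad h X) = X"
    and com: "\<And>X. X \<in> so8 \<Longrightarrow> Ad J (Ad h X) = Ad h (Ad J X)"
    and nt: "\<exists>X\<in>so8. Ad h X \<noteq> X" "\<exists>X\<in>so8. Ad J X \<noteq> Ad h X"
  shows "conj_standard {X \<in> so8. Ad J X = X \<and> Ad h X = X}"
proof -
  have "tp J * (J * J) = J" using O8_simps(3)[OF J(1)] .
  hence Jt: "tp J = - J" unfolding J(2) by (metis minus_equation_iff mult_minus1_right)
  have Jso: "(1/2) *\<^sub>R J \<in> so8" using Jt by (simp add: so8_iff)
  have hJ: "Ad h J = J \<or> Ad h J = - J"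
  proof -
    have "J * h = h * J \<or> J * h = - (h * J)"
      by (rule Ad_eq) (auto simp: J h O8_closed com simp flip: Ad_Ad)
    hence "h * J = J * h \<or> h * J = - (J * h)" by auto
    moreover have "J * h * tp h = J" by (simp add: mult.assoc O8_simps[OF h])
    ultimately show ?thesis unfolding Ad_def by (metis mult_minus_left)
  qed
  obtain \<psi> where \<psi>: "aut \<psi>" "\<psi> ((1/2) *\<^sub>R J) = - e 0 1" using to_plane_rotation[OF Jt J(2)] .
  define \<psi>' where "\<psi>' = inv_into so8 \<psi>"
  note i = aut_inv[OF \<psi>(1), folded \<psi>'_def]
  define d where "d = 1 + 2 *\<^sub>R (e 0 1 * e 0 1)"
  have ee: "e 0 1 * e 0 1 = - E 0 0 - E 1 1" by (simp add: e_def algebra_simps)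
  have d: "tp d = d" "d * d = 1" "tr d = 4" unfolding d_def ee by (simp_all add: algebra_simps scaleR_2)
  have dO: "d \<in> O8" using d by (simp add: O8_def)
  have \<sigma>: "\<psi> (Ad J Y) = Ad d (\<psi> Y)" if Y: "Y \<in> so8" for Y
  proof -
    let ?Z = "\<psi> Y"
    have Z: "?Z \<in> so8" using autD(2)[OF \<psi>(1) Y] .
    have "br ((1/2) *\<^sub>R J) (br ((1/2) *\<^sub>R J) Y) = (1/4) *\<^sub>R (J * (J * Y) - 2 *\<^sub>R (J * (Y * J)) + Y * (J * J))"
      by (simp add: br_def algebra_simps scaleR_2)
    also have "\<dots> = (1/4) *\<^sub>R (2 *\<^sub>R (Ad J Y - Y))"
    proof -
      have "J * (J * Y) = - Y" using J(2) by (simp flip: mult.assoc)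
      thus ?thesis using J(2) unfolding Ad_def Jt scaleR_2 by (simp add: algebra_simps)
    qed
    finally have "Ad J Y = Y + 2 *\<^sub>R br ((1/2) *\<^sub>R J) (br ((1/2) *\<^sub>R J) Y)" by simp
    hence "\<psi> (Ad J Y) = ?Z + 2 *\<^sub>R br (- e 0 1) (br (- e 0 1) ?Z)"
      using Y Jso by (simp only: autD[OF \<psi>(1)] so8_closed \<psi>(2))
    also have "\<dots> = ?Z + 2 *\<^sub>R (e 0 1 * (e 0 1 * ?Z) - 2 *\<^sub>R (e 0 1 * (?Z * e 0 1)) + ?Z * (e 0 1 * e 0 1))"
      by (simp add: br_def algebra_simps scaleR_2)
    also have "\<dots> = Ad d ?Z"
    proof -
      have 3: "e 0 1 * (e 0 1 * e 0 1) = - e 0 1"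
        using plane_rot_e[of 0 1] by (simp add: plane_rot_def power3_eq_cube mult.assoc)
      have s: "e 0 1 * (?Z * e 0 1) = (- ent ?Z 0 1) *\<^sub>R e 0 1" by (rule e_sandwich[OF _ _ Z]) auto
      have "e 0 1 * (e 0 1 * (?Z * (e 0 1 * e 0 1))) = e 0 1 * (e 0 1 * (?Z * e 0 1)) * e 0 1" by (simp add: mult.assoc)
      also have "\<dots> = - (e 0 1 * (?Z * e 0 1))" unfolding s using 3 by (simp add: mult.assoc)
      finally show ?thesis unfolding Ad_def d(1) unfolding d_def by (simp add: algebra_simps scaleR_2)
    qed
    finally show ?thesis .
  qed
  define \<tau> where "\<tau> = \<psi> \<circ> (Ad h \<circ> \<psi>')"
  have \<tau>: "aut \<tau>" unfolding \<tau>_def by (intro aut_comp \<psi>(1) aut_Ad h i(1))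
  have \<tau>\<psi>: "\<tau> (\<psi> Y) = \<psi> (Ad h Y)" if "Y \<in> so8" for Y using i(2) that by (simp add: \<tau>_def)
  have "\<tau> (- e 0 1) = - e 0 1 \<or> \<tau> (- e 0 1) = e 0 1"
    using \<tau>\<psi>[OF Jso] hJ \<psi>(2) Jso aut_lin(2)[OF \<psi>(1) Jso] by (auto simp: Ad_lin)
  hence "\<tau> (e 0 1) = e 0 1 \<or> \<tau> (e 0 1) = - e 0 1"
    using aut_lin(2)[OF \<tau>, of "e 0 1"] by (auto simp: minus_equation_iff)
  moreover have "plane_rot (e 0 1)" by (rule plane_rot_e) auto
  moreover have "plane_rot (- e 0 1)" using plane_rot_e[of 1 0] by (simp add: e_def)
  ultimately have "plane_rot (\<tau> (e 0 1))" by auto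
  then obtain h' where h': "h' \<in> O8" "\<And>X. X \<in> so8 \<Longrightarrow> \<tau> X = Ad h' X"
    using aut_preserving_plane_rot[OF \<tau>] by metis
  have \<tau>h: "\<psi> (Ad h Y) = Ad h' (\<psi> Y)" if "Y \<in> so8" for Y
    using \<tau>\<psi>[OF that] h'(2)[OF autD(2)[OF \<psi>(1) that]] by simp
  have surj: "\<exists>Y\<in>so8. X = \<psi> Y" if "X \<in> so8" for X using aut_lin(4)[OF \<psi>(1) that] .
  have k: "\<psi> ` {X \<in> so8. Ad J X = X \<and> Ad h X = X} = {X \<in> so8. X * d = d * X \<and> X * h' = h' * X}"
  proof -
    have "Ad J Y = Y \<longleftrightarrow> Ad d (\<psi> Y) = \<psi> Y" "Ad h Y = Y \<longleftrightarrow> Ad h' (\<psi> Y) = \<psi> Y" if "Y \<in> so8" for Y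
      using aut_lin(3)[OF \<psi>(1)] that by (simp_all flip: \<sigma> \<tau>h)
    thus ?thesis by (intro aut_image_Collect[OF \<psi>(1)]) (simp add: Ad_fix_iff[OF dO] Ad_fix_iff[OF h'(1)])
  qed
  have inv': "Ad h' (Ad h' X) = X" if "X \<in> so8" for X
    using surj[OF that] inv by (auto simp flip: \<tau>h)
  have com': "Ad d (Ad h' X) = Ad h' (Ad d X)" if "X \<in> so8" for X
    using surj[OF that] com by (auto simp flip: \<tau>h \<sigma>)
  have "h' * h' = 1 \<or> h' * h' = -1"
    by (rule Ad_trivial) (auto simp: O8_closed h' inv' simp flip: Ad_Ad)
  moreover have "d * h' = h' * d"
  proof -
    have "d * h' = h' * d \<or> d * h' = - (h' * d)"
      by (rule Ad_eq) (auto simp: dO h' O8_closed com' simp flip: Ad_Ad)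
    moreover have "d * h' \<noteq> - (h' * d)"
    proof
      \<comment> \<open>anticommuting with the orthogonal \<open>h'\<close> would make \<open>d\<close> traceless\<close>
      assume *: "d * h' = - (h' * d)"
      have "tr d = tr (tp h' * (h' * d))" by (simp add: O8_simps[OF h'(1)])
      also have "\<dots> = - tr (tp h' * (d * h'))" unfolding * by simp
      also have "tr (tp h' * (d * h')) = tr d" by (subst tr_commute) (simp add: mult.assoc O8_simps[OF h'(1)])
      finally show False using d(3) by simp
    qed
    ultimately show ?thesis by blast
  qed
  moreover have "conj_standard {X \<in> so8. X * d = d * X \<and> X * h' = h' * X}" if "h' * h' = 1" "d * h' = h' * d"
  proof (rule conj_standard_diagonal[OF dO d(2) _ _ h'(1) that(1) _ _ that(2)])
    show "d \<noteq> 1" "d \<noteq> -1" using d(3) by auto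
    obtain Y where Y: "Y \<in> so8" "Ad h Y \<noteq> Y" using nt by blast
    hence "Ad h' (\<psi> Y) \<noteq> \<psi> Y" using aut_lin(3)[OF \<psi>(1), of "Ad h Y" Y] by (simp flip: \<tau>h)
    thus "h' \<noteq> 1" "h' \<noteq> -1" by (auto simp: Ad_def)
    obtain Z where Z: "Z \<in> so8" "Ad J Z \<noteq> Ad h Z" using nt by blast
    hence "Ad d (\<psi> Z) \<noteq> Ad h' (\<psi> Z)"
      using aut_lin(3)[OF \<psi>(1), of "Ad J Z" "Ad h Z"] by (simp flip: \<tau>h \<sigma>)
    thus "d \<noteq> h'" "d \<noteq> - h'" by (auto simp: Ad_def)
  qed
  moreover have "conj_standard {X \<in> so8. X * d = d * X \<and> X * h' = h' * X}" if "h' * h' = -1" "d * h' = h' * d"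
  proof (rule conj_standard_unitary[OF _ that(1) d(1,2) that(2) d(3)])
    have "tp h' * (h' * h') = h'" using O8_simps(3)[OF h'(1)] .
    thus "tp h' = - h'" unfolding that(1) by (metis minus_equation_iff mult_minus1_right)
  qed
  ultimately have "conj_standard {X \<in> so8. X * d = d * X \<and> X * h' = h' * X}" by blast
  thus ?thesis unfolding k[symmetric] by (rule conj_standard_image[OF \<psi>(1)])
qed

text \<open>If \<open>g\<close> and \<open>h\<close> are both of square 1 but anticommute, then \<open>g h\<close> is a complex structure; it may replace
  \<open>g\<close> because the common fixed points of two commuting involutions are also those of one of them and the product.\<close>

theorem conj_standard_fixed:
  assumes \<sigma>: "aut \<sigma>" and \<tau>: "aut \<tau>"
    and ss: "\<And>X. X \<in> so8 \<Longrightarrow> \<sigma> (\<sigma> X) = X" and tt: "\<And>X. X \<in> so8 \<Longrightarrow> \<tau> (\<tau> X) = X"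
    and st: "\<And>X. X \<in> so8 \<Longrightarrow> \<sigma> (\<tau> X) = \<tau> (\<sigma> X)"
    and nt: "\<exists>X\<in>so8. \<sigma> X \<noteq> X" "\<exists>X\<in>so8. \<tau> X \<noteq> X" "\<exists>X\<in>so8. \<sigma> X \<noteq> \<tau> X"
  shows "conj_standard {X \<in> so8. \<sigma> X = X \<and> \<tau> X = X}"
proof -
  obtain \<psi> g h where \<psi>: "aut \<psi>" and g: "g \<in> O8" and h: "h \<in> O8"
    and \<psi>g: "\<And>X. X \<in> so8 \<Longrightarrow> \<psi> (\<sigma> X) = Ad g (\<psi> X)" and \<psi>h: "\<And>X. X \<in> so8 \<Longrightarrow> \<psi> (\<tau> X) = Ad h (\<psi> X)"
    using commuting_involutions_orthogonal[OF \<sigma> \<tau> ss tt st] by metis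
  have surj: "\<exists>Y\<in>so8. X = \<psi> Y" if "X \<in> so8" for X using aut_lin(4)[OF \<psi> that] .
  have mem: "\<sigma> Y \<in> so8" "\<tau> Y \<in> so8" if "Y \<in> so8" for Y using autD(2) \<sigma> \<tau> that by auto
  have k: "\<psi> ` {X \<in> so8. \<sigma> X = X \<and> \<tau> X = X} = {X \<in> so8. Ad g X = X \<and> Ad h X = X}"
  proof -
    have "\<sigma> Y = Y \<longleftrightarrow> Ad g (\<psi> Y) = \<psi> Y" "\<tau> Y = Y \<longleftrightarrow> Ad h (\<psi> Y) = \<psi> Y" if "Y \<in> so8" for Y
      using aut_lin(3)[OF \<psi>] that mem by (simp_all flip: \<psi>g \<psi>h)
    thus ?thesis by (intro aut_image_Collect[OF \<psi>]) simp
  qed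
  have inv: "Ad g (Ad g X) = X" "Ad h (Ad h X) = X" "Ad g (Ad h X) = Ad h (Ad g X)" if "X \<in> so8" for X
    using surj[OF that] ss tt st mem by (auto simp flip: \<psi>g \<psi>h)
  have ne: "\<exists>X\<in>so8. Ad g X \<noteq> X" "\<exists>X\<in>so8. Ad h X \<noteq> X" "\<exists>X\<in>so8. Ad g X \<noteq> Ad h X"
  proof -
    have "Ad g (\<psi> X) = \<psi> X \<longleftrightarrow> \<sigma> X = X" "Ad h (\<psi> X) = \<psi> X \<longleftrightarrow> \<tau> X = X" "Ad g (\<psi> X) = Ad h (\<psi> X) \<longleftrightarrow> \<sigma> X = \<tau> X"
      if "X \<in> so8" for X using aut_lin(3)[OF \<psi>] that mem by (simp_all flip: \<psi>g \<psi>h)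
    thus "\<exists>X\<in>so8. Ad g X \<noteq> X" "\<exists>X\<in>so8. Ad h X \<noteq> X" "\<exists>X\<in>so8. Ad g X \<noteq> Ad h X"
      using nt autD(2)[OF \<psi>] by metis+
  qed
  have gg: "g * g = 1 \<or> g * g = -1" by (rule Ad_trivial) (auto simp: O8_closed g inv simp flip: Ad_Ad)
  have hh: "h * h = 1 \<or> h * h = -1" by (rule Ad_trivial) (auto simp: O8_closed h inv simp flip: Ad_Ad)
  have gh: "g * h = h * g \<or> g * h = - (h * g)" by (rule Ad_eq) (auto simp: O8_closed g h inv simp flip: Ad_Ad)
  have "conj_standard {X \<in> so8. Ad g X = X \<and> Ad h X = X}"
  proof -
    consider "g * g = -1" | "h * h = -1" | "g * g = 1" "h * h = 1" "g * h = - (h * g)" | "g * g = 1" "h * h = 1" "g * h = h * g"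
      using gg hh gh by blast
    thus ?thesis
    proof cases
      case 1
      show ?thesis by (rule conj_standard_complex[OF g 1 h inv(2,3) ne(2,3)])
    next
      case 2
      have "conj_standard {X \<in> so8. Ad h X = X \<and> Ad g X = X}"
        using ne(3) by (intro conj_standard_complex[OF h 2 g inv(1) inv(3)[symmetric] ne(1)]) (auto simp: eq_commute)
      thus ?thesis by (simp add: conj_commute)
    next
      case 3
      have "g * h * (g * h) = - (g * (g * (h * h)))" unfolding 3(3) by (simp add: mult.assoc) (simp add: 3 flip: mult.assoc)
      hence ghgh: "g * h * (g * h) = -1" using 3 by simp
      have "conj_standard {X \<in> so8. Ad (g * h) X = X \<and> Ad h X = X}"
      proof (rule conj_standard_complex[OF O8_closed(2)[OF g h] ghgh h inv(2)])
        show "Ad (g * h) (Ad h X) = Ad h (Ad (g * h) X)" if "X \<in> so8" for X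
          using that inv by (simp flip: Ad_Ad)
        show "\<exists>X\<in>so8. Ad (g * h) X \<noteq> Ad h X"
        proof -
          obtain X where X: "X \<in> so8" "Ad g X \<noteq> X" using ne(1) by blast
          have "Ad (g * h) (Ad h X) = Ad g X" "Ad h (Ad h X) = X" using X inv by (simp_all flip: Ad_Ad)
          thus ?thesis using X by (intro bexI[of _ "Ad h X"]) auto
        qed
      qed (use ne in auto)
      also have "{X \<in> so8. Ad (g * h) X = X \<and> Ad h X = X} = {X \<in> so8. Ad g X = X \<and> Ad h X = X}"
        unfolding Ad_Ad[symmetric] by (rule Collect_cong) (metis (no_types))
      finally show ?thesis .
    next
      case 4
      have "g \<noteq> 1" "g \<noteq> -1" "h \<noteq> 1" "h \<noteq> -1" "g \<noteq> h" "g \<noteq> - h" using ne by (auto simp: Ad_def)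
      from conj_standard_diagonal[OF g 4(1) this(1,2) h 4(2) this(3,4) 4(3) this(5,6)]
      show ?thesis by (simp add: Ad_fix_iff g h)
    qed
  qed
  thus ?thesis unfolding k[symmetric] by (rule conj_standard_image[OF \<psi>])
qed

section \<open>The standard subalgebras as sets of matrices\<close>

text \<open>Skew-symmetric matrices for \<open>f = uminus\<close> and skew-Hermitian ones for \<open>f = (\<lambda>z. - cnj z)\<close>, so that
  their block sums can be treated together.\<close>

definition symm_mats :: "('a \<Rightarrow> 'a) \<Rightarrow> nat \<Rightarrow> 'a :: zero mat set" where
  "symm_mats f n = {X \<in> carrier_mat n n. \<forall>i<n. \<forall>j<n. X $$ (j, i) = f (X $$ (i, j))}"

lemma so_lie_symm: "so_lie n = symm_mats uminus n"
proof -
  have "transpose_mat X = - X \<longleftrightarrow> (\<forall>i<n. \<forall>j<n. X $$ (j, i) = - X $$ (i, j))"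
    if "X \<in> carrier_mat n n" for X :: "real mat"
  proof
    assume *: "transpose_mat X = - X"
    show "\<forall>i<n. \<forall>j<n. X $$ (j, i) = - X $$ (i, j)"
    proof (intro allI impI)
      fix i j assume "i < n" "j < n"
      thus "X $$ (j, i) = - X $$ (i, j)" using arg_cong[OF *, of "\<lambda>Z. Z $$ (i, j)"] that by auto
    qed
  next
    assume *: "\<forall>i<n. \<forall>j<n. X $$ (j, i) = - X $$ (i, j)"
    show "transpose_mat X = - X"
    proof (rule eq_matI)
      fix i j assume "i < dim_row (- X)" "j < dim_col (- X)"
      hence ij: "i < n" "j < n" using that by auto
      have "X $$ (j, i) = - X $$ (i, j)" using * ij by blast
      thus "transpose_mat X $$ (i, j) = (- X) $$ (i, j)" using that ij by simp
    qed (use that in auto)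
  qed
  thus ?thesis unfolding so_lie_def symm_mats_def by (intro Collect_cong conj_cong refl)
qed

lemma mat_adjoint_index:
  "Z \<in> carrier_mat n n \<Longrightarrow> i < n \<Longrightarrow> j < n \<Longrightarrow> mat_adjoint Z $$ (i, j) = conjugate (Z $$ (j, i))"
  by (auto simp: mat_adjoint_def mat_of_rows_def)

lemma mat_adjoint_carrier: "Z \<in> carrier_mat n n \<Longrightarrow> mat_adjoint Z \<in> carrier_mat n n"
  by (auto simp: mat_adjoint_def mat_of_rows_def)

lemma u_lie_symm: "u_lie n = symm_mats (\<lambda>z. - cnj z) n"
proof -
  have "mat_adjoint Z = - Z \<longleftrightarrow> (\<forall>i<n. \<forall>j<n. Z $$ (j, i) = - cnj (Z $$ (i, j)))"
    if Z: "Z \<in> carrier_mat n n" for Z :: "complex mat"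
  proof
    assume *: "mat_adjoint Z = - Z"
    show "\<forall>i<n. \<forall>j<n. Z $$ (j, i) = - cnj (Z $$ (i, j))"
    proof (intro allI impI)
      fix i j assume ij: "i < n" "j < n"
      have "cnj (Z $$ (i, j)) = mat_adjoint Z $$ (j, i)" using mat_adjoint_index[OF Z ij(2,1)] by simp
      thus "Z $$ (j, i) = - cnj (Z $$ (i, j))" using Z ij * by simp
    qed
  next
    assume *: "\<forall>i<n. \<forall>j<n. Z $$ (j, i) = - cnj (Z $$ (i, j))"
    show "mat_adjoint Z = - Z"
    proof (rule eq_matI)
      fix i j assume "i < dim_row (- Z)" "j < dim_col (- Z)"
      hence ij: "i < n" "j < n" using Z by auto
      have "Z $$ (i, j) = - cnj (Z $$ (j, i))" using * ij by blast
      thus "mat_adjoint Z $$ (i, j) = (- Z) $$ (i, j)" using mat_adjoint_index[OF Z ij] Z ij by simp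
    qed (use Z mat_adjoint_carrier[OF Z] in auto)
  qed
  thus ?thesis unfolding u_lie_def symm_mats_def by (intro Collect_cong conj_cong refl)
qed

lemma block_sum_Nil: "block_sum [] = {0\<^sub>m 0 0}"
  by (auto simp: block_sum_def)

lemma block_sum_Cons:
  "block_sum (S # Ss) = {four_block_mat A (0\<^sub>m (dim_row A) (dim_col B)) (0\<^sub>m (dim_row B) (dim_col A)) B |A B.
     A \<in> S \<and> B \<in> block_sum Ss}"
  by (auto simp: block_sum_def Let_def list_all2_Cons2) (metis diag_block_mat.simps(2) list_all2_Cons)+

lemma block_sum_symm_mats:
  fixes f :: "'a :: zero \<Rightarrow> 'a"
  assumes f0: "f 0 = 0"
  shows "block_sum (map (symm_mats f) ns) =
    {X \<in> symm_mats f (sum_list ns). \<forall>i<sum_list ns. \<forall>j<sum_list ns. block_index ns i \<noteq> block_index ns j \<longrightarrow> X $$ (i, j) = 0}"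
proof (induction ns)
  case Nil
  show ?case by (auto simp: block_sum_Nil symm_mats_def)
next
  case (Cons n ns)
  define m where "m = sum_list ns"
  show ?case
  proof (intro equalityI subsetI)
    fix X assume "X \<in> block_sum (map (symm_mats f) (n # ns))"
    then obtain A B where X: "X = four_block_mat A (0\<^sub>m (dim_row A) (dim_col B)) (0\<^sub>m (dim_row B) (dim_col A)) B"
      and A: "A \<in> symm_mats f n" and B: "B \<in> symm_mats f m" "\<forall>i<m. \<forall>j<m. block_index ns i \<noteq> block_index ns j \<longrightarrow> B $$ (i, j) = 0"
      unfolding list.map block_sum_Cons mem_Collect_eq Cons.IH m_def by blast
    have c: "A \<in> carrier_mat n n" "B \<in> carrier_mat m m" using A B(1) unfolding symm_mats_def by blast+
    have ent: "X $$ (i, j) = (if i < n then if j < n then A $$ (i, j) else 0 else if j < n then 0 else B $$ (i - n, j - n))"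
      if "i < n + m" "j < n + m" for i j using that c by (auto simp: X)
    have "X $$ (j, i) = f (X $$ (i, j))" if "i < n + m" "j < n + m" for i j
    proof -
      have "A $$ (j, i) = f (A $$ (i, j))" if "i < n" "j < n" using A that unfolding symm_mats_def by blast
      moreover have "B $$ (j - n, i - n) = f (B $$ (i - n, j - n))" if "i - n < m" "j - n < m"
        using B(1) that unfolding symm_mats_def by blast
      ultimately show ?thesis using that f0 by (simp add: ent)
    qed
    moreover have "X \<in> carrier_mat (n + m) (n + m)" using c by (simp add: X)
    ultimately have "X \<in> symm_mats f (n + m)" unfolding symm_mats_def by blast
    moreover have "X $$ (i, j) = 0" if "i < n + m" "j < n + m" "block_index (n # ns) i \<noteq> block_index (n # ns) j" for i j
      using that B(2)[rule_format, of "i - n" "j - n"] by (auto simp: ent split: if_splits)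
    ultimately show "X \<in> {X \<in> symm_mats f (sum_list (n # ns)). \<forall>i<sum_list (n # ns). \<forall>j<sum_list (n # ns).
        block_index (n # ns) i \<noteq> block_index (n # ns) j \<longrightarrow> X $$ (i, j) = 0}" by (simp add: m_def)
  next
    fix X assume "X \<in> {X \<in> symm_mats f (sum_list (n # ns)). \<forall>i<sum_list (n # ns). \<forall>j<sum_list (n # ns).
        block_index (n # ns) i \<noteq> block_index (n # ns) j \<longrightarrow> X $$ (i, j) = 0}"
    hence X: "X \<in> carrier_mat (n + m) (n + m)" "\<And>i j. i < n + m \<Longrightarrow> j < n + m \<Longrightarrow> X $$ (j, i) = f (X $$ (i, j))"
      "\<And>i j. i < n + m \<Longrightarrow> j < n + m \<Longrightarrow> block_index (n # ns) i \<noteq> block_index (n # ns) j \<Longrightarrow> X $$ (i, j) = 0"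
      unfolding symm_mats_def m_def sum_list.Cons by blast+
    define A where "A = mat n n (\<lambda>(i, j). X $$ (i, j))"
    define B where "B = mat m m (\<lambda>(i, j). X $$ (i + n, j + n))"
    have "A \<in> symm_mats f n"
      unfolding symm_mats_def
    proof (intro CollectI conjI allI impI)
      fix i j assume "i < n" "j < n"
      thus "A $$ (j, i) = f (A $$ (i, j))" using X(2)[of i j] by (simp add: A_def)
    qed (simp add: A_def)
    moreover have "B \<in> symm_mats f m"
      unfolding symm_mats_def
    proof (intro CollectI conjI allI impI)
      fix i j assume "i < m" "j < m"
      thus "B $$ (j, i) = f (B $$ (i, j))" using X(2)[of "i + n" "j + n"] by (simp add: B_def)
    qed (simp add: B_def)
    moreover have "B $$ (i, j) = 0" if "i < m" "j < m" "block_index ns i \<noteq> block_index ns j" for i j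
      using X(3)[of "i + n" "j + n"] that by (simp add: B_def)
    ultimately have AB: "A \<in> symm_mats f n" "B \<in> block_sum (map (symm_mats f) ns)" unfolding Cons.IH m_def by blast+
    have "X = four_block_mat A (0\<^sub>m (dim_row A) (dim_col B)) (0\<^sub>m (dim_row B) (dim_col A)) B"
    proof (rule eq_matI)
      fix i j assume "i < dim_row (four_block_mat A (0\<^sub>m (dim_row A) (dim_col B)) (0\<^sub>m (dim_row B) (dim_col A)) B)"
        "j < dim_col (four_block_mat A (0\<^sub>m (dim_row A) (dim_col B)) (0\<^sub>m (dim_row B) (dim_col A)) B)"
      hence ij: "i < n + m" "j < n + m" by (auto simp: A_def B_def)
      thus "X $$ (i, j) = four_block_mat A (0\<^sub>m (dim_row A) (dim_col B)) (0\<^sub>m (dim_row B) (dim_col A)) B $$ (i, j)"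
        using X(3)[OF ij] by (auto simp: A_def B_def)
    qed (use X(1) in \<open>auto simp: A_def B_def\<close>)
    thus "X \<in> block_sum (map (symm_mats f) (n # ns))" using AB by (auto simp: block_sum_Cons)
  qed
qed

lemma so_lie_8: "so_lie 8 = Rep_mat8 ` so8"
proof (intro equalityI subsetI)
  fix M assume M: "M \<in> so_lie 8"
  hence c: "M \<in> carrier_mat 8 8" "transpose_mat M = - M" by (auto simp: so_lie_def)
  have "tp (Abs_mat8 M) = - Abs_mat8 M"
    using c by (simp add: Rep_mat8_inject[symmetric] tp.rep_eq uminus_mat8.rep_eq Abs_mat8_inverse)
  thus "M \<in> Rep_mat8 ` so8" using c by (intro image_eqI[of _ _ "Abs_mat8 M"]) (simp_all add: Abs_mat8_inverse so8_iff)
next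
  fix M assume "M \<in> Rep_mat8 ` so8"
  then obtain X where "M = Rep_mat8 X" "tp X = - X" by (auto simp: so8_iff)
  thus "M \<in> so_lie 8" using Rep_mat8[of X]
    by (simp add: so_lie_def flip: tp.rep_eq uminus_mat8.rep_eq)
qed

lemma Rep_so_blocks:
  assumes "sum_list ns = 8"
  shows "Rep_mat8 ` so_blocks ns = block_sum (map so_lie ns)"
proof -
  have "block_sum (map so_lie ns) = {X \<in> so_lie 8. \<forall>i<8. \<forall>j<8. block_index ns i \<noteq> block_index ns j \<longrightarrow> X $$ (i, j) = 0}"
    using block_sum_symm_mats[of "uminus :: real \<Rightarrow> real" ns] assms by (simp add: so_lie_symm[abs_def])
  also have "\<dots> = Rep_mat8 ` so_blocks ns"
    unfolding so_lie_8 so_blocks_def by (auto simp: ent.rep_eq)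
  finally show ?thesis ..
qed

lemma ent_J_std: "i < 8 \<Longrightarrow> j < 8 \<Longrightarrow> ent J_std i j = (if i = j + 4 then 1 else 0) - (if j = i + 4 then 1 else 0)"
proof -
  assume ij: "i < 8" "j < 8"
  have "ent J_std i j = (\<Sum>k<4. if k = j then (if i = j + 4 then 1 else 0) else 0) - (\<Sum>k<4. if k = i then (if j = i + 4 then 1 else 0) else 0)"
    unfolding J_std_def sum_subtractf[symmetric] using ij
    by (subst ent_sum) (auto intro!: sum.cong)
  thus ?thesis using ij by auto
qed

lemma ent_J_std_mult:
  assumes "i < 8" "j < 8"
  shows "ent (J_std * X) i j = (if i < 4 then - ent X (i + 4) j else ent X (i - 4) j)"
    "ent (X * J_std) i j = (if j < 4 then ent X i (j + 4) else - ent X i (j - 4))"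
proof -
  have "ent (J_std * X) i j = (\<Sum>k<8. ent J_std i k * ent X k j)" by (rule ent_mult[OF assms])
  also have "\<dots> = (\<Sum>k<8. if k = (if i < 4 then i + 4 else i - 4) then
      (if i < 4 then - ent X (i + 4) j else ent X (i - 4) j) else 0)"
    using assms by (intro sum.cong refl) (auto simp: ent_J_std)
  also have "\<dots> = (if i < 4 then - ent X (i + 4) j else ent X (i - 4) j)" using assms by auto
  finally show "ent (J_std * X) i j = (if i < 4 then - ent X (i + 4) j else ent X (i - 4) j)" .
  have "ent (X * J_std) i j = (\<Sum>k<8. ent X i k * ent J_std k j)" by (rule ent_mult[OF assms])
  also have "\<dots> = (\<Sum>k<8. if k = (if j < 4 then j + 4 else j - 4) then
      (if j < 4 then ent X i (j + 4) else - ent X i (j - 4)) else 0)"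
    using assms by (intro sum.cong refl) (auto simp: ent_J_std)
  also have "\<dots> = (if j < 4 then ent X i (j + 4) else - ent X i (j - 4))" using assms by auto
  finally show "ent (X * J_std) i j = (if j < 4 then ent X i (j + 4) else - ent X i (j - 4))" .
qed

text \<open>Commuting with the complex structure relates the four quadrants as in \<open>realify\<close>; commuting with the reflection
  separates the indices 3 and 7, the fourth complex coordinate, from the others.\<close>

lemma u3_u1_iff:
  "X \<in> u3_u1 \<longleftrightarrow> X \<in> so8 \<and> (\<forall>i<4. \<forall>j<4. ent X (i + 4) (j + 4) = ent X i j \<and> ent X i (j + 4) = - ent X (i + 4) j \<and>
     ((i = 3) \<noteq> (j = 3) \<longrightarrow> ent X i j = 0 \<and> ent X (i + 4) j = 0))"
proof -
  have J: "X * J_std = J_std * X \<longleftrightarrow> (\<forall>i<4. \<forall>j<4. ent X (i + 4) (j + 4) = ent X i j \<and> ent X i (j + 4) = - ent X (i + 4) j)"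
  proof
    assume *: "X * J_std = J_std * X"
    show "\<forall>i<4. \<forall>j<4. ent X (i + 4) (j + 4) = ent X i j \<and> ent X i (j + 4) = - ent X (i + 4) j"
    proof (intro allI impI conjI)
      fix i j :: nat assume ij: "i < 4" "j < 4"
      have "ent (X * J_std) (i + 4) j = ent (J_std * X) (i + 4) j" "ent (X * J_std) i j = ent (J_std * X) i j" using * by auto
      thus "ent X (i + 4) (j + 4) = ent X i j" "ent X i (j + 4) = - ent X (i + 4) j"
        using ij by (auto simp: ent_J_std_mult)
    qed
  next
    assume *: "\<forall>i<4. \<forall>j<4. ent X (i + 4) (j + 4) = ent X i j \<and> ent X i (j + 4) = - ent X (i + 4) j"
    show "X * J_std = J_std * X"
    proof (rule mat8_eqI)
      fix i j :: nat assume ij: "i < 8" "j < 8"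
      consider "i < 4" "j < 4" | "i < 4" "\<not> j < 4" | "\<not> i < 4" "j < 4" | "\<not> i < 4" "\<not> j < 4" by blast
      thus "ent (X * J_std) i j = ent (J_std * X) i j"
      proof cases
        case 1 thus ?thesis using * by (simp add: ent_J_std_mult)
      next
        case 2 thus ?thesis using *[rule_format, of i "j - 4"] ij by (simp add: ent_J_std_mult)
      next
        case 3 thus ?thesis using *[rule_format, of "i - 4" j] ij by (simp add: ent_J_std_mult)
      next
        case 4 thus ?thesis using *[rule_format, of "i - 4" "j - 4"] ij by (simp add: ent_J_std_mult)
      qed
    qed
  qed
  have D: "X * D_std = D_std * X \<longleftrightarrow> (\<forall>i<8. \<forall>j<8. (i = 3 \<or> i = 7) \<noteq> (j = 3 \<or> j = 7) \<longrightarrow> ent X i j = 0)"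
  proof
    assume *: "X * D_std = D_std * X"
    show "\<forall>i<8. \<forall>j<8. (i = 3 \<or> i = 7) \<noteq> (j = 3 \<or> j = 7) \<longrightarrow> ent X i j = 0"
    proof (intro allI impI)
      fix i j :: nat assume "i < 8" "j < 8" "(i = 3 \<or> i = 7) \<noteq> (j = 3 \<or> j = 7)"
      thus "ent X i j = 0" using arg_cong[OF *, of "\<lambda>Z. ent Z i j"] by (auto simp: D_std_def ent_diag8)
    qed
  next
    assume *: "\<forall>i<8. \<forall>j<8. (i = 3 \<or> i = 7) \<noteq> (j = 3 \<or> j = 7) \<longrightarrow> ent X i j = 0"
    show "X * D_std = D_std * X"
    proof (rule mat8_eqI)
      fix i j :: nat assume ij: "i < 8" "j < 8"
      thus "ent (X * D_std) i j = ent (D_std * X) i j"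
        using *[rule_format, OF ij] by (auto simp: D_std_def ent_diag8)
    qed
  qed
  show ?thesis
  proof
    assume X: "X \<in> u3_u1"
    hence *: "\<forall>i<8. \<forall>j<8. (i = 3 \<or> i = 7) \<noteq> (j = 3 \<or> j = 7) \<longrightarrow> ent X i j = 0" using D by (simp add: u3_u1_def)
    have "ent X i j = 0 \<and> ent X (i + 4) j = 0" if "i < 4" "j < 4" "(i = 3) \<noteq> (j = 3)" for i j
      using *[rule_format, of i j] *[rule_format, of "i + 4" j] that by auto
    thus "X \<in> so8 \<and> (\<forall>i<4. \<forall>j<4. ent X (i + 4) (j + 4) = ent X i j \<and> ent X i (j + 4) = - ent X (i + 4) j \<and>
     ((i = 3) \<noteq> (j = 3) \<longrightarrow> ent X i j = 0 \<and> ent X (i + 4) j = 0))" using X J by (simp add: u3_u1_def)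
  next
    assume R: "X \<in> so8 \<and> (\<forall>i<4. \<forall>j<4. ent X (i + 4) (j + 4) = ent X i j \<and> ent X i (j + 4) = - ent X (i + 4) j \<and>
     ((i = 3) \<noteq> (j = 3) \<longrightarrow> ent X i j = 0 \<and> ent X (i + 4) j = 0))"
    have "ent X i j = 0" if ij: "i < 8" "j < 8" "(i = 3 \<or> i = 7) \<noteq> (j = 3 \<or> j = 7)" for i j
    proof -
      define i' j' where "i' = (if i < 4 then i else i - 4)" and "j' = (if j < 4 then j else j - 4)"
      have i'j': "i' < 4" "j' < 4" "(i' = 3) \<noteq> (j' = 3)" "i = i' \<or> i = i' + 4" "j = j' \<or> j = j' + 4"
        using ij by (auto simp: i'_def j'_def)
      have "ent X i' j' = 0" "ent X (i' + 4) j' = 0" "ent X i' (j' + 4) = 0" "ent X (i' + 4) (j' + 4) = 0"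
        using conjunct2[OF R, rule_format, OF i'j'(1,2)] i'j'(3) by simp_all
      thus ?thesis using i'j'(4,5) by auto
    qed
    thus "X \<in> u3_u1" using R J D by (simp add: u3_u1_def)
  qed
qed

lemma realify_index:
  assumes "Z \<in> carrier_mat 4 4" "i < 4" "j < 4"
  shows "realify Z $$ (i, j) = Re (Z $$ (i, j))" "realify Z $$ (i + 4, j) = Im (Z $$ (i, j))"
    "realify Z $$ (i, j + 4) = - Im (Z $$ (i, j))" "realify Z $$ (i + 4, j + 4) = Re (Z $$ (i, j))"
  using assms by (auto simp: realify_def)

lemma realify_carrier: "Z \<in> carrier_mat 4 4 \<Longrightarrow> realify Z \<in> carrier_mat 8 8"
  by (auto simp: realify_def)

lemma Rep_u3_u1: "Rep_mat8 ` u3_u1 = realify ` block_sum [u_lie 3, u_lie 1]"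
proof -
  have b: "block_index [3, 1] i \<noteq> block_index [3, 1] j \<longleftrightarrow> (i = 3) \<noteq> (j = 3)" if "i < 4" "j < 4" for i j using that by auto
  have U: "block_sum [u_lie 3, u_lie 1] = {Z \<in> carrier_mat 4 4. \<forall>i<4. \<forall>j<4. Z $$ (j, i) = - cnj (Z $$ (i, j)) \<and>
      ((i = 3) \<noteq> (j = 3) \<longrightarrow> Z $$ (i, j) = 0)}"
  proof -
    have "block_sum [u_lie 3, u_lie 1] = {X \<in> symm_mats (\<lambda>z. - cnj z) 4. \<forall>i<4. \<forall>j<4. block_index [3, 1] i \<noteq> block_index [3, 1] j \<longrightarrow> X $$ (i, j) = 0}"
      using block_sum_symm_mats[of "\<lambda>z. - cnj z" "[3, 1]"] by (simp add: u_lie_symm[abs_def] del: block_index.simps)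
    moreover have "(\<forall>i<4. \<forall>j<4. block_index [3, 1] i \<noteq> block_index [3, 1] j \<longrightarrow> Z $$ (i, j) = 0) \<longleftrightarrow>
        (\<forall>i<4. \<forall>j<4. (i = 3) \<noteq> (j = 3) \<longrightarrow> Z $$ (i, j) = 0)" for Z :: "complex mat"
      by (intro iff_allI imp_cong refl b)
    ultimately have eq: "block_sum [u_lie 3, u_lie 1] = {Z \<in> symm_mats (\<lambda>z. - cnj z) 4.
        \<forall>i<4. \<forall>j<4. (i = 3) \<noteq> (j = 3) \<longrightarrow> Z $$ (i, j) = 0}" by (simp only:)
    show ?thesis unfolding eq symm_mats_def mem_Collect_eq by (rule Collect_cong) blast
  qed
  have half: "\<exists>i'<4. i = i' \<or> i = i' + 4" if "i < 8" for i :: nat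
    using that by (intro exI[of _ "if i < 4 then i else i - 4"]) auto
  show ?thesis
  proof (intro equalityI subsetI)
    fix M assume "M \<in> Rep_mat8 ` u3_u1"
    then obtain X where M: "M = Rep_mat8 X" and X: "X \<in> u3_u1" by blast
    have e: "M $$ (i, j) = ent X i j" for i j by (simp add: M ent.rep_eq)
    have c: "M \<in> carrier_mat 8 8" using Rep_mat8 by (simp add: M)
    define Z where "Z = mat 4 4 (\<lambda>(i, j). Complex (ent X i j) (ent X (i + 4) j))"
    have Zc: "Z \<in> carrier_mat 4 4" by (simp add: Z_def)
    have so: "X \<in> so8" using X by (simp add: u3_u1_iff)
    have r: "ent X (i + 4) (j + 4) = ent X i j" "ent X i (j + 4) = - ent X (i + 4) j" if "i < 4" "j < 4" for i j
      using X that by (auto simp: u3_u1_iff)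
    have "M = realify Z"
    proof (rule eq_matI)
      fix i j assume "i < dim_row (realify Z)" "j < dim_col (realify Z)"
      hence ij: "i < 8" "j < 8" using realify_carrier[OF Zc] by auto
      then obtain i' j' where "i' < 4" "j' < 4" "i = i' \<or> i = i' + 4" "j = j' \<or> j = j' + 4" using half by metis
      thus "M $$ (i, j) = realify Z $$ (i, j)"
        using realify_index[OF Zc, of i' j'] r[of i' j'] by (auto simp: e Z_def)
    qed (use c realify_carrier[OF Zc] in auto)
    moreover have "Z \<in> block_sum [u_lie 3, u_lie 1]"
      unfolding U
    proof (intro CollectI conjI allI impI)
      fix i j :: nat assume ij: "i < 4" "j < 4"
      have "ent X j i = - ent X i j" "ent X i (j + 4) = - ent X (j + 4) i"
        using so8_ent[OF so, of i j] so8_ent[OF so, of "j + 4" i] ij by auto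
      thus "Z $$ (j, i) = - cnj (Z $$ (i, j))" using ij r(2)[OF ij] by (simp add: Z_def complex_eq_iff)
      assume "(i = 3) \<noteq> (j = 3)"
      thus "Z $$ (i, j) = 0" using X ij by (simp add: Z_def u3_u1_iff complex_eq_iff)
    qed (rule Zc)
    ultimately show "M \<in> realify ` block_sum [u_lie 3, u_lie 1]" by blast
  next
    fix M assume "M \<in> realify ` block_sum [u_lie 3, u_lie 1]"
    then obtain Z where M: "M = realify Z" and Zc: "Z \<in> carrier_mat 4 4"
      and Z: "\<And>i j. i < 4 \<Longrightarrow> j < 4 \<Longrightarrow> Z $$ (j, i) = - cnj (Z $$ (i, j))"
      "\<And>i j. i < 4 \<Longrightarrow> j < 4 \<Longrightarrow> (i = 3) \<noteq> (j = 3) \<Longrightarrow> Z $$ (i, j) = 0" unfolding U by blast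
    define X where "X = Abs_mat8 M"
    have RX: "Rep_mat8 X = M" using realify_carrier[OF Zc] by (simp add: X_def M Abs_mat8_inverse)
    have e: "ent X i j = M $$ (i, j)" for i j by (simp add: ent.rep_eq RX)
    note ri = realify_index[OF Zc]
    have "tp X = - X"
    proof (rule mat8_eqI)
      fix i j :: nat assume ij: "i < 8" "j < 8"
      then obtain i' j' where i'j': "i' < 4" "j' < 4" "i = i' \<or> i = i' + 4" "j = j' \<or> j = j' + 4" using half by metis
      have "Re (Z $$ (j', i')) = - Re (Z $$ (i', j'))" "Im (Z $$ (j', i')) = Im (Z $$ (i', j'))"
        using Z(1)[OF i'j'(1,2)] by auto
      thus "ent (tp X) i j = ent (- X) i j" using ij i'j' ri[of i' j'] ri[of j' i'] by (auto simp: e M)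
    qed
    hence "X \<in> u3_u1" using Z(2) by (simp add: u3_u1_iff so8_iff e M ri)
    thus "M \<in> Rep_mat8 ` u3_u1" using RX by blast
  qed
qed

lemma Rep_br: "lie_bracket (Rep_mat8 X) (Rep_mat8 Y) = Rep_mat8 (br X Y)"
  by (simp add: lie_bracket_def br_def minus_mat8.rep_eq times_mat8.rep_eq)

lemma aut_of_lie_automorphism:
  assumes "lie_automorphism (so_lie 8) \<sigma>"
  defines "\<sigma>' \<equiv> \<lambda>X. Abs_mat8 (\<sigma> (Rep_mat8 X))"
  shows "aut \<sigma>'" "X \<in> so8 \<Longrightarrow> Rep_mat8 (\<sigma>' X) = \<sigma> (Rep_mat8 X)"
proof -
  have b: "bij_betw \<sigma> (so_lie 8) (so_lie 8)"
    and add: "\<And>X Y. X \<in> so_lie 8 \<Longrightarrow> Y \<in> so_lie 8 \<Longrightarrow> \<sigma> (X + Y) = \<sigma> X + \<sigma> Y"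
    and sc: "\<And>c X. X \<in> so_lie 8 \<Longrightarrow> \<sigma> (c \<cdot>\<^sub>m X) = c \<cdot>\<^sub>m \<sigma> X"
    and br: "\<And>X Y. X \<in> so_lie 8 \<Longrightarrow> Y \<in> so_lie 8 \<Longrightarrow> \<sigma> (lie_bracket X Y) = lie_bracket (\<sigma> X) (\<sigma> Y)"
    using assms(1) by (auto simp: lie_automorphism_def)
  have Rb: "bij_betw Rep_mat8 so8 (so_lie 8)"
    unfolding so_lie_8 by (rule inj_on_imp_bij_betw) (auto simp: inj_on_def Rep_mat8_inject)
  have mem: "\<sigma> (Rep_mat8 X) \<in> Rep_mat8 ` so8" if "X \<in> so8" for X
    using b that unfolding so_lie_8 by (auto simp: bij_betw_def)
  have R: "Rep_mat8 (\<sigma>' X) = \<sigma> (Rep_mat8 X)" if "X \<in> so8" for X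
    using mem[OF that] Rep_mat8 by (auto simp: \<sigma>'_def Abs_mat8_inverse)
  thus "X \<in> so8 \<Longrightarrow> Rep_mat8 (\<sigma>' X) = \<sigma> (Rep_mat8 X)" .
  have "bij_betw (Rep_mat8 \<circ> \<sigma>') so8 (so_lie 8)"
    using bij_betw_trans[OF Rb b] R by (subst bij_betw_cong[of _ _ "\<sigma> \<circ> Rep_mat8"]) auto
  hence bb: "bij_betw \<sigma>' so8 so8"
  proof -
    assume *: "bij_betw (Rep_mat8 \<circ> \<sigma>') so8 (so_lie 8)"
    have "Rep_mat8 ` \<sigma>' ` so8 = Rep_mat8 ` so8" using * by (simp add: bij_betw_def image_comp so_lie_8)
    hence "\<sigma>' ` so8 = so8" by (subst (asm) inj_image_eq_iff) (auto simp: inj_def Rep_mat8_inject)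
    moreover have "inj_on \<sigma>' so8" using * by (auto simp: bij_betw_def intro: inj_on_imageI2)
    ultimately show ?thesis by (simp add: bij_betw_def)
  qed
  have m: "Rep_mat8 X \<in> so_lie 8" if "X \<in> so8" for X using that by (simp add: so_lie_8)
  show "aut \<sigma>'"
    unfolding aut_def
  proof (intro conjI ballI allI bb)
    fix X Y c assume X: "X \<in> so8"
    show "\<sigma>' (c *\<^sub>R X) = c *\<^sub>R \<sigma>' X"
      by (subst Rep_mat8_inject[symmetric]) (simp add: R X scaleR_mat8.rep_eq sc m)
    assume Y: "Y \<in> so8"
    show "\<sigma>' (X + Y) = \<sigma>' X + \<sigma>' Y"
      by (subst Rep_mat8_inject[symmetric]) (simp add: R X Y plus_mat8.rep_eq add m)
    show "\<sigma>' (br X Y) = br (\<sigma>' X) (\<sigma>' Y)"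
      by (subst Rep_mat8_inject[symmetric]) (simp add: R X Y Rep_br[symmetric] br m)
  qed
qed

lemma lie_automorphism_of_aut:
  assumes \<phi>: "aut \<phi>"
  shows "lie_automorphism (so_lie 8) (\<lambda>M. Rep_mat8 (\<phi> (Abs_mat8 M)))"
proof -
  have Rb: "bij_betw Rep_mat8 so8 (so_lie 8)"
    unfolding so_lie_8 by (rule inj_on_imp_bij_betw) (auto simp: inj_on_def Rep_mat8_inject)
  have Ab: "bij_betw Abs_mat8 (so_lie 8) so8"
    unfolding so_lie_8 by (rule bij_betwI[of _ _ _ Rep_mat8]) (auto simp: Rep_mat8_inverse)
  have "bij_betw (Rep_mat8 \<circ> (\<phi> \<circ> Abs_mat8)) (so_lie 8) (so_lie 8)"
    by (rule bij_betw_trans[OF bij_betw_trans[OF Ab autD(1)[OF \<phi>]] Rb])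
  hence b: "bij_betw (\<lambda>M. Rep_mat8 (\<phi> (Abs_mat8 M))) (so_lie 8) (so_lie 8)" by (simp add: comp_def)
  have A: "Abs_mat8 (Rep_mat8 X + Rep_mat8 Y) = X + Y" "Abs_mat8 (c \<cdot>\<^sub>m Rep_mat8 X) = c *\<^sub>R X" for X Y c
    by (simp_all add: Rep_mat8_inverse flip: plus_mat8.rep_eq scaleR_mat8.rep_eq)
  show ?thesis
    unfolding lie_automorphism_def
    by (intro conjI b) (auto simp: so_lie_8 A Rep_br Rep_mat8_inverse autD[OF \<phi>] plus_mat8.rep_eq scaleR_mat8.rep_eq)
qed

text \<open>Transport of \<open>conj_standard_fixed\<close> along the identification of \<open>so8\<close> with \<open>so_lie 8\<close>.\<close>

theorem theorem1p3:
  fixes k :: "real mat set" and \<sigma> \<tau> :: "real mat \<Rightarrow> real mat"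
  assumes "lie_subalgebra k (so_lie 8)"
    and "lie_involution (so_lie 8) \<sigma>"
    and "lie_involution (so_lie 8) \<tau>"
    and "\<forall>X\<in>so_lie 8. \<sigma> (\<tau> X) = \<tau> (\<sigma> X)"
    and "\<exists>X\<in>so_lie 8. \<sigma> X \<noteq> \<tau> X"
    and "k = fixed_subalgebra (so_lie 8) \<sigma> \<inter> fixed_subalgebra (so_lie 8) \<tau>"
  shows "\<exists>\<phi>. lie_automorphism (so_lie 8) \<phi> \<and>
    ((\<exists>n1 n2 n3. n1 \<ge> 1 \<and> n2 \<ge> 1 \<and> n3 \<ge> 1 \<and> n1 + n2 + n3 = 8 \<and>
        \<phi> ` k = block_sum [so_lie n1, so_lie n2, so_lie n3]) \<or>
     (\<exists>n1 n2 n3 n4. n1 \<ge> 1 \<and> n2 \<ge> 1 \<and> n3 \<ge> 1 \<and> n4 \<ge> 1 \<and> n1 + n2 + n3 + n4 = 8 \<and>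
        \<phi> ` k = block_sum [so_lie n1, so_lie n2, so_lie n3, so_lie n4]) \<or>
     \<phi> ` k = realify ` block_sum [u_lie 3, u_lie 1])"
proof -
  define s where "s X = Abs_mat8 (\<sigma> (Rep_mat8 X))" for X
  define t where "t X = Abs_mat8 (\<tau> (Rep_mat8 X))" for X
  have la: "lie_automorphism (so_lie 8) \<sigma>" "lie_automorphism (so_lie 8) \<tau>"
    using assms(2,3) by (auto simp: lie_involution_def)
  note s = aut_of_lie_automorphism[OF la(1), folded s_def] and t = aut_of_lie_automorphism[OF la(2), folded t_def]
  have m: "Rep_mat8 X \<in> so_lie 8" if "X \<in> so8" for X using that by (simp add: so_lie_8)
  have mem: "s X \<in> so8" "t X \<in> so8" if "X \<in> so8" for X using autD(2) s(1) t(1) that by auto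
  have "conj_standard {X \<in> so8. s X = X \<and> t X = X}"
  proof (rule conj_standard_fixed[OF s(1) t(1)])
    fix X assume X: "X \<in> so8"
    show "s (s X) = X" using assms(2) X m
      by (subst Rep_mat8_inject[symmetric]) (simp add: s(2) mem lie_involution_def)
    show "t (t X) = X" using assms(3) X m
      by (subst Rep_mat8_inject[symmetric]) (simp add: t(2) mem lie_involution_def)
    show "s (t X) = t (s X)" using assms(4) X m
      by (subst Rep_mat8_inject[symmetric]) (simp add: s(2) t(2) mem)
  next
    have "\<exists>X\<in>so8. Rep_mat8 (s X) \<noteq> Rep_mat8 X" using assms(2) s(2) by (auto simp: lie_involution_def so_lie_8)
    thus "\<exists>X\<in>so8. s X \<noteq> X" by metis
    have "\<exists>X\<in>so8. Rep_mat8 (t X) \<noteq> Rep_mat8 X" using assms(3) t(2) by (auto simp: lie_involution_def so_lie_8)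
    thus "\<exists>X\<in>so8. t X \<noteq> X" by metis
    have "\<exists>X\<in>so8. Rep_mat8 (s X) \<noteq> Rep_mat8 (t X)" using assms(5) s(2) t(2) by (auto simp: so_lie_8)
    thus "\<exists>X\<in>so8. s X \<noteq> t X" by metis
  qed
  then obtain \<phi> where \<phi>: "aut \<phi>" and cases: "(\<exists>ns. (length ns = 3 \<or> length ns = 4) \<and> sum_list ns = 8 \<and>
      (\<forall>n\<in>set ns. n \<ge> 1) \<and> \<phi> ` {X \<in> so8. s X = X \<and> t X = X} = so_blocks ns) \<or> \<phi> ` {X \<in> so8. s X = X \<and> t X = X} = u3_u1"
    unfolding conj_standard_def by blast
  have "Rep_mat8 (s X) = Rep_mat8 X \<longleftrightarrow> \<sigma> (Rep_mat8 X) = Rep_mat8 X" "Rep_mat8 (t X) = Rep_mat8 X \<longleftrightarrow> \<tau> (Rep_mat8 X) = Rep_mat8 X"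
    if "X \<in> so8" for X using s(2) t(2) that by auto
  hence k: "k = Rep_mat8 ` {X \<in> so8. s X = X \<and> t X = X}"
    unfolding assms(6) fixed_subalgebra_def so_lie_8 Rep_mat8_inject by auto
  define \<psi> where "\<psi> M = Rep_mat8 (\<phi> (Abs_mat8 M))" for M
  have \<psi>: "lie_automorphism (so_lie 8) \<psi>" using lie_automorphism_of_aut[OF \<phi>] by (simp add: \<psi>_def[abs_def])
  have \<psi>k: "\<psi> ` k = Rep_mat8 ` \<phi> ` {X \<in> so8. s X = X \<and> t X = X}"
    unfolding k image_image by (simp add: \<psi>_def Rep_mat8_inverse)
  from cases show ?thesis
  proof (elim disjE exE conjE)
    fix ns assume ns: "length ns = 3" "sum_list ns = 8" "\<forall>n\<in>set ns. 1 \<le> n" "\<phi> ` {X \<in> so8. s X = X \<and> t X = X} = so_blocks ns"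
    then obtain n1 n2 n3 where n: "ns = [n1, n2, n3]" by (auto simp: length_Suc_conv numeral_3_eq_3)
    have "\<psi> ` k = block_sum [so_lie n1, so_lie n2, so_lie n3]" using \<psi>k ns(2,4) Rep_so_blocks[of ns] n by simp
    thus ?thesis using \<psi> ns(2,3) n by (intro exI[of _ \<psi>] conjI disjI1 exI[of _ n1] exI[of _ n2] exI[of _ n3]) auto
  next
    fix ns assume ns: "length ns = 4" "sum_list ns = 8" "\<forall>n\<in>set ns. 1 \<le> n" "\<phi> ` {X \<in> so8. s X = X \<and> t X = X} = so_blocks ns"
    then obtain n1 n2 n3 n4 where n: "ns = [n1, n2, n3, n4]" by (auto simp: length_Suc_conv eval_nat_numeral)
    have "\<psi> ` k = block_sum [so_lie n1, so_lie n2, so_lie n3, so_lie n4]" using \<psi>k ns(2,4) Rep_so_blocks[of ns] n by simp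
    thus ?thesis using \<psi> ns(2,3) n
      by (intro exI[of _ \<psi>] conjI disjI2 disjI1 exI[of _ n1] exI[of _ n2] exI[of _ n3] exI[of _ n4]) auto
  next
    assume "\<phi> ` {X \<in> so8. s X = X \<and> t X = X} = u3_u1"
    hence "\<psi> ` k = realify ` block_sum [u_lie 3, u_lie 1]" using \<psi>k Rep_u3_u1 by simp
    thus ?thesis using \<psi> by (intro exI[of _ \<psi>] conjI disjI2)
  qed
qed

end
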